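(* Suppose $\mathcal G$ is a connected metric graph whose completion $\overline{\mathcal G}$ is weakly connected and compact. Assume there is an edge weight $\omega:\mathcal E\to(0,\infty)$ with $\omega(\mathcal G)=\sum_{e}\omega(e)<\infty$, and that the nonnegative locally integrable function $q:\mathcal G\to\mathbb R$ satisfies $$\int_{\mathcal G}(\omega^{-1}q)^2\,\omega=\sum_{e\in\mathcal E}\int_e \Big(\frac{q(x)}{\omega(e)}\Big)^2\omega(e)\,dx<\infty .$$ If $\partial\overline{\mathcal G}\neq\emptyset$, then every continuous function $U:\partial\overline{\mathcal G}\to\mathbb R$ has a unique extension to a continuous function $u:\overline{\mathcal G}\to\mathbb R$ that is $q$-harmonic on $\mathcal G$.
   Context: A metric graph $\mathcal G$ is a locally finite graph with countable vertex set and edge set $\mathcal E$, without loops or multiple edges, in which each edge is identified with a real interval of finite positive length; Lebesgue measure on the intervals gives a measure on $\mathcal G$. The distance $d(p_1,p_2)$ is the infimum of lengths of paths (of finitely many intervals) joining $p_1$ and $p_2$; $\overline{\mathcal G}$ is the metric completion. $\partial\mathcal G$ is the set of boundary vertices (vertices of degree one) and $\partial\overline{\mathcal G}=\partial\mathcal G\cup(\overline{\mathcal G}\setminus\mathcal G)$. $\overline{\mathcal G}$ is weakly connected if for every pair of distinct points $x,y\in\overline{\mathcal G}$ there is a finite set of points $W\subset\mathcal G$ and disjoint open sets $U,V$ with $\overline{\mathcal G}\setminus W=U\cup V$, $x\in U$, $y\in V$. A function $u:\mathcal G\to\mathbb R$ is $q$-harmonic if on each edge $u'$ is absolutely continuous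 and $u''=qu$ almost everywhere, and at each vertex $v$ of degree at least $2$: (i) the limits of $u$ at $v$ along all incident edges agree ($u$ is continuous at $v$); (ii) $\sum_{e(i)\sim v}\partial_\nu u_i(v)=0$, where $u_i$ is the restriction of $u$ to the incident edge $e(i)$ and $\partial_\nu u_i(v)$ is the derivative at $v$ in the local coordinate identifying $e(i)$ with $[a,b]$ so that $a$ corresponds to $v$. *)

theory Defs
  imports "HOL-Analysis.Analysis"
begin

text \<open>
  An edge is an ordered pair of its two endpoints. The order only fixes the coordinate: an edge
  \<open>e\<close> is identified with the interval \<open>[0, len e]\<close>, where \<open>0\<close> corresponds to \<open>fst e\<close> and \<open>len e\<close>
  to \<open>snd e\<close>. Multiple edges are excluded by allowing only one orientation of each edge.
\<close>

record 'v mgraph =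
  verts :: "'v set"
  edges :: "('v \<times> 'v) set"
  len :: "'v \<times> 'v \<Rightarrow> real"

definition incident :: "'v mgraph \<Rightarrow> 'v \<Rightarrow> ('v \<times> 'v) set" where
  "incident G v = {e \<in> edges G. v = fst e \<or> v = snd e}"

definition metric_graph :: "'v mgraph \<Rightarrow> bool" where
  "metric_graph G \<longleftrightarrow>
     countable (verts G) \<and>
     edges G \<subseteq> verts G \<times> verts G \<and>
     (\<forall>v. (v, v) \<notin> edges G) \<and>
     (\<forall>v w. (v, w) \<in> edges G \<longrightarrow> (w, v) \<notin> edges G) \<and>
     (\<forall>v\<in>verts G. finite (incident G v)) \<and>
     (\<forall>e\<in>edges G. 0 < len G e)"

datatype 'v point = Vertex 'v | Inner "'v \<times> 'v" real

definition points :: "'v mgraph \<Rightarrow> 'v point set" where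
  "points G = Vertex ` verts G \<union> {Inner e t | e t. e \<in> edges G \<and> 0 < t \<and> t < len G e}"

definition edge_point :: "'v mgraph \<Rightarrow> 'v \<times> 'v \<Rightarrow> real \<Rightarrow> 'v point" where
  "edge_point G e t =
     (if t = 0 then Vertex (fst e) else if t = len G e then Vertex (snd e) else Inner e t)"

text \<open>\<open>joined G p l r\<close>: some path consisting of finitely many intervals, of total length \<open>l\<close>,
  leads from \<open>p\<close> to \<open>r\<close>.\<close>

inductive joined :: "'v mgraph \<Rightarrow> 'v point \<Rightarrow> real \<Rightarrow> 'v point \<Rightarrow> bool" for G where
  refl: "p \<in> points G \<Longrightarrow> joined G p 0 p"
| step: "joined G p l (edge_point G e s) \<Longrightarrow> e \<in> edges G \<Longrightarrow>
         s \<in> {0..len G e} \<Longrightarrow> t \<in> {0..len G e} \<Longrightarrow>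
         joined G p (l + \<bar>t - s\<bar>) (edge_point G e t)"

definition graph_connected :: "'v mgraph \<Rightarrow> bool" where
  "graph_connected G \<longleftrightarrow> (\<forall>p\<in>points G. \<forall>r\<in>points G. \<exists>l. joined G p l r)"

definition graph_dist :: "'v mgraph \<Rightarrow> 'v point \<Rightarrow> 'v point \<Rightarrow> real" where
  "graph_dist G p r = Inf {l. joined G p l r}"

text \<open>
  The metric completion is determined up to isometry: it is a complete metric space \<open>X\<close>
  together with an isometric map \<open>j\<close> from the points of the graph onto a dense subset of \<open>X\<close>.
\<close>

definition is_completion ::
    "'v mgraph \<Rightarrow> ('v point \<Rightarrow> 'c::metric_space) \<Rightarrow> 'c set \<Rightarrow> bool" where
  "is_completion G j X \<longleftrightarrow>
     complete X \<and> j ` points G \<subseteq> X \<and> X \<subseteq> closure (j ` points G) \<and>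
     (\<forall>p\<in>points G. \<forall>r\<in>points G. dist (j p) (j r) = graph_dist G p r)"

definition boundary_verts :: "'v mgraph \<Rightarrow> 'v set" where
  "boundary_verts G = {v \<in> verts G. card (incident G v) = 1}"

definition completion_boundary ::
    "'v mgraph \<Rightarrow> ('v point \<Rightarrow> 'c) \<Rightarrow> 'c set \<Rightarrow> 'c set" where
  "completion_boundary G j X = j ` Vertex ` boundary_verts G \<union> (X - j ` points G)"

definition weakly_connected ::
    "'v mgraph \<Rightarrow> ('v point \<Rightarrow> 'c::metric_space) \<Rightarrow> 'c set \<Rightarrow> bool" where
  "weakly_connected G j X \<longleftrightarrow>
     (\<forall>x\<in>X. \<forall>y\<in>X. x \<noteq> y \<longrightarrow>
        (\<exists>W U V. finite W \<and> W \<subseteq> j ` points G \<and>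
           openin (top_of_set X) U \<and> openin (top_of_set X) V \<and> U \<inter> V = {} \<and>
           X - W = U \<union> V \<and> x \<in> U \<and> y \<in> V))"

definition locally_integrable :: "'v mgraph \<Rightarrow> ('v point \<Rightarrow> real) \<Rightarrow> bool" where
  "locally_integrable G q \<longleftrightarrow>
     (\<forall>e\<in>edges G. (\<lambda>t. q (edge_point G e t)) absolutely_integrable_on {0..len G e})"

definition absolutely_continuous_on :: "real \<Rightarrow> real \<Rightarrow> (real \<Rightarrow> real) \<Rightarrow> bool" where
  "absolutely_continuous_on a b f \<longleftrightarrow>
     (\<forall>\<epsilon>>0. \<exists>\<delta>>0. \<forall>D.
        finite D \<and> (\<forall>(c, d)\<in>D. a \<le> c \<and> c \<le> d \<and> d \<le> b) \<and>
        pairwise (\<lambda>(c, d) (c', d'). {c<..<d} \<inter> {c'<..<d'} = {}) D \<and>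
        (\<Sum>(c, d)\<in>D. d - c) < \<delta> \<longrightarrow>
        (\<Sum>(c, d)\<in>D. \<bar>f d - f c\<bar>) < \<epsilon>)"

text \<open>The local coordinate on the edge \<open>e\<close> in which \<open>0\<close> corresponds to the endpoint \<open>v\<close>.\<close>

definition coord_from :: "'v mgraph \<Rightarrow> 'v \<Rightarrow> 'v \<times> 'v \<Rightarrow> real \<Rightarrow> 'v point" where
  "coord_from G v e t = edge_point G e (if v = fst e then t else len G e - t)"

definition normal_deriv :: "'v mgraph \<Rightarrow> ('v point \<Rightarrow> real) \<Rightarrow> 'v \<Rightarrow> 'v \<times> 'v \<Rightarrow> real" where
  "normal_deriv G u v e =
     vector_derivative (\<lambda>t. u (coord_from G v e t)) (at 0 within {0..len G e})"

text \<open>On the closed edge the derivative \<open>u'\<close> is one-sided at the two endpoints, so the normal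
  derivatives below always exist.\<close>

definition q_harmonic :: "'v mgraph \<Rightarrow> ('v point \<Rightarrow> real) \<Rightarrow> ('v point \<Rightarrow> real) \<Rightarrow> bool" where
  "q_harmonic G q u \<longleftrightarrow>
     (\<forall>e\<in>edges G. \<exists>u'.
        (\<forall>t\<in>{0..len G e}.
           ((\<lambda>s. u (edge_point G e s)) has_real_derivative u' t) (at t within {0..len G e})) \<and>
        absolutely_continuous_on 0 (len G e) u' \<and>
        (AE t in lebesgue. t \<in> {0<..<len G e} \<longrightarrow>
           (u' has_real_derivative q (edge_point G e t) * u (edge_point G e t)) (at t))) \<and>
     (\<forall>v\<in>verts G. 2 \<le> card (incident G v) \<longrightarrow>
        (\<forall>e\<in>incident G v. ((\<lambda>t. u (coord_from G v e t)) \<longlongrightarrow> u (Vertex v)) (at_right 0)) \<and>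
        (\<Sum>e\<in>incident G v. normal_deriv G u v e) = 0)"

end

theory Submission
  imports Defs
begin

text \<open>
  On an edge of length \<open>L\<close> a solution of \<open>u'' = q u\<close> is determined by its end values \<open>a\<close>, \<open>b\<close>, and its
  energy \<open>\<integral> u'\<^sup>2 + q u\<^sup>2\<close> is a quadratic form in \<open>(a, b)\<close> that is at least \<open>(b - a)\<^sup>2 / L\<close>. A \<open>q\<close>-harmonic
  function is therefore the same thing as a function on the vertices whose flux vanishes at every
  vertex off the boundary.

  Call boundary data flat if they extend to a continuous function on the completion taking equal
  values at the two ends of all but finitely many edges. Because \<open>2 q \<le> q\<^sup>2 / \<omega> + \<omega>\<close> and edge lengths
  are bounded, \<open>q\<close> is integrable over the graph, so such an extension has finite energy. Minimise the
  energy over its modifications at finitely many vertices off the boundary. By the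
  parallelogram law the differences in a minimising sequence have small energy, and since they
  vanish at some vertex within bounded distance of any given one, Cauchy--Schwarz along walks makes
  the sequence uniformly Cauchy. The limit has zero flux and still tends to the prescribed data at
  the ideal points.

  Weak connectedness makes flat functions separate points, so by the Stone--Weierstrass theorem they
  are dense in the continuous boundary data, and the maximum principle, which also yields
  uniqueness, carries the solutions to the uniform limit.
\<close>

section \<open>Absolutely continuous functions\<close>

text \<open>For general continuous data no extension of finite energy is at hand, hence the detour
  through flat data. The completion is bounded, so energy controls the supremum norm of a function
  that vanishes at some vertex. In this sense every point has positive capacity, and a limit of
  minimising functions cannot lose its boundary values, even at a single ideal point. Ideal points
  are not vertices and cannot be held fixed directly. Modifying only finitely many vertices replaces
  this: the uniform limit differs from the given function by more than a given amount at finitely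
  many vertices only, and these keep away from any ideal point. There remain the interiors of edges.
  By compactness only finitely many edges exceed a given length, so the edges near an ideal point
  are short, and on a short edge a solution stays close to its end values.\<close>

lemma sum_integral_disjoint_le:
  fixes g :: "real \<Rightarrow> real"
  assumes g: "g integrable_on {a..b}" and nn: "\<And>x. x \<in> {a..b} \<Longrightarrow> 0 \<le> g x"
    and D: "finite D" "\<forall>(c, d)\<in>D. a \<le> c \<and> c \<le> d \<and> d \<le> b"
    and disj: "pairwise (\<lambda>(c, d) (c', d'). {c<..<d} \<inter> {c'<..<d'} = {}) D"
  shows "(\<Sum>(c, d)\<in>D. integral {c..d} g) \<le> integral {a..b} g"
proof -
  let ?I = "\<lambda>(c::real, d::real). {c<..<d}"
  have "(g has_integral (\<Sum>p\<in>D. (\<lambda>(c, d). integral {c..d} g) p)) (\<Union>p\<in>D. ?I p)"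
  proof (rule has_integral_UN[OF D(1)])
    fix p assume p: "p \<in> D"
    obtain c d where cd: "p = (c, d)" by fastforce
    have "g integrable_on {c..d}"
      by (rule integrable_on_subinterval[OF g]) (use D(2) p cd in auto)
    then show "(g has_integral (\<lambda>(c, d). integral {c..d} g) p) (?I p)"
      using cd by (simp add: has_integral_integral has_integral_Icc_iff_Ioo)
  next
    show "pairwise (\<lambda>i i'. negligible (?I i \<inter> ?I i')) D"
      using disj by (rule pairwise_mono) (auto simp: split_beta)
  qed
  moreover have "(\<Union>p\<in>D. ?I p) \<subseteq> {a..b}" using D(2) by fastforce
  ultimately show ?thesis
    using has_integral_subset_le[OF _ _ integrable_integral[OF g]] nn by blast
qed

text \<open>Truncate \<open>\<bar>f\<bar>\<close> at height \<open>n\<close>: the part above has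
  small integral, and the part below contributes at most \<open>n\<close> times the total
  length.\<close>

lemma absolutely_continuous_on_integral:
  fixes f :: "real \<Rightarrow> real"
  assumes f: "f absolutely_integrable_on {a..b}"
  shows "absolutely_continuous_on a b (\<lambda>t. integral {a..t} f)"
  unfolding absolutely_continuous_on_def
proof (intro allI impI)
  fix e :: real assume e: "e > 0"
  let ?m = "\<lambda>n x. min \<bar>f x\<bar> (real n)"
  have fi: "f integrable_on {a..b}" and af: "(\<lambda>x. \<bar>f x\<bar>) integrable_on {a..b}"
    using f by (auto simp: absolutely_integrable_on_def)
  have meas: "(\<lambda>x. \<bar>f x\<bar>) \<in> borel_measurable (lebesgue_on {a..b})"
    using af by (rule integrable_imp_measurable)
  have mi: "?m n integrable_on {a..b}" for n
  proof -
    have "?m n absolutely_integrable_on {a..b}"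
      by (rule measurable_bounded_by_integrable_imp_absolutely_integrable[OF _ _ af])
         (use meas in auto)
    then show ?thesis by (auto simp: absolutely_integrable_on_def)
  qed
  have "(\<lambda>n. integral {a..b} (?m n)) \<longlonglongrightarrow> integral {a..b} (\<lambda>x. \<bar>f x\<bar>)"
  proof (rule dominated_convergence(2)[OF mi af])
    fix x
    have "\<forall>\<^sub>F n in sequentially. ?m n x = \<bar>f x\<bar>"
      using eventually_ge_at_top[of "nat \<lceil>\<bar>f x\<bar>\<rceil>"]
      by eventually_elim linarith
    then show "(\<lambda>n. ?m n x) \<longlonglongrightarrow> \<bar>f x\<bar>" by (rule tendsto_eventually)
  qed auto
  then obtain n where n: "\<bar>integral {a..b} (?m n) - integral {a..b} (\<lambda>x. \<bar>f x\<bar>)\<bar> < e/2"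
    using e LIMSEQ_D[of _ _ "e/2"] by (metis half_gt_zero order_refl real_norm_def)
  let ?r = "\<lambda>x. \<bar>f x\<bar> - ?m n x"
  have ri: "?r integrable_on {a..b}" using af mi by (rule integrable_diff)
  have rint: "integral {a..b} ?r < e/2"
    unfolding integral_diff[OF af mi] using n by linarith
  show "\<exists>\<delta>>0. \<forall>D. finite D \<and> (\<forall>(c, d)\<in>D. a \<le> c \<and> c \<le> d \<and> d \<le> b) \<and>
        pairwise (\<lambda>(c, d) (c', d'). {c<..<d} \<inter> {c'<..<d'} = {}) D \<and>
        (\<Sum>(c, d)\<in>D. d - c) < \<delta> \<longrightarrow>
        (\<Sum>(c, d)\<in>D. \<bar>integral {a..d} f - integral {a..c} f\<bar>) < e"
  proof (intro exI conjI allI impI)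
    show "0 < e / (2 * (real n + 1))" using e by simp
    fix D assume *: "finite D \<and> (\<forall>(c, d)\<in>D. a \<le> c \<and> c \<le> d \<and> d \<le> b) \<and>
        pairwise (\<lambda>(c, d) (c', d'). {c<..<d} \<inter> {c'<..<d'} = {}) D \<and>
        (\<Sum>(c, d)\<in>D. d - c) < e / (2 * (real n + 1))"
    have le: "\<bar>integral {a..d} f - integral {a..c} f\<bar> \<le> integral {c..d} ?r + (real n + 1) * (d - c)"
      if "(c, d) \<in> D" for c d
    proof -
      have cd: "a \<le> c" "c \<le> d" "d \<le> b" using that * by auto
      have sub: "h integrable_on {c..d}" if "h integrable_on {a..b}" for h :: "real \<Rightarrow> real"
        using that cd integrable_on_subinterval by (metis atLeastatMost_subset_iff)
      have "f integrable_on {a..d}" using fi cd integrable_on_subinterval by (metis atLeastatMost_subset_iff order_refl)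
      then have "integral {a..d} f - integral {a..c} f = integral {c..d} f"
        using Henstock_Kurzweil_Integration.integral_combine[where a=a and c=c and b=d and f=f] cd by simp
      also have "\<bar>\<dots>\<bar> \<le> integral {c..d} (\<lambda>x. ?r x + (real n + 1))"
      proof (rule integral_norm_bound_integral[where f=f, unfolded real_norm_def])
        show "(\<lambda>x. ?r x + (real n + 1)) integrable_on {c..d}"
          using sub[OF ri] by (intro integrable_add) auto
      qed (use sub fi in auto)
      also have "\<dots> = integral {c..d} ?r + (real n + 1) * (d - c)"
        using integral_add[OF sub[OF ri] integrable_const_ivl, of "real n + 1"] cd by (simp add: mult.commute)
      finally show ?thesis .
    qed
    have "(\<Sum>(c, d)\<in>D. \<bar>integral {a..d} f - integral {a..c} f\<bar>) \<le>
        (\<Sum>(c, d)\<in>D. integral {c..d} ?r + (real n + 1) * (d - c))"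
      by (rule sum_mono) (use le in auto)
    also have "\<dots> = (\<Sum>(c, d)\<in>D. integral {c..d} ?r) + (real n + 1) * (\<Sum>(c, d)\<in>D. d - c)"
      by (simp add: split_beta sum.distrib sum_distrib_left)
    also have "(\<Sum>(c, d)\<in>D. integral {c..d} ?r) \<le> integral {a..b} ?r"
      by (rule sum_integral_disjoint_le[OF ri]) (use * in auto)
    also have "(real n + 1) * (\<Sum>(c, d)\<in>D. d - c) \<le> (real n + 1) * (e / (2 * (real n + 1)))"
      by (rule mult_left_mono) (use * in auto)
    also have "\<dots> = e/2" by (simp add: field_simps)
    finally show "(\<Sum>(c, d)\<in>D. \<bar>integral {a..d} f - integral {a..c} f\<bar>) < e"
      using rint by linarith
  qed
qed

lemma absolutely_continuous_onD:
  assumes "absolutely_continuous_on a b f" "0 < \<epsilon>"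
  obtains \<delta> where "0 < \<delta>"
    "\<And>D. finite D \<Longrightarrow> \<forall>(c, d)\<in>D. a \<le> c \<and> c \<le> d \<and> d \<le> b \<Longrightarrow>
        pairwise (\<lambda>(c, d) (c', d'). {c<..<d} \<inter> {c'<..<d'} = {}) D \<Longrightarrow>
        (\<Sum>(c, d)\<in>D. d - c) < \<delta> \<Longrightarrow> (\<Sum>(c, d)\<in>D. \<bar>f d - f c\<bar>) < \<epsilon>"
  using assms unfolding absolutely_continuous_on_def by meson

text \<open>The common source of the closure rules for differences, products of bounded functions
  and added constants.\<close>

lemma absolutely_continuous_on_bound:
  assumes f: "absolutely_continuous_on a b f" and g: "absolutely_continuous_on a b g"
    and h: "\<And>c d. a \<le> c \<Longrightarrow> c \<le> d \<Longrightarrow> d \<le> b \<Longrightarrow>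
      \<bar>h d - h c\<bar> \<le> M * \<bar>f d - f c\<bar> + M * \<bar>g d - g c\<bar>" and M: "0 < M"
  shows "absolutely_continuous_on a b h"
  unfolding absolutely_continuous_on_def
proof (intro allI impI)
  fix e :: real assume e: "e > 0"
  then have e': "e / (2 * M) > 0" using M by simp
  obtain r where r: "r > 0" "\<And>D. finite D \<Longrightarrow> \<forall>(c, d)\<in>D. a \<le> c \<and> c \<le> d \<and> d \<le> b \<Longrightarrow>
        pairwise (\<lambda>(c, d) (c', d'). {c<..<d} \<inter> {c'<..<d'} = {}) D \<Longrightarrow>
        (\<Sum>(c, d)\<in>D. d - c) < r \<Longrightarrow> (\<Sum>(c, d)\<in>D. \<bar>f d - f c\<bar>) < e / (2 * M)"
    using absolutely_continuous_onD[OF f e'] by blast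
  obtain s where s: "s > 0" "\<And>D. finite D \<Longrightarrow> \<forall>(c, d)\<in>D. a \<le> c \<and> c \<le> d \<and> d \<le> b \<Longrightarrow>
        pairwise (\<lambda>(c, d) (c', d'). {c<..<d} \<inter> {c'<..<d'} = {}) D \<Longrightarrow>
        (\<Sum>(c, d)\<in>D. d - c) < s \<Longrightarrow> (\<Sum>(c, d)\<in>D. \<bar>g d - g c\<bar>) < e / (2 * M)"
    using absolutely_continuous_onD[OF g e'] by blast
  show "\<exists>\<delta>>0. \<forall>D. finite D \<and> (\<forall>(c, d)\<in>D. a \<le> c \<and> c \<le> d \<and> d \<le> b) \<and>
        pairwise (\<lambda>(c, d) (c', d'). {c<..<d} \<inter> {c'<..<d'} = {}) D \<and>
        (\<Sum>(c, d)\<in>D. d - c) < \<delta> \<longrightarrow>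
        (\<Sum>(c, d)\<in>D. \<bar>h d - h c\<bar>) < e"
  proof (intro exI conjI allI impI)
    show "0 < min r s" using r s by simp
    fix D assume *: "finite D \<and> (\<forall>(c, d)\<in>D. a \<le> c \<and> c \<le> d \<and> d \<le> b) \<and>
        pairwise (\<lambda>(c, d) (c', d'). {c<..<d} \<inter> {c'<..<d'} = {}) D \<and>
        (\<Sum>(c, d)\<in>D. d - c) < min r s"
    have "(\<Sum>(c, d)\<in>D. \<bar>h d - h c\<bar>) \<le> (\<Sum>(c, d)\<in>D. M * \<bar>f d - f c\<bar> + M * \<bar>g d - g c\<bar>)"
      by (rule sum_mono) (use h * in auto)
    also have "\<dots> = M * (\<Sum>(c, d)\<in>D. \<bar>f d - f c\<bar>) + M * (\<Sum>(c, d)\<in>D. \<bar>g d - g c\<bar>)"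
      by (simp add: split_beta sum.distrib sum_distrib_left)
    also have "\<dots> < M * (e / (2 * M)) + M * (e / (2 * M))"
      using r(2)[of D] s(2)[of D] * M by (intro add_strict_mono mult_strict_left_mono) auto
    also have "\<dots> = e" using M by simp
    finally show "(\<Sum>(c, d)\<in>D. \<bar>h d - h c\<bar>) < e" .
  qed
qed

lemma absolutely_continuous_on_diff:
  assumes "absolutely_continuous_on a b f" "absolutely_continuous_on a b g"
  shows "absolutely_continuous_on a b (\<lambda>t. f t - g t)"
  by (rule absolutely_continuous_on_bound[OF assms, where M=1]) auto

lemma absolutely_continuous_on_mult:
  assumes ac: "absolutely_continuous_on a b f" "absolutely_continuous_on a b g"
    and bd: "\<And>t. t \<in> {a..b} \<Longrightarrow> \<bar>f t\<bar> \<le> M" "\<And>t. t \<in> {a..b} \<Longrightarrow> \<bar>g t\<bar> \<le> M"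
  shows "absolutely_continuous_on a b (\<lambda>t. f t * g t)"
proof (rule absolutely_continuous_on_bound[OF ac, where M="\<bar>M\<bar> + 1"])
  fix c d assume cd: "a \<le> c" "c \<le> d" "d \<le> b"
  have "f d * g d - f c * g c = f d * (g d - g c) + g c * (f d - f c)" by (simp add: algebra_simps)
  also have "\<bar>\<dots>\<bar> \<le> \<bar>f d\<bar> * \<bar>g d - g c\<bar> + \<bar>g c\<bar> * \<bar>f d - f c\<bar>"
    by (metis abs_mult abs_triangle_ineq)
  also have "\<dots> \<le> (\<bar>M\<bar> + 1) * \<bar>g d - g c\<bar> + (\<bar>M\<bar> + 1) * \<bar>f d - f c\<bar>"
    using bd(1)[of d] bd(2)[of c] cd by (intro add_mono mult_right_mono) auto
  finally show "\<bar>f d * g d - f c * g c\<bar> \<le> (\<bar>M\<bar> + 1) * \<bar>f d - f c\<bar> + (\<bar>M\<bar> + 1) * \<bar>g d - g c\<bar>"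
    by simp
qed auto

section \<open>Differentiation of indefinite integrals almost everywhere\<close>

lemma integral_right_derivative:
  fixes f :: "real \<Rightarrow> real"
  assumes f: "\<And>a b. f integrable_on {a..b}"
  obtains N where "negligible N"
    "\<And>x e. x \<notin> N \<Longrightarrow> 0 < e \<Longrightarrow> \<exists>d>0. \<forall>h. 0 < h \<and> h < d \<longrightarrow> \<bar>integral {x..x+h} f - h * f x\<bar> \<le> e * h"
proof -
  obtain N where N: "negligible N"
    "\<And>x e. x \<notin> N \<Longrightarrow> 0 < e \<Longrightarrow> \<exists>d>0. \<forall>h. 0 < h \<and> h < d \<longrightarrow> \<bar>integral {x..x+h} f / h - f x\<bar> < e"
    using integrable_ccontinuous_explicit[of f] f
    by (simp add: divide_inverse_commute) blast
  have "\<bar>integral {x..x+h} f - h * f x\<bar> \<le> e * h" if "\<bar>integral {x..x+h} f / h - f x\<bar> < e" "0 < h" for x e h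
  proof -
    have "integral {x..x+h} f - h * f x = h * (integral {x..x+h} f / h - f x)"
      using that by (simp add: field_simps)
    then show ?thesis using that by (simp add: abs_mult mult.commute)
  qed
  then show thesis using N that by metis
qed

text \<open>The averages in \<open>integral_right_derivative\<close> lie to the right of the point;
  the left side comes from the reflected function, and both exceptional sets are discarded.
  Extension by zero makes the integrand integrable on every interval, as that lemma
  requires.\<close>

lemma has_real_derivative_integral_ae:
  fixes f :: "real \<Rightarrow> real"
  assumes f: "f integrable_on {a..b}"
  obtains N where "negligible N"
    "\<And>t. t \<in> {a<..<b} - N \<Longrightarrow> ((\<lambda>t. integral {a..t} f) has_real_derivative f t) (at t)"
proof -
  let ?F = "\<lambda>x. if x \<in> {a..b} then f x else 0"
  have Fi: "?F integrable_on {c..d}" for c d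
  proof -
    have "?F integrable_on UNIV" using f integrable_restrict_UNIV[of "{a..b}" f] by simp
    then show ?thesis by (rule integrable_on_subinterval) auto
  qed
  have Gi: "(\<lambda>x. ?F (- x)) integrable_on {c..d}" for c d
    using iffD2[OF Henstock_Kurzweil_Integration.integrable_reflect_real[where f="?F" and a="-d" and b="-c"] Fi] by simp
  obtain N where N: "negligible N" "\<And>x e. x \<notin> N \<Longrightarrow> 0 < e \<Longrightarrow> \<exists>d>0. \<forall>h. 0 < h \<and> h < d \<longrightarrow> \<bar>integral {x..x+h} ?F - h * ?F x\<bar> \<le> e * h"
    using integral_right_derivative[of ?F] Fi by blast
  obtain N' where N': "negligible N'" "\<And>x e. x \<notin> N' \<Longrightarrow> 0 < e \<Longrightarrow> \<exists>d>0. \<forall>h. 0 < h \<and> h < d \<longrightarrow> \<bar>integral {x..x+h} (\<lambda>x. ?F (- x)) - h * ?F (-x)\<bar> \<le> e * h"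
    using integral_right_derivative[of "\<lambda>x. ?F (- x)"] Gi by blast
  have neg: "negligible (N \<union> uminus ` N')"
    using N(1) negligible_differentiable_image_negligible[OF _ N'(1), of uminus]
    by (auto intro!: derivative_intros)
  have "((\<lambda>t. integral {a..t} f) has_real_derivative f t) (at t)" if t: "t \<in> {a<..<b} - (N \<union> uminus ` N')" for t
  proof -
    have t': "t \<notin> N" "-t \<notin> N'" "a < t" "t < b" using t by (auto simp: image_iff)
    show ?thesis
      unfolding has_field_derivative_def has_derivative_at_alt
    proof (intro conjI allI impI bounded_linear_mult_right)
      fix e :: real assume e: "0 < e"
      obtain d1 where d1: "d1 > 0" "\<And>h. 0 < h \<Longrightarrow> h < d1 \<Longrightarrow> \<bar>integral {t..t+h} ?F - h * ?F t\<bar> \<le> e * h"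
        using N(2)[OF t'(1) e] by blast
      obtain d2 where d2: "d2 > 0" "\<And>h. 0 < h \<Longrightarrow> h < d2 \<Longrightarrow> \<bar>integral {-t..-t+h} (\<lambda>x. ?F (- x)) - h * ?F (- (- t))\<bar> \<le> e * h"
        using N'(2)[OF t'(2) e] by blast
      let ?d = "min (min d1 d2) (min (t - a) (b - t))"
      show "\<exists>d>0. \<forall>y. norm (y - t) < d \<longrightarrow>
          norm (integral {a..y} f - integral {a..t} f - f t * (y - t)) \<le> e * norm (y - t)"
      proof (intro exI conjI allI impI)
        show "0 < ?d" using d1 d2 t' by auto
        fix y assume y: "norm (y - t) < ?d"
        have eqF: "integral {c..d} ?F = integral {c..d} f" if "a \<le> c" "d \<le> b" for c d
          by (rule integral_cong) (use that in auto)
        have sub: "f integrable_on {c..d}" if "a \<le> c" "d \<le> b" for c d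
          using f by (rule integrable_on_subinterval) (use that in auto)
        consider "y = t" | "t < y" | "y < t" by linarith
        then show "norm (integral {a..y} f - integral {a..t} f - f t * (y - t)) \<le> e * norm (y - t)"
        proof cases
          case 2
          have "\<bar>integral {t..y} f - (y - t) * f t\<bar> \<le> e * (y - t)"
            using d1(2)[of "y - t"] eqF[of t y] 2 y t' by auto
          moreover have "integral {a..y} f - integral {a..t} f = integral {t..y} f"
            using Henstock_Kurzweil_Integration.integral_combine[where a=a and c=t and b=y and f=f] sub[of a y] 2 y t' by auto
          ultimately show ?thesis using 2 by (simp add: mult.commute)
        next
          case 3
          have "integral {-t..-y} (\<lambda>x. ?F (- x)) = integral {y..t} ?F"
            using Henstock_Kurzweil_Integration.integral_reflect_real[where f="?F" and a=y and b=t] by simp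
          then have "\<bar>integral {y..t} f - (t - y) * f t\<bar> \<le> e * (t - y)"
            using d2(2)[of "t - y"] eqF[of y t] 3 y t' by auto
          moreover have "integral {a..t} f - integral {a..y} f = integral {y..t} f"
            using Henstock_Kurzweil_Integration.integral_combine[where a=a and c=y and b=t and f=f] sub[of a t] 3 y t' by auto
          ultimately show ?thesis using 3 by (simp add: algebra_simps abs_le_iff)
        qed auto
      qed
    qed
  qed
  then show thesis using neg that by blast
qed


text \<open>Cousin's lemma with a gauge that is an open set of small measure at the exceptional points:
  there absolute continuity bounds the increments, elsewhere the derivative does.\<close>

lemma absolutely_continuous_on_const:
  fixes f :: "real \<Rightarrow> real"
  assumes ac: "absolutely_continuous_on a b f" and ab: "a \<le> b" and N: "negligible N"
    and der: "\<And>t. t \<in> {a<..<b} - N \<Longrightarrow> (f has_real_derivative 0) (at t)"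
  shows "f b = f a"
proof -
  \<comment> \<open>The tags outside the exceptional set contribute \<open>e * (b - a)\<close>,
    those inside it the extra \<open>e\<close>.\<close>
  have "\<bar>f b - f a\<bar> \<le> e * (b - a + 1)" if e: "e > 0" for e
  proof -
    obtain \<delta> where \<delta>: "0 < \<delta>" "\<And>D. finite D \<Longrightarrow> \<forall>(c, d)\<in>D. a \<le> c \<and> c \<le> d \<and> d \<le> b \<Longrightarrow>
        pairwise (\<lambda>(c, d) (c', d'). {c<..<d} \<inter> {c'<..<d'} = {}) D \<Longrightarrow>
        (\<Sum>(c, d)\<in>D. d - c) < \<delta> \<Longrightarrow> (\<Sum>(c, d)\<in>D. \<bar>f d - f c\<bar>) < e"
      using absolutely_continuous_onD[OF ac e] by blast
    \<comment> \<open>The derivative is known on the open interval only, so the endpoints join the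
      exceptional set.\<close>
    define M where "M = N \<union> {a, b}"
    have M0: "M \<in> null_sets lebesgue"
      using N by (simp add: M_def negligible_iff_null_sets[symmetric])
    obtain T where T: "open T" "M \<subseteq> T" "T - M \<in> lmeasurable" "emeasure lebesgue (T - M) < ennreal \<delta>"
      using sets_lebesgue_outer_open[of M \<delta>] M0 \<delta>(1) by blast
    have "emeasure lebesgue T = emeasure lebesgue (T - M)"
      using M0 T(1) by (simp add: emeasure_Diff_null_set)
    then have T\<delta>: "T \<in> lmeasurable" "measure lebesgue T < \<delta>"
      using T \<delta>(1) by (auto simp: fmeasurable_def measure_def enn2real_less_iff less_top[symmetric])
    have "\<exists>r>0. \<forall>y. \<bar>y - t\<bar> < r \<longrightarrow> \<bar>f y - f t\<bar> \<le> e * \<bar>y - t\<bar>" if "t \<in> {a..b} - M" for t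
    proof -
      have "(f has_real_derivative 0) (at t)" using der[of t] that by (auto simp: M_def)
      then show ?thesis
        unfolding has_field_derivative_def has_derivative_at_alt using e by simp
    qed
    then obtain r where r: "\<And>t. t \<in> {a..b} - M \<Longrightarrow> 0 < r t"
        "\<And>t y. t \<in> {a..b} - M \<Longrightarrow> \<bar>y - t\<bar> < r t \<Longrightarrow> \<bar>f y - f t\<bar> \<le> e * \<bar>y - t\<bar>"
      by metis
    define \<gamma> where "\<gamma> t = (if t \<in> M then T else if t \<in> {a..b} then ball t (r t) else ball t 1)" for t
    have "gauge \<gamma>"
      unfolding gauge_def \<gamma>_def using T r(1) by auto
    then obtain p where p: "p tagged_division_of {a..b}" "\<gamma> fine p"
      using fine_division_exists_real by blast
    note pD = tagged_division_ofD[OF p(1)]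
    have box: "\<exists>c d. K = {c..d} \<and> a \<le> c \<and> c \<le> d \<and> d \<le> b \<and> c \<le> x \<and> x \<le> d" if xK: "(x, K) \<in> p" for x K
    proof -
      obtain c d where "K = {c..d}" using pD(4)[OF xK] by auto
      then show ?thesis using pD(2)[OF xK] pD(3)[OF xK] by auto
    qed
    define P where "P = {z \<in> p. fst z \<in> M}"
    have fP: "finite P" "finite p" "P \<subseteq> p" using pD(1) by (auto simp: P_def)
    let ?J = "\<lambda>(x::real, K::real set). (Inf K, Sup K)"
    \<comment> \<open>Two tagged intervals with the same pair of endpoints must be degenerate, since
      otherwise their interiors would meet; degenerate pairs contribute no increment, so the sum may
      be reindexed by endpoint pairs.\<close>
    have J: "?J z \<noteq> ?J w \<or> (Inf (snd z) = Sup (snd z))" "{Inf (snd z)<..<Sup (snd z)} \<inter> {Inf (snd w)<..<Sup (snd w)} = {}"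
      if "z \<in> p" "w \<in> p" "z \<noteq> w" for z w
    proof -
      obtain x K where z: "z = (x, K)" by fastforce
      obtain y L where w: "w = (y, L)" by fastforce
      have "(x, K) \<in> p" "(y, L) \<in> p" using that z w by auto
      then obtain c d c' d' where K: "K = {c..d}" "c \<le> d" and L: "L = {c'..d'}" "c' \<le> d'"
        using box[of x K] box[of y L] order_trans by metis
      have int: "interior K \<inter> interior L = {}"
        using pD(5)[of x K y L] that z w by blast
      then show "{Inf (snd z)<..<Sup (snd z)} \<inter> {Inf (snd w)<..<Sup (snd w)} = {}"
        using K L z w by (simp add: interior_atLeastAtMost_real)
      show "?J z \<noteq> ?J w \<or> (Inf (snd z) = Sup (snd z))"
      proof (rule ccontr)
        assume "\<not> ?thesis"
        then have "c = c'" "d = d'" "c < d" using K L z w by auto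
        then show False using int K L by (auto simp: interior_atLeastAtMost_real)
      qed
    qed
    have "f b - f a = (\<Sum>(x, K)\<in>p. f (Sup K) - f (Inf K))"
      using additive_tagged_division_1[OF ab p(1), of f] by simp
    also have "\<dots> = (\<Sum>(x, K)\<in>p - P. f (Sup K) - f (Inf K)) + (\<Sum>(x, K)\<in>P. f (Sup K) - f (Inf K))"
      using fP by (simp add: sum.subset_diff)
    also have "\<bar>\<dots>\<bar> \<le> \<bar>\<Sum>(x, K)\<in>p - P. f (Sup K) - f (Inf K)\<bar> + \<bar>\<Sum>(x, K)\<in>P. f (Sup K) - f (Inf K)\<bar>"
      by (rule abs_triangle_ineq)
    also have "\<dots> \<le> (\<Sum>z\<in>p - P. \<bar>f (Sup (snd z)) - f (Inf (snd z))\<bar>)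
         + (\<Sum>z\<in>P. \<bar>f (Sup (snd z)) - f (Inf (snd z))\<bar>)"
      unfolding split_beta by (intro add_mono sum_abs)
    also have "(\<Sum>z\<in>P. \<bar>f (Sup (snd z)) - f (Inf (snd z))\<bar>) = (\<Sum>(c, d)\<in>?J ` P. \<bar>f d - f c\<bar>)"
    proof (subst sum.reindex_nontrivial[OF fP(1)])
      fix z w assume "z \<in> P" "w \<in> P" "z \<noteq> w" "?J z = ?J w"
      then show "(case ?J z of (c, d) \<Rightarrow> \<bar>f d - f c\<bar>) = 0"
        using J(1)[of w z] fP by (force simp: split_beta)
    qed (simp add: split_beta)
    also have "\<dots> < e"
    proof (rule \<delta>(2))
      show "finite (?J ` P)" using fP by simp
      show "\<forall>(c, d)\<in>?J ` P. a \<le> c \<and> c \<le> d \<and> d \<le> b"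
        using box fP(3) by fastforce
      show pw: "pairwise (\<lambda>(c, d) (c', d'). {c<..<d} \<inter> {c'<..<d'} = {}) (?J ` P)"
        unfolding pairwise_def
      proof (intro ballI impI)
        fix i k assume "i \<in> ?J ` P" "k \<in> ?J ` P" "i \<noteq> k"
        then obtain z w where "z \<in> p" "w \<in> p" "z \<noteq> w" "i = ?J z" "k = ?J w" using fP by blast
        then show "(case i of (c, d) \<Rightarrow> \<lambda>(c', d'). {c<..<d} \<inter> {c'<..<d'} = {}) k"
          using J(2)[of z w] by (simp add: split_beta)
      qed
      have "(\<Sum>(c, d)\<in>?J ` P. d - c) = (\<Sum>i\<in>?J ` P. measure lebesgue ((\<lambda>(c, d). {c<..<d}) i))"
      proof (rule sum.cong[OF HOL.refl])
        fix i assume "i \<in> ?J ` P"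
        then obtain x K where xK: "(x, K) \<in> p" "i = (Inf K, Sup K)" using fP by auto
        then obtain c d where "K = {c..d}" "c \<le> d" using box[of x K] order_trans by metis
        then show "(case i of (c, d) \<Rightarrow> d - c) = measure lebesgue (case i of (c, d) \<Rightarrow> {c<..<d})"
          using xK by simp
      qed
      also have "\<dots> = measure lebesgue (\<Union>((\<lambda>(c, d). {c<..<d}) ` (?J ` P)))"
        by (rule measure_negligible_finite_Union_image[symmetric])
           (use fP pw in \<open>auto simp: pairwise_def split_beta\<close>)
      also have "\<dots> \<le> measure lebesgue T"
      proof (rule measure_mono_fmeasurable[OF _ _ T\<delta>(1)])
        show "\<Union>((\<lambda>(c, d). {c<..<d}) ` (?J ` P)) \<subseteq> T"
        proof clarsimp
          fix x K y assume *: "(x, K) \<in> P" "Inf K < y" "y < Sup K"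
          then have "K \<subseteq> \<gamma> x" using p(2) fP(3) by (auto simp: fine_def)
          then have "K \<subseteq> T" using *(1) by (simp add: \<gamma>_def P_def)
          moreover obtain c d where "K = {c..d}" "c \<le> d" using box[of x K] * fP by blast
          ultimately show "y \<in> T" using * by auto
        qed
        show "\<Union>((\<lambda>(c, d). {c<..<d}) ` (?J ` P)) \<in> sets lebesgue"
          using fP by (intro sets.finite_UN) auto
      qed
      finally show "(\<Sum>(c, d)\<in>?J ` P. d - c) < \<delta>" using T\<delta>(2) by linarith
    qed
    also have "(\<Sum>z\<in>p - P. \<bar>f (Sup (snd z)) - f (Inf (snd z))\<bar>) \<le> (\<Sum>z\<in>p - P. e * (Sup (snd z) - Inf (snd z)))"
    proof (rule sum_mono)
      fix z assume z: "z \<in> p - P"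
      obtain x K where zx: "z = (x, K)" by fastforce
      obtain c d where K: "K = {c..d}" "a \<le> c" "c \<le> d" "d \<le> b" "c \<le> x" "x \<le> d"
        using box[of x K] z zx by blast
      have x: "x \<in> {a..b} - M" using z zx K by (auto simp: P_def)
      have "K \<subseteq> ball x (r x)" using p(2) z zx x unfolding fine_def \<gamma>_def by fastforce
      then have "c \<in> ball x (r x)" "d \<in> ball x (r x)" using K(1,3) atLeastAtMost_iff order_refl by blast+
      then have "\<bar>c - x\<bar> < r x" "\<bar>d - x\<bar> < r x" by (auto simp: dist_real_def)
      then have "\<bar>f c - f x\<bar> \<le> e * \<bar>c - x\<bar>" "\<bar>f d - f x\<bar> \<le> e * \<bar>d - x\<bar>" using r(2)[OF x] by auto
      then have "\<bar>f d - f c\<bar> \<le> e * (x - c) + e * (d - x)" using K by simp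
      also have "\<dots> = e * (d - c)" by (simp add: algebra_simps)
      finally show "\<bar>f (Sup (snd z)) - f (Inf (snd z))\<bar> \<le> e * (Sup (snd z) - Inf (snd z))"
        using zx K by simp
    qed
    also have "\<dots> \<le> (\<Sum>z\<in>p. e * (Sup (snd z) - Inf (snd z)))"
      by (rule sum_mono2) (use fP box e in fastforce)+
    also have "\<dots> = e * (b - a)"
      using additive_tagged_division_1[OF ab p(1), of "\<lambda>x. x"] by (simp add: sum_distrib_left[symmetric] split_beta)
    finally show ?thesis by (simp add: algebra_simps)
  qed note * = this
  show ?thesis
  proof (rule ccontr)
    assume "f b \<noteq> f a"
    then have pos: "\<bar>f b - f a\<bar> > 0" by simp
    have "\<bar>f b - f a\<bar> \<le> \<bar>f b - f a\<bar> / (2 * (b - a + 1)) * (b - a + 1)"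
      by (rule *) (use pos ab in auto)
    also have "\<dots> = \<bar>f b - f a\<bar> / 2" using ab by (simp add: divide_simps)
    finally show False using pos by simp
  qed
qed

lemma absolutely_continuous_on_subinterval:
  assumes "absolutely_continuous_on a b f" "a \<le> c" "d \<le> b"
  shows "absolutely_continuous_on c d f"
  unfolding absolutely_continuous_on_def
proof (intro allI impI)
  fix e :: real assume "e > 0"
  then obtain \<delta> where \<delta>: "0 < \<delta>" "\<And>D. finite D \<Longrightarrow> \<forall>(c, d)\<in>D. a \<le> c \<and> c \<le> d \<and> d \<le> b \<Longrightarrow>
        pairwise (\<lambda>(c, d) (c', d'). {c<..<d} \<inter> {c'<..<d'} = {}) D \<Longrightarrow>
        (\<Sum>(c, d)\<in>D. d - c) < \<delta> \<Longrightarrow> (\<Sum>(c, d)\<in>D. \<bar>f d - f c\<bar>) < e"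
    using absolutely_continuous_onD[OF assms(1)] by blast
  show "\<exists>\<delta>>0. \<forall>D. finite D \<and> (\<forall>(x, y)\<in>D. c \<le> x \<and> x \<le> y \<and> y \<le> d) \<and>
        pairwise (\<lambda>(c, d) (c', d'). {c<..<d} \<inter> {c'<..<d'} = {}) D \<and>
        (\<Sum>(c, d)\<in>D. d - c) < \<delta> \<longrightarrow> (\<Sum>(c, d)\<in>D. \<bar>f d - f c\<bar>) < e"
    by (intro exI[of _ \<delta>] conjI allI impI \<delta>(1) \<delta>(2)) (use assms(2,3) in fastforce)+
qed

lemma absolutely_continuous_on_add_const:
  assumes "absolutely_continuous_on a b g" "\<And>t. t \<in> {a..b} \<Longrightarrow> f t = k + g t"
  shows "absolutely_continuous_on a b f"
  by (rule absolutely_continuous_on_bound[where M=1, OF assms(1) assms(1)]) (auto simp: assms(2))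

text \<open>The fundamental theorem for absolutely continuous functions: \<open>F\<close> minus the
  indefinite integral of \<open>g\<close> is absolutely continuous with derivative zero almost
  everywhere, hence constant.\<close>

lemma has_integral_absolutely_continuous:
  fixes F g :: "real \<Rightarrow> real"
  assumes ac: "absolutely_continuous_on a b F" and ab: "a \<le> b" and g: "g absolutely_integrable_on {a..b}"
    and N: "negligible N" and der: "\<And>t. t \<in> {a<..<b} - N \<Longrightarrow> (F has_real_derivative g t) (at t)"
  shows "(g has_integral F b - F a) {a..b}"
proof -
  have gi: "g integrable_on {a..b}" using g set_lebesgue_integral_eq_integral(1) by blast
  obtain N' where N': "negligible N'"
    "\<And>t. t \<in> {a<..<b} - N' \<Longrightarrow> ((\<lambda>t. integral {a..t} g) has_real_derivative g t) (at t)"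
    using has_real_derivative_integral_ae[OF gi] by blast
  have "F b - integral {a..b} g = F a - integral {a..a} g"
  proof (rule absolutely_continuous_on_const[where N="N \<union> N'" and f="\<lambda>t. F t - integral {a..t} g"])
    show "absolutely_continuous_on a b (\<lambda>t. F t - integral {a..t} g)"
      using ac absolutely_continuous_on_integral[OF g] by (rule absolutely_continuous_on_diff)
    show "((\<lambda>t. F t - integral {a..t} g) has_real_derivative 0) (at t)"
      if "t \<in> {a<..<b} - (N \<union> N')" for t
      using DERIV_diff[OF der[of t] N'(2)[of t]] that by auto
  qed (use ab N N' in auto)
  then have "F b - F a = integral {a..b} g" by simp
  then show ?thesis using integrable_integral[OF gi] by (simp only:)
qed

section \<open>The equation on one edge\<close>

definition edge_solution :: "real \<Rightarrow> (real \<Rightarrow> real) \<Rightarrow> (real \<Rightarrow> real) \<Rightarrow> (real \<Rightarrow> real) \<Rightarrow> bool" where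
  "edge_solution L q u u' \<longleftrightarrow>
     (\<forall>t\<in>{0..L}. (u has_real_derivative u' t) (at t within {0..L})) \<and>
     absolutely_continuous_on 0 L u' \<and>
     (AE t in lebesgue. t \<in> {0<..<L} \<longrightarrow> (u' has_real_derivative q t * u t) (at t))"

text \<open>The integrated form of the equation, which is linear without further argument; it is equivalent
  to \<open>edge_solution\<close> by the fundamental theorem for absolutely continuous functions.\<close>

definition ode_solution :: "real \<Rightarrow> (real \<Rightarrow> real) \<Rightarrow> (real \<Rightarrow> real) \<Rightarrow> (real \<Rightarrow> real) \<Rightarrow> bool" where
  "ode_solution L q u u' \<longleftrightarrow>
     (\<forall>t\<in>{0..L}. (u has_real_derivative u' t) (at t within {0..L}) \<and>
        ((\<lambda>s. q s * u s) has_integral u' t - u' 0) {0..t})"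

lemma ode_solution_deriv:
  "ode_solution L q u u' \<Longrightarrow> t \<in> {0..L} \<Longrightarrow> (u has_real_derivative u' t) (at t within {0..L})"
  by (simp add: ode_solution_def)

lemma ode_solution_has_integral:
  "ode_solution L q u u' \<Longrightarrow> t \<in> {0..L} \<Longrightarrow> ((\<lambda>s. q s * u s) has_integral u' t - u' 0) {0..t}"
  by (simp add: ode_solution_def)

lemma ode_solution_combination:
  assumes "ode_solution L q u u'" "ode_solution L q v v'"
  shows "ode_solution L q (\<lambda>t. a * u t + b * v t) (\<lambda>t. a * u' t + b * v' t)"
  unfolding ode_solution_def
proof (intro ballI conjI)
  fix t assume t: "t \<in> {0..L}"
  show "((\<lambda>t. a * u t + b * v t) has_real_derivative a * u' t + b * v' t) (at t within {0..L})"
    using ode_solution_deriv[OF assms(1) t] ode_solution_deriv[OF assms(2) t]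
    by (auto intro!: derivative_eq_intros)
  have "((\<lambda>s. a * (q s * u s) + b * (q s * v s)) has_integral a * (u' t - u' 0) + b * (v' t - v' 0)) {0..t}"
    by (intro has_integral_add has_integral_mult_right ode_solution_has_integral[OF _ t] assms)
  then show "((\<lambda>s. q s * (a * u s + b * v s)) has_integral
      a * u' t + b * v' t - (a * u' 0 + b * v' 0)) {0..t}"
    by (simp add: algebra_simps)
qed

lemma has_real_derivative_within_reflect:
  assumes "(u has_real_derivative d) (at (L - t) within {0..L})" "t \<in> {0..L}"
  shows "((\<lambda>t. u (L - t)) has_real_derivative - d) (at t within {0..L})"
proof -
  have im: "(\<lambda>t. L - t) ` {0..L} \<subseteq> {0..L}" by auto
  have "((\<lambda>t. L - t) has_real_derivative - 1) (at t within {0..L})"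
    by (auto intro!: derivative_eq_intros)
  with has_field_derivative_subset[OF assms(1) im] show ?thesis
    using DERIV_image_chain[of u d "\<lambda>t. L - t" t "{0..L}" "-1"] by (simp add: o_def)
qed

text \<open>Carries the initial value problem at the right end to the one at 0, with the potential
  reflected as well.\<close>

lemma ode_solution_reflect:
  assumes "ode_solution L q u u'"
  shows "ode_solution L (\<lambda>t. q (L - t)) (\<lambda>t. u (L - t)) (\<lambda>t. - u' (L - t))"
  unfolding ode_solution_def
proof (intro ballI conjI)
  fix t assume t: "t \<in> {0..L}"
  then have t': "L - t \<in> {0..L}" "L \<in> {0..L}" by auto
  show "((\<lambda>t. u (L - t)) has_real_derivative - u' (L - t)) (at t within {0..L})"
    by (rule has_real_derivative_within_reflect[OF ode_solution_deriv[OF assms t'(1)] t])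
  let ?f = "\<lambda>s. q s * u s"
  have 1: "(?f has_integral u' (L - t) - u' 0) {0..L - t}" "(?f has_integral u' L - u' 0) {0..L}"
    using ode_solution_has_integral[OF assms] t' by auto
  have "?f integrable_on {L - t..L}"
    using integrable_on_subinterval[of ?f "{0..L}" "L - t" L] 1(2) t by (auto simp: integrable_on_def)
  then obtain i where i: "(?f has_integral i) {L - t..L}" by blast
  have "(?f has_integral (u' (L - t) - u' 0) + i) {0..L}"
    by (rule has_integral_combine[OF _ _ 1(1) i]) (use t in auto)
  then have "i = u' L - u' (L - t)" using has_integral_unique[OF 1(2)] by fastforce
  with i have *: "(?f has_integral u' L - u' (L - t)) (cbox (L - t) L)" by simp
  have "((\<lambda>x. ?f ((-1) *\<^sub>R x + L)) has_integral (u' L - u' (L - t)) /\<^sub>R 1) {0..t}"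
    using has_integral_affinity[OF *, of "-1" L] by simp
  then show "((\<lambda>s. q (L - s) * u (L - s)) has_integral - u' (L - t) - - u' (L - 0)) {0..t}"
    by (simp add: add.commute[of _ L])
qed

locale edge_ode =
  fixes L :: real and q :: "real \<Rightarrow> real"
  assumes L: "0 < L" and q: "q absolutely_integrable_on {0..L}"
    and q_nonneg: "t \<in> {0..L} \<Longrightarrow> 0 \<le> q t"
begin

lemma q_mult_absolutely_integrable:
  assumes "continuous_on {0..L} u"
  shows "(\<lambda>s. q s * u s) absolutely_integrable_on {0..L}"
proof -
  have "(\<lambda>s. u s * q s) absolutely_integrable_on {0..L}"
    using assms q by (intro absolutely_integrable_bounded_measurable_product_real)
      (auto intro: continuous_imp_measurable_on_sets_lebesgue compact_imp_bounded compact_continuous_image)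
  then show ?thesis by (simp add: mult.commute)
qed

lemma ode_solution_continuous:
  "ode_solution L q u u' \<Longrightarrow> continuous_on {0..L} u"
  by (auto simp: ode_solution_def intro!: DERIV_continuous_on)

lemma edge_solution_iff: "edge_solution L q u u' \<longleftrightarrow> ode_solution L q u u'"
proof
  assume es: "edge_solution L q u u'"
  then have "continuous_on {0..L} u" by (auto simp: edge_solution_def intro!: DERIV_continuous_on)
  note qu = q_mult_absolutely_integrable[OF this]
  obtain N where N: "N \<in> null_sets lebesgue" "{t. \<not> (t \<in> {0<..<L} \<longrightarrow> (u' has_real_derivative q t * u t) (at t))} \<subseteq> N"
    using es unfolding edge_solution_def eventually_ae_filter by auto
  show "ode_solution L q u u'"
    unfolding ode_solution_def
  proof (intro ballI conjI)
    fix t assume t: "t \<in> {0..L}"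
    show "(u has_real_derivative u' t) (at t within {0..L})" using es t by (simp add: edge_solution_def)
    show "((\<lambda>s. q s * u s) has_integral u' t - u' 0) {0..t}"
    proof (rule has_integral_absolutely_continuous)
      show "absolutely_continuous_on 0 t u'"
        using es t by (auto simp: edge_solution_def intro: absolutely_continuous_on_subinterval)
      show "(\<lambda>s. q s * u s) absolutely_integrable_on {0..t}"
        using qu by (rule absolutely_integrable_on_subinterval) (use t in auto)
      show "negligible N" using N by (simp add: negligible_iff_null_sets)
    qed (use N(2) t in auto)
  qed
next
  assume os: "ode_solution L q u u'"
  note qu = q_mult_absolutely_integrable[OF ode_solution_continuous[OF os]]
  then have qui: "(\<lambda>s. q s * u s) integrable_on {0..L}" by (rule set_lebesgue_integral_eq_integral(1))
  have u': "u' t = u' 0 + integral {0..t} (\<lambda>s. q s * u s)" if "t \<in> {0..L}" for t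
    using integral_unique[OF ode_solution_has_integral[OF os that]] by simp
  obtain N where N: "negligible N" "\<And>t. t \<in> {0<..<L} - N \<Longrightarrow>
      ((\<lambda>t. integral {0..t} (\<lambda>s. q s * u s)) has_real_derivative q t * u t) (at t)"
    using has_real_derivative_integral_ae[OF qui] by blast
  show "edge_solution L q u u'"
    unfolding edge_solution_def
  proof (intro conjI ballI)
    show "absolutely_continuous_on 0 L u'"
      using absolutely_continuous_on_integral[OF qu] u' by (rule absolutely_continuous_on_add_const)
    have "(u' has_real_derivative q t * u t) (at t)" if t: "t \<in> {0<..<L} - N" for t
    proof -
      have "((\<lambda>t. u' 0 + integral {0..t} (\<lambda>s. q s * u s)) has_real_derivative q t * u t) (at t)"
        using N(2)[OF t] by (auto intro!: derivative_eq_intros)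
      then show ?thesis
        by (rule has_field_derivative_transform_within_open[of _ _ _ "{0<..<L}"]) (use t in \<open>auto simp: u'[symmetric]\<close>)
    qed
    then show "AE t in lebesgue. t \<in> {0<..<L} \<longrightarrow> (u' has_real_derivative q t * u t) (at t)"
      using N(1) unfolding eventually_ae_filter by (intro bexI[of _ N]) (auto simp: negligible_iff_null_sets)
  qed (use os in \<open>auto simp: ode_solution_def\<close>)
qed

lemma ode_solution_deriv_continuous:
  assumes "ode_solution L q u u'"
  shows "continuous_on {0..L} u'"
proof -
  have "continuous_on {0..L} (\<lambda>t. u' 0 + integral {0..t} (\<lambda>s. q s * u s))"
    using ode_solution_has_integral[OF assms, of L] L
    by (intro continuous_intros indefinite_integral_continuous_1) (auto simp: integrable_on_def)
  moreover have "u' t = u' 0 + integral {0..t} (\<lambda>s. q s * u s)" if "t \<in> {0..L}" for t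
    using integral_unique[OF ode_solution_has_integral[OF assms that]] by simp
  ultimately show ?thesis by (metis (no_types, lifting) continuous_on_eq)
qed

lemma ode_solution_absolutely_continuous:
  assumes "ode_solution L q u u'"
  shows "absolutely_continuous_on 0 L u"
proof -
  have "(u' has_integral u t - u 0) {0..t}" if "t \<in> {0..L}" for t
  proof (rule fundamental_theorem_of_calculus)
    fix x assume "x \<in> {0..t}"
    then show "(u has_vector_derivative u' x) (at x within {0..t})"
      using ode_solution_deriv[OF assms, of x] that has_field_derivative_subset[of u "u' x" x "{0..L}" "{0..t}"]
      by (auto simp: has_real_derivative_iff_has_vector_derivative[symmetric])
  qed (use that in auto)
  then have u: "u t = u 0 + integral {0..t} u'" if "t \<in> {0..L}" for t
    using integral_unique[of u' "u t - u 0" "{0..t}"] that by simp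
  have "u' absolutely_integrable_on {0..L}"
    using ode_solution_deriv_continuous[OF assms] by (rule absolutely_integrable_continuous_real)
  note ac = absolutely_continuous_on_integral[OF this]
  show ?thesis using ac u by (rule absolutely_continuous_on_add_const)
qed

text \<open>Integration by parts: \<open>u * v'\<close> is a product of bounded absolutely
  continuous functions, and the equation for \<open>v\<close> gives its derivative almost
  everywhere.\<close>

lemma ode_solution_green:
  assumes u: "ode_solution L q u u'" and v: "ode_solution L q v v'"
  shows "((\<lambda>t. u' t * v' t + q t * u t * v t) has_integral u L * v' L - u 0 * v' 0) {0..L}"
proof -
  have cont: "continuous_on {0..L} u" "continuous_on {0..L} v" "continuous_on {0..L} u'" "continuous_on {0..L} v'"
    using u v ode_solution_continuous ode_solution_deriv_continuous by auto
  have bdd: "\<exists>M::real. \<forall>t\<in>{0..L}. \<bar>f t\<bar> \<le> M" if "continuous_on {0..L} f" for f :: "real \<Rightarrow> real"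
    using compact_imp_bounded[OF compact_continuous_image[OF that compact_Icc]] unfolding bounded_iff by simp
  obtain M1 M2 where M: "\<forall>t\<in>{0..L}. \<bar>u t\<bar> \<le> M1" "\<forall>t\<in>{0..L}. \<bar>v' t\<bar> \<le> M2"
    using bdd[OF cont(1)] bdd[OF cont(4)] by blast
  have v2: "edge_solution L q v v'" using v edge_solution_iff by simp
  obtain N where N: "N \<in> null_sets lebesgue" "{t. \<not> (t \<in> {0<..<L} \<longrightarrow> (v' has_real_derivative q t * v t) (at t))} \<subseteq> N"
    using v2 unfolding edge_solution_def eventually_ae_filter by auto
  show ?thesis
  proof (rule has_integral_absolutely_continuous[where N=N])
    show "absolutely_continuous_on 0 L (\<lambda>t. u t * v' t)"
    proof (rule absolutely_continuous_on_mult[where M="max M1 M2"])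
      show "absolutely_continuous_on 0 L v'" using v2 by (simp add: edge_solution_def)
    qed (use M ode_solution_absolutely_continuous[OF u] in \<open>auto simp: le_max_iff_disj\<close>)
    have "(\<lambda>t. u' t * v' t) absolutely_integrable_on {0..L}"
      by (intro absolutely_integrable_continuous_real continuous_intros cont)
    moreover have "(\<lambda>t. q t * (u t * v t)) absolutely_integrable_on {0..L}"
      by (intro q_mult_absolutely_integrable continuous_intros cont)
    ultimately show "(\<lambda>t. u' t * v' t + q t * u t * v t) absolutely_integrable_on {0..L}"
      by (simp add: mult.assoc set_integral_add(1))
    show "((\<lambda>t. u t * v' t) has_real_derivative u' t * v' t + q t * u t * v t) (at t)"
      if "t \<in> {0<..<L} - N" for t
    proof -
      have "(v' has_real_derivative q t * v t) (at t)" using N(2) that by auto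
      moreover have "(u has_real_derivative u' t) (at t)"
        using ode_solution_deriv[OF u, of t] that by (simp add: at_within_Icc_at)
      ultimately show ?thesis by (auto intro!: derivative_eq_intros)
    qed
  qed (use N L in \<open>auto simp: negligible_iff_null_sets\<close>)
qed

text \<open>By Green's formula the right-hand side is the integral of
  \<open>u'\<^sup>2 + q * u\<^sup>2\<close>. With the mean slope \<open>m\<close>, the pointwise
  inequality \<open>u'\<^sup>2 \<ge> 2 * m * u' - m\<^sup>2\<close> integrates to the bound, which
  is Cauchy--Schwarz in linearised form.\<close>

lemma ode_solution_energy:
  assumes u: "ode_solution L q u u'"
  shows "(u L - u 0)\<^sup>2 / L \<le> u L * u' L - u 0 * u' 0"
proof -
  define m where "m = (u L - u 0) / L"
  have "(u' has_integral u L - u 0) {0..L}"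
    using ode_solution_deriv[OF u] L
    by (intro fundamental_theorem_of_calculus) (auto simp: has_real_derivative_iff_has_vector_derivative[symmetric])
  then have "((\<lambda>t. 2 * m * u' t - m\<^sup>2) has_integral 2 * m * (u L - u 0) - m\<^sup>2 * L) {0..L}"
    using has_integral_const_real[of "m\<^sup>2" 0 L] L
    by (intro has_integral_diff has_integral_mult_right) (auto simp: mult.commute)
  then have "2 * m * (u L - u 0) - m\<^sup>2 * L \<le> u L * u' L - u 0 * u' 0"
  proof (rule has_integral_le[OF _ ode_solution_green[OF u u]])
    fix t assume t: "t \<in> {0..L}"
    have "0 \<le> (u' t - m)\<^sup>2 + q t * (u t)\<^sup>2" using q_nonneg[OF t] by simp
    then show "2 * m * u' t - m\<^sup>2 \<le> u' t * u' t + q t * u t * u t"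
      by (simp add: power2_eq_square algebra_simps)
  qed
  moreover have "2 * m * (u L - u 0) - m\<^sup>2 * L = (u L - u 0)\<^sup>2 / L"
    using L by (simp add: m_def power2_eq_square field_simps)
  ultimately show ?thesis by simp
qed

text \<open>With zero end values Green's formula says that the energy is 0, so the continuous
  function \<open>u'\<close> vanishes and \<open>u\<close> is constant.\<close>

lemma ode_solution_zero:
  assumes u: "ode_solution L q u u'" and bc: "u 0 = 0" "u L = 0" and t: "t \<in> {0..L}"
  shows "u t = 0"
proof -
  have g: "((\<lambda>t. u' t * u' t + q t * u t * u t) has_integral 0) {0..L}"
    using ode_solution_green[OF u u] bc by simp
  have i1: "(\<lambda>t. u' t * u' t) integrable_on {0..L}"
    by (intro integrable_continuous_real continuous_intros ode_solution_deriv_continuous[OF u])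
  have "integral {0..L} (\<lambda>t. u' t * u' t) \<le> 0"
    by (rule has_integral_le[OF integrable_integral[OF i1] g]) (use q_nonneg in \<open>auto simp: mult.assoc\<close>)
  then have "integral {0..L} (\<lambda>t. u' t * u' t) = 0"
    using Henstock_Kurzweil_Integration.integral_nonneg[OF i1] by force
  then have "((\<lambda>t. u' t * u' t) has_integral 0) {0..L}" using i1 by (simp add: has_integral_iff)
  then have z: "u' s * u' s = 0" if "s \<in> {0..L}" for s
    using has_integral_0_cbox_imp_0[of 0 L "\<lambda>t. u' t * u' t" s] that L ode_solution_deriv_continuous[OF u]
    by (auto intro!: continuous_intros)
  have "(u has_field_derivative 0) (at s within {0..L})" if "s \<in> {0..L}" for s
    using ode_solution_deriv[OF u that] z[OF that] by simp
  then obtain k where "\<And>s. s \<in> {0..L} \<Longrightarrow> u s = k"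
    using has_field_derivative_zero_constant[of "{0..L}" u] by auto
  then show ?thesis using bc t L by (metis atLeastAtMost_iff less_imp_le order_refl)
qed

end

section \<open>Initial value problem, convexity, and solutions with given end values\<close>

lemma integral_abs_bound:
  fixes f g :: "real \<Rightarrow> real"
  assumes "f integrable_on S" "g integrable_on S" "\<And>x. x \<in> S \<Longrightarrow> \<bar>f x\<bar> \<le> g x"
  shows "\<bar>integral S f\<bar> \<le> integral S g"
  using integral_norm_bound_integral[of f S g] assms by simp

context edge_ode
begin

lemma q_integrable: "q integrable_on {0..L}"
  using q by (rule set_lebesgue_integral_eq_integral(1))

lemma integral_q_nonneg: "0 \<le> integral {0..L} q"
  by (rule Henstock_Kurzweil_Integration.integral_nonneg[OF q_integrable]) (use q_nonneg in auto)

text \<open>Picard iteration for \<open>z' = 1 + \<integral> q z\<close> with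
  \<open>z 0 = 0\<close>. Running it in the closed cone of nonnegative functions makes the fixed
  point nonnegative at once.\<close>

lemma ivp_solution:
  obtains z z' where "ode_solution L q z z'" "z 0 = 0" "z' 0 = 1" "\<And>t. t \<in> {0..L} \<Longrightarrow> 0 \<le> z t"
proof -
  define Q where "Q = integral {0..L} q"
  \<comment> \<open>The Volterra operator is a contraction with constant \<open>1/2\<close> in the norm weighted by \<open>exp (- (k * t))\<close>.\<close>
  define k where "k = 2 * Q + 1"
  have Q0: "0 \<le> Q" using integral_q_nonneg by (simp add: Q_def)
  then have k0: "0 < k" by (simp add: k_def)
  define I where "I f s = integral {0..s} (\<lambda>r. q r * (exp (k * r) * apply_bcontfun f r))" for f s
  define J where "J f t = exp (- (k * t)) * integral {0..t} (\<lambda>s. 1 + I f s)" for f t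
  \<comment> \<open>The type of bounded continuous functions has the whole line as domain; clamping
    the argument to the edge extends \<open>J f\<close> to it.\<close>
  define cl where "cl t = max 0 (min L t)" for t
  have cl: "cl t \<in> {0..L}" "t \<in> {0..L} \<Longrightarrow> cl t = t" for t using L by (auto simp: cl_def)
  have integrand: "(\<lambda>r. q r * (exp (k * r) * apply_bcontfun f r)) integrable_on {0..s}" if "s \<in> {0..L}" for f s
  proof (rule integrable_on_subinterval[where S="{0..L}"])
    have "continuous_on {0..L} (\<lambda>r. exp (k * r) * apply_bcontfun f r)" by (intro continuous_intros) auto
    then show "(\<lambda>r. q r * (exp (k * r) * apply_bcontfun f r)) integrable_on {0..L}"
      by (rule set_lebesgue_integral_eq_integral(1)[OF q_mult_absolutely_integrable])
  qed (use that in auto)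
  have I_cont: "continuous_on {0..L} (\<lambda>s. 1 + I f s)" for f
    unfolding I_def using integrand[of L f] L
    by (intro continuous_intros indefinite_integral_continuous_1) auto
  then have I_int: "(\<lambda>s. 1 + I f s) integrable_on {0..t}" if "t \<in> {0..L}" for t f
    using that by (intro integrable_continuous_real continuous_on_subset[OF I_cont]) auto
  have J_cont: "continuous_on {0..L} (J f)" for f
    unfolding J_def using I_int[of L f] L
    by (intro continuous_intros indefinite_integral_continuous_1) auto
  have Jcl: "(\<lambda>t. J f (cl t)) \<in> bcontfun" for f
  proof -
    have "continuous_on UNIV (\<lambda>t. J f (cl t))"
      by (rule continuous_on_compose2[OF J_cont]) (use cl in \<open>auto simp: cl_def intro!: continuous_intros\<close>)
    moreover have "bounded (range (\<lambda>t. J f (cl t)))"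
      by (rule bounded_subset[OF compact_imp_bounded[OF compact_continuous_image[OF J_cont compact_Icc]]])
         (use cl in auto)
    ultimately show ?thesis by (simp add: bcontfun_def)
  qed
  define \<Phi> where "\<Phi> f = Bcontfun (\<lambda>t. J f (cl t))" for f
  have \<Phi>: "apply_bcontfun (\<Phi> f) t = J f (cl t)" for f t
    unfolding \<Phi>_def by (simp add: Bcontfun_inverse[OF Jcl])
  let ?S = "PiC UNIV (\<lambda>_. {0..}) :: (real \<Rightarrow>\<^sub>C real) set"
  have "\<exists>!f. f \<in> ?S \<and> \<Phi> f = f"
  proof (rule Banach_fix[where c="1/2"])
    show "complete ?S" unfolding complete_eq_closed by (intro closed_PiC) auto
    show "?S \<noteq> {}" using mem_PiC_iff[of "0 :: real \<Rightarrow>\<^sub>C real"] by auto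
    show "\<Phi> ` ?S \<subseteq> ?S"
    proof
      fix g assume "g \<in> \<Phi> ` ?S"
      then obtain f where f: "g = \<Phi> f" "\<And>t. 0 \<le> apply_bcontfun f t" by (auto simp: mem_PiC_iff Pi_def)
      have "0 \<le> I f s" if "s \<in> {0..L}" for s
        unfolding I_def by (rule Henstock_Kurzweil_Integration.integral_nonneg[OF integrand[OF that]])
          (use that f q_nonneg in auto)
      then have "0 \<le> J f t" if "t \<in> {0..L}" for t
        unfolding J_def using that
        by (intro mult_nonneg_nonneg Henstock_Kurzweil_Integration.integral_nonneg I_int) (auto intro!: add_nonneg_nonneg)
      then show "g \<in> ?S" using cl by (simp add: f mem_PiC_iff \<Phi>)
    qed
    fix f g assume "f \<in> ?S" "g \<in> ?S"
    define D where "D = dist f g"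
    have D: "\<bar>apply_bcontfun f x - apply_bcontfun g x\<bar> \<le> D" for x
      using dist_bounded[of f x g] by (simp add: D_def dist_real_def)
    then have D0: "0 \<le> D" by (meson abs_ge_zero order_trans)
    have I_diff: "\<bar>I f s - I g s\<bar> \<le> exp (k * s) * D * Q" if s: "s \<in> {0..L}" for s
    proof -
      have qs: "q integrable_on {0..s}" using q_integrable by (rule integrable_on_subinterval) (use s in auto)
      have "I f s - I g s = integral {0..s} (\<lambda>r. q r * (exp (k * r) * apply_bcontfun f r) - q r * (exp (k * r) * apply_bcontfun g r))"
        unfolding I_def by (rule Henstock_Kurzweil_Integration.integral_diff[OF integrand[OF s] integrand[OF s], symmetric])
      also have "\<bar>\<dots>\<bar> \<le> integral {0..s} (\<lambda>r. exp (k * s) * D * q r)"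
      proof (rule integral_abs_bound)
        fix r assume r: "r \<in> {0..s}"
        have "\<bar>q r * (exp (k * r) * apply_bcontfun f r) - q r * (exp (k * r) * apply_bcontfun g r)\<bar>
            = q r * exp (k * r) * \<bar>apply_bcontfun f r - apply_bcontfun g r\<bar>"
          using q_nonneg[of r] r s by (simp add: right_diff_distrib[symmetric] abs_mult)
        also have "\<dots> \<le> q r * exp (k * s) * D"
          using q_nonneg[of r] r s D[of r] k0 by (intro mult_mono) auto
        finally show "\<bar>q r * (exp (k * r) * apply_bcontfun f r) - q r * (exp (k * r) * apply_bcontfun g r)\<bar> \<le> exp (k * s) * D * q r"
          by (simp add: mult_ac)
      next
        show "(\<lambda>r. exp (k * s) * D * q r) integrable_on {0..s}"
          by (intro integrable_on_mult_right qs)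
      qed (intro Henstock_Kurzweil_Integration.integrable_diff integrand s)
      also have "\<dots> = exp (k * s) * D * integral {0..s} q" by simp
      also have "\<dots> \<le> exp (k * s) * D * Q"
        unfolding Q_def using D0 s q_nonneg
        by (intro mult_left_mono Henstock_Kurzweil_Integration.integral_subset_le qs q_integrable) auto
      finally show ?thesis .
    qed
    have J_diff: "\<bar>J f t - J g t\<bar> \<le> 1/2 * D" if t: "t \<in> {0..L}" for t
    proof -
      have e: "((\<lambda>s. exp (k * s) * D * Q) has_integral exp (k * t) / k * D * Q - exp (k * 0) / k * D * Q) {0..t}"
        using t k0 by (intro fundamental_theorem_of_calculus)
          (auto intro!: derivative_eq_intros simp: has_real_derivative_iff_has_vector_derivative[symmetric])
      have "integral {0..t} (\<lambda>s. 1 + I f s) - integral {0..t} (\<lambda>s. 1 + I g s)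
          = integral {0..t} (\<lambda>s. (1 + I f s) - (1 + I g s))"
        by (rule Henstock_Kurzweil_Integration.integral_diff[OF I_int[OF t] I_int[OF t], symmetric])
      also have "\<bar>\<dots>\<bar> \<le> integral {0..t} (\<lambda>s. exp (k * s) * D * Q)"
        by (rule integral_abs_bound)
          (use e I_diff t in \<open>auto intro!: Henstock_Kurzweil_Integration.integrable_diff[OF I_int[OF t] I_int[OF t], simplified]\<close>)
      also have "\<dots> = exp (k * t) / k * D * Q - 1 / k * D * Q" using integral_unique[OF e] by simp
      also have "\<dots> \<le> exp (k * t) * (D * (Q / k))" using k0 D0 Q0 by (simp add: mult.assoc)
      \<comment> \<open>\<open>Q / k \<le> 1/2\<close> by the choice of \<open>k\<close>, whose
        summand 1 keeps it positive when \<open>Q = 0\<close>.\<close>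
      also have "\<dots> \<le> exp (k * t) * (D * (1/2))"
        using k0 D0 Q0 by (intro mult_left_mono) (auto simp: k_def field_simps)
      finally have *: "\<bar>integral {0..t} (\<lambda>s. 1 + I f s) - integral {0..t} (\<lambda>s. 1 + I g s)\<bar> \<le> exp (k * t) * (D * (1/2))" .
      have "\<bar>J f t - J g t\<bar> = exp (- (k * t)) * \<bar>integral {0..t} (\<lambda>s. 1 + I f s) - integral {0..t} (\<lambda>s. 1 + I g s)\<bar>"
        unfolding J_def by (simp add: right_diff_distrib[symmetric] abs_mult)
      also have "\<dots> \<le> exp (- (k * t)) * (exp (k * t) * (D * (1/2)))"
        using * by (intro mult_left_mono) auto
      also have "\<dots> = 1/2 * D" by (simp add: exp_minus)
      finally show ?thesis .
    qed
    show "dist (\<Phi> f) (\<Phi> g) \<le> 1/2 * dist f g"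
      by (rule dist_bound) (use J_diff cl in \<open>simp add: \<Phi> dist_real_def D_def\<close>)
  qed auto
  then obtain f where f: "f \<in> ?S" "\<Phi> f = f" by blast
  have fJ: "apply_bcontfun f t = J f t" if "t \<in> {0..L}" for t using \<Phi>[of f t] f(2) cl that by simp
  define z where "z t = integral {0..t} (\<lambda>s. 1 + I f s)" for t
  define z' where "z' t = 1 + I f t" for t
  have z: "z t = exp (k * t) * apply_bcontfun f t" if "t \<in> {0..L}" for t
    using fJ[OF that] by (simp add: J_def z_def exp_minus)
  show thesis
  proof (rule that)
    show "z 0 = 0" "z' 0 = 1" by (simp_all add: z_def z'_def I_def)
    show "0 \<le> z t" if "t \<in> {0..L}" for t using z[OF that] f(1) by (auto simp: mem_PiC_iff Pi_iff)
    show "ode_solution L q z z'"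
      unfolding ode_solution_def
    proof (intro ballI conjI)
      fix t assume t: "t \<in> {0..L}"
      show "(z has_real_derivative z' t) (at t within {0..L})"
        unfolding z_def z'_def using integral_has_real_derivative[OF I_cont t] by simp
      have "((\<lambda>r. q r * (exp (k * r) * apply_bcontfun f r)) has_integral I f t) {0..t}"
        unfolding I_def by (rule integrable_integral[OF integrand[OF t]])
      then have "((\<lambda>r. q r * z r) has_integral I f t) {0..t}"
        by (rule has_integral_eq[rotated]) (use z t in auto)
      then show "((\<lambda>s. q s * z s) has_integral z' t - z' 0) {0..t}" by (simp add: z'_def I_def)
    qed
  qed
qed

lemma ode_solution_mvt:
  assumes u: "ode_solution L q u u'" and st: "0 \<le> s" "s < t" "t \<le> L"
  obtains x where "s < x" "x < t" "u t - u s = (t - s) * u' x"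
proof -
  have "\<exists>x\<in>{s<..<t}. u t - u s = (\<lambda>h. h * u' x) (t - s)"
  proof (rule mvt_simple[OF st(2)])
    fix x assume "s \<le> x" "x \<le> t"
    then show "(u has_derivative (\<lambda>h. h * u' x)) (at x within {s..t})"
      using has_field_derivative_subset[OF ode_solution_deriv[OF u, of x], of "{s..t}"] st
      by (simp add: has_field_derivative_def mult_commute_abs)
  qed
  then show thesis using that by auto
qed

text \<open>Convexity: \<open>u'' = q * u\<close> is nonnegative where \<open>u\<close> is.\<close>

lemma ode_solution_deriv_mono:
  assumes u: "ode_solution L q u u'" and nn: "\<And>t. t \<in> {0..L} \<Longrightarrow> 0 \<le> u t" and st: "0 \<le> s" "s \<le> t" "t \<le> L"
  shows "u' s \<le> u' t"
proof -
  have "u' s - u' 0 \<le> u' t - u' 0"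
    by (rule has_integral_subset_le[OF _ ode_solution_has_integral[OF u, of s] ode_solution_has_integral[OF u, of t]])
      (use st nn q_nonneg in auto)
  then show ?thesis by simp
qed

end

text \<open>\<open>y1\<close> and \<open>y2\<close> are the solutions with end values \<open>(1, 0)\<close> and \<open>(0, 1)\<close>, and \<open>\<alpha>\<close>, \<open>- c\<close>, \<open>\<beta>\<close> are the
  entries of the matrix taking the end values of a solution to its outgoing flux
  \<open>(- u' 0, u' L)\<close>. The matrix is symmetric because the Wronskian is constant.\<close>

definition edge_model ::
    "real \<Rightarrow> (real \<Rightarrow> real) \<Rightarrow> (real \<Rightarrow> real) \<Rightarrow> (real \<Rightarrow> real) \<Rightarrow> real \<Rightarrow> real \<Rightarrow> real \<Rightarrow> bool" where
  "edge_model L q y1 y2 \<alpha> \<beta> c \<longleftrightarrow>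
     y1 0 = 1 \<and> y1 L = 0 \<and> y2 0 = 0 \<and> y2 L = 1 \<and>
     (\<forall>t\<in>{0..L}. 0 \<le> y1 t \<and> 0 \<le> y2 t \<and> y1 t + y2 t \<le> 1 \<and> 1 - L * integral {0..L} q \<le> y1 t + y2 t) \<and>
     0 < c \<and> c \<le> \<alpha> \<and> c \<le> \<beta> \<and> \<alpha> + \<beta> - 2 * c \<le> integral {0..L} q \<and>
     (\<forall>a b. (b - a)\<^sup>2 / L \<le> \<alpha> * a\<^sup>2 - 2 * c * a * b + \<beta> * b\<^sup>2) \<and>
     (\<forall>a b. \<exists>u'. edge_solution L q (\<lambda>t. a * y1 t + b * y2 t) u') \<and>
     (\<forall>u u'. edge_solution L q u u' \<longrightarrow>
        (\<forall>t\<in>{0..L}. u t = u 0 * y1 t + u L * y2 t) \<and>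
        u' 0 = c * u L - \<alpha> * u 0 \<and> u' L = \<beta> * u L - c * u 0)"

theorem (in edge_ode) edge_model_exists: "\<exists>y1 y2 \<alpha> \<beta> c. edge_model L q y1 y2 \<alpha> \<beta> c"
proof -
  obtain z z' where z: "ode_solution L q z z'" "z 0 = 0" "z' 0 = 1" "\<And>t. t \<in> {0..L} \<Longrightarrow> 0 \<le> z t"
    using ivp_solution by blast
  \<comment> \<open>The solution vanishing at the right end is the reflected initial value solution
    for the reflected potential.\<close>
  interpret R: edge_ode L "\<lambda>t. q (L - t)"
  proof
    have "((\<lambda>t. q ((-1) *\<^sub>R t + L)) has_integral integral {0..L} q /\<^sub>R 1) {0..L}"
      using has_integral_affinity[of q "integral {0..L} q" 0 L "-1" L] q_integrable
      by (simp add: has_integral_integral)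
    then have "(\<lambda>t. q (L - t)) integrable_on {0..L}"
      unfolding integrable_on_def by (auto simp: add.commute[of _ L])
    then show "(\<lambda>t. q (L - t)) absolutely_integrable_on {0..L}"
      using q_nonneg by (intro nonnegative_absolutely_integrable_1) auto
  qed (use L q_nonneg in auto)
  obtain w w' where w: "ode_solution L (\<lambda>t. q (L - t)) w w'" "w 0 = 0" "w' 0 = 1" "\<And>t. t \<in> {0..L} \<Longrightarrow> 0 \<le> w t"
    using R.ivp_solution by blast
  \<comment> \<open>\<open>z\<close> is convex with initial slope 1, so it cannot return to 0 and
    can be normalised at \<open>L\<close>.\<close>
  have zL: "0 < z L"
  proof -
    obtain x where "0 < x" "x < L" "z L - z 0 = (L - 0) * z' x"
      using ode_solution_mvt[OF z(1), of 0 L] L by auto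
    moreover have "1 \<le> z' x" using ode_solution_deriv_mono[OF z(1,4), of 0 x] calculation z(3) by simp
    ultimately show ?thesis using z(2) L by simp
  qed
  have wL: "0 < w L"
  proof -
    obtain x where "0 < x" "x < L" "w L - w 0 = (L - 0) * w' x"
      using R.ode_solution_mvt[OF w(1), of 0 L] L by auto
    moreover have "1 \<le> w' x" using R.ode_solution_deriv_mono[OF w(1,4), of 0 x] calculation w(3) by simp
    ultimately show ?thesis using w(2) L by simp
  qed
  define y2 y2' where "y2 t = z t / z L" and "y2' t = z' t / z L" for t
  define y1 y1' where "y1 t = w (L - t) / w L" and "y1' t = - w' (L - t) / w L" for t
  have y2: "ode_solution L q y2 y2'"
    using ode_solution_combination[OF z(1) z(1), of "1 / z L" 0] by (simp add: y2_def[abs_def] y2'_def[abs_def])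
  have "ode_solution L q (\<lambda>t. w (L - t)) (\<lambda>t. - w' (L - t))"
    using ode_solution_reflect[OF w(1)] by simp
  from ode_solution_combination[OF this this, of "1 / w L" 0]
  have y1: "ode_solution L q y1 y1'" by (simp add: y1_def[abs_def] y1'_def[abs_def])
  have bv: "y1 0 = 1" "y1 L = 0" "y2 0 = 0" "y2 L = 1"
    using zL wL z(2) w(2) by (auto simp: y1_def y2_def)
  have nn: "0 \<le> y1 t" "0 \<le> y2 t" if "t \<in> {0..L}" for t
    using z(4) w(4) zL wL that by (auto simp: y1_def y2_def)
  define \<alpha> \<beta> c where "\<alpha> = - y1' 0" and "\<beta> = y2' L" and "c = y2' 0"
  have c: "0 < c" using zL z(3) by (simp add: c_def y2'_def)
  \<comment> \<open>Green's formula for \<open>y1\<close> and \<open>y2\<close> in both orders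
    evaluates one integral as \<open>- y2' 0\<close> and as \<open>y1' L\<close>.\<close>
  have y1L: "y1' L = - c"
  proof -
    have "((\<lambda>t. y1' t * y2' t + q t * y1 t * y2 t) has_integral - c) {0..L}"
      using ode_solution_green[OF y1 y2] bv by (simp add: c_def)
    moreover have "((\<lambda>t. y1' t * y2' t + q t * y1 t * y2 t) has_integral y1' L) {0..L}"
      using ode_solution_green[OF y2 y1] bv by (simp add: mult_ac)
    ultimately show ?thesis by (rule has_integral_unique[symmetric])
  qed
  \<comment> \<open>The solution with both end values 1 measures how far constants are from being
    solutions: its total change of slope is \<open>\<alpha> + \<beta> - 2 * c\<close>.\<close>
  define s s' where "s t = y1 t + y2 t" and "s' t = y1' t + y2' t" for t
  have s: "ode_solution L q s s'"
    using ode_solution_combination[OF y1 y2, of 1 1] by (simp add: s_def[abs_def] s'_def[abs_def])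
  have sv: "s 0 = 1" "s L = 1" "s' 0 = c - \<alpha>" "s' L = \<beta> - c"
    using bv y1L by (auto simp: s_def s'_def \<alpha>_def \<beta>_def c_def)
  have s_nn: "0 \<le> s t" if "t \<in> {0..L}" for t using nn[OF that] by (simp add: s_def)
  note mono = ode_solution_deriv_mono[OF s s_nn]
  \<comment> \<open>A value above 1 would force a positive slope before \<open>t\<close> and a
    negative one after it, against convexity.\<close>
  have s_le: "s t \<le> 1" if t: "t \<in> {0..L}" for t
  proof (rule ccontr)
    assume "\<not> s t \<le> 1"
    then have "1 < s t" by simp
    then have t': "0 < t" "t < L" using t sv by (auto simp: less_le)
    obtain x where x: "0 < x" "x < t" "s t - s 0 = (t - 0) * s' x"
      using ode_solution_mvt[OF s, of 0 t] t' by auto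
    obtain y where y: "t < y" "y < L" "s L - s t = (L - t) * s' y"
      using ode_solution_mvt[OF s, of t L] t' by auto
    have "0 < t * s' x" using x(3) sv \<open>1 < s t\<close> by simp
    then have "0 < s' x" using t' by (simp add: zero_less_mult_iff)
    have "(L - t) * s' y < 0" using y(3) sv \<open>1 < s t\<close> by simp
    then have "s' y < 0" using t' by (simp add: mult_less_0_iff)
    then show False using mono[of x y] x y \<open>0 < s' x\<close> by simp
  qed
  \<comment> \<open>The slope vanishes somewhere because the end values agree, so by convexity the
    end slopes have these signs. In terms of the coefficients this is
    \<open>c \<le> \<alpha>\<close> and \<open>c \<le> \<beta>\<close>.\<close>
  have ends: "s' 0 \<le> 0" "0 \<le> s' L"
  proof -
    obtain x where x: "0 < x" "x < L" "s L - s 0 = (L - 0) * s' x"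
      using ode_solution_mvt[OF s, of 0 L] L by auto
    then have "s' x = 0" using sv L by simp
    then show "s' 0 \<le> 0" "0 \<le> s' L" using mono[of 0 x] mono[of x L] x by auto
  qed
  have tot: "s' L - s' 0 \<le> integral {0..L} q"
  proof (rule has_integral_le[OF ode_solution_has_integral[OF s] integrable_integral[OF q_integrable]])
    fix t assume t: "t \<in> {0..L}"
    show "q t * s t \<le> q t" using mult_left_mono[OF s_le[OF t] q_nonneg[OF t]] by simp
  qed (use L in auto)
  have s_ge: "1 - L * integral {0..L} q \<le> s t" if t: "t \<in> {0..L}" for t
  proof (cases "t = 0")
    case True
    then show ?thesis using sv L integral_q_nonneg by simp
  next
    case False
    then obtain x where x: "0 < x" "x < t" "s t - s 0 = (t - 0) * s' x"
      using ode_solution_mvt[OF s, of 0 t] t by auto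
    \<comment> \<open>\<open>s' x \<ge> s' 0 \<ge> s' L - integral {0..L} q\<close>, and
      \<open>s' L\<close> is nonnegative.\<close>
    have "- integral {0..L} q \<le> s' x" using tot ends(2) mono[of 0 x] x t by auto
    then have "t * (- integral {0..L} q) \<le> t * s' x" using t by (intro mult_left_mono) auto
    moreover have "t * integral {0..L} q \<le> L * integral {0..L} q"
      using t integral_q_nonneg by (intro mult_right_mono) auto
    ultimately show ?thesis using x(3) sv by simp
  qed
  have comb: "ode_solution L q (\<lambda>t. a * y1 t + b * y2 t) (\<lambda>t. a * y1' t + b * y2' t)" for a b
    by (rule ode_solution_combination[OF y1 y2])
  have uniq: "(\<forall>t\<in>{0..L}. u t = u 0 * y1 t + u L * y2 t) \<and>
        u' 0 = c * u L - \<alpha> * u 0 \<and> u' L = \<beta> * u L - c * u 0" if es: "edge_solution L q u u'" for u u'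
  proof -
    define v where "v t = u 0 * y1 t + u L * y2 t" for t
    define v' where "v' t = u 0 * y1' t + u L * y2' t" for t
    have u: "ode_solution L q u u'" using es edge_solution_iff by simp
    have v: "ode_solution L q v v'" using comb[of "u 0" "u L"] by (simp add: v_def[abs_def] v'_def[abs_def])
    have eq: "u t = v t" if "t \<in> {0..L}" for t
      using ode_solution_zero[OF ode_solution_combination[OF u v, of 1 "-1"] _ _ that] bv by (simp add: v_def)
    have "u' t = v' t" if t: "t \<in> {0..L}" for t
    proof (rule has_field_derivative_unique)
      show "(u has_field_derivative u' t) (at t within {0..L})" by (rule ode_solution_deriv[OF u t])
      show "(u has_field_derivative v' t) (at t within {0..L})"
        by (rule has_field_derivative_transform_within[OF ode_solution_deriv[OF v t] zero_less_one t]) (simp add: eq)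
      show "at t within {0..L} \<noteq> bot" using t L by (simp add: trivial_limit_within islimpt_Icc)
    qed
    from this[of 0] this[of L] have "u' 0 = v' 0" "u' L = v' L" using L by auto
    then have "u' 0 = c * u L - \<alpha> * u 0" "u' L = \<beta> * u L - c * u 0"
      by (simp_all add: y1L v'_def \<alpha>_def \<beta>_def c_def)
    moreover have "\<forall>t\<in>{0..L}. u t = u 0 * y1 t + u L * y2 t" using eq unfolding v_def by blast
    ultimately show ?thesis by blast
  qed
  have energy: "(b - a)\<^sup>2 / L \<le> \<alpha> * a\<^sup>2 - 2 * c * a * b + \<beta> * b\<^sup>2" for a b
    using ode_solution_energy[OF comb[of a b]] bv y1L
    by (simp add: \<alpha>_def \<beta>_def c_def power2_eq_square algebra_simps)
  have "edge_model L q y1 y2 \<alpha> \<beta> c"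
    unfolding edge_model_def edge_solution_iff
  proof (intro conjI)
    show "\<forall>t\<in>{0..L}. 0 \<le> y1 t \<and> 0 \<le> y2 t \<and> y1 t + y2 t \<le> 1 \<and> 1 - L * integral {0..L} q \<le> y1 t + y2 t"
      using nn s_le s_ge by (auto simp: s_def)
    show "\<forall>u u'. ode_solution L q u u' \<longrightarrow> (\<forall>t\<in>{0..L}. u t = u 0 * y1 t + u L * y2 t) \<and>
        u' 0 = c * u L - \<alpha> * u 0 \<and> u' L = \<beta> * u L - c * u 0"
      using uniq edge_solution_iff by blast
    show "\<forall>a b. \<exists>u'. ode_solution L q (\<lambda>t. a * y1 t + b * y2 t) u'" using comb by blast
  qed (use bv c ends tot sv energy in auto)
  then show ?thesis by blast
qed

section \<open>Energy minimisation on the vertices\<close>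

text \<open>\<open>A\<close> is the vertex set of the walk. Vertices must not repeat: since no edge is used twice, the
  Cauchy--Schwarz inequality bounds the increment of a function along the walk by its total energy.\<close>

inductive simple_walk :: "'v mgraph \<Rightarrow> 'v \<Rightarrow> 'v set \<Rightarrow> real \<Rightarrow> 'v \<Rightarrow> bool" for G where
  trivial_walk: "w \<in> verts G \<Longrightarrow> simple_walk G w {w} 0 w"
| cons_walk: "simple_walk G v' A l w \<Longrightarrow> v \<notin> A \<Longrightarrow> e \<in> edges G \<Longrightarrow> e = (v, v') \<or> e = (v', v) \<Longrightarrow>
              simple_walk G v (insert v A) (l + len G e) w"

definition reaches :: "'v mgraph \<Rightarrow> 'v \<Rightarrow> real \<Rightarrow> 'v \<Rightarrow> bool" where
  "reaches G v l w \<longleftrightarrow> (\<exists>A l'. l' \<le> l \<and> simple_walk G v A l' w)"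

lemma simple_walk_start: "simple_walk G v A l w \<Longrightarrow> v \<in> A"
  by (induction rule: simple_walk.induct) auto

lemma simple_walk_finite: "simple_walk G v A l w \<Longrightarrow> finite A"
  by (induction rule: simple_walk.induct) auto

lemma simple_walk_suffix:
  assumes "simple_walk G v' A l w" "v \<in> A" "metric_graph G"
  shows "\<exists>A' l'. l' \<le> l \<and> simple_walk G v A' l' w"
  using assms
proof (induction rule: simple_walk.induct)
  case (trivial_walk w)
  then show ?case using simple_walk.trivial_walk by fastforce
next
  case (cons_walk v' A l w u e)
  have "0 < len G e" using cons_walk by (auto simp: metric_graph_def)
  show ?case
  proof (cases "v = u")
    case True
    then show ?thesis using simple_walk.cons_walk[OF cons_walk.hyps(1-4)] by blast
  next
    case False
    then obtain A' l' where "l' \<le> l" "simple_walk G v A' l' w" using cons_walk by auto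
    then show ?thesis using \<open>0 < len G e\<close> by (intro exI[of _ A'] exI[of _ l']) auto
  qed
qed

lemma reaches_refl: "w \<in> verts G \<Longrightarrow> 0 \<le> l \<Longrightarrow> reaches G w l w"
  unfolding reaches_def by (intro exI[of _ "{w}"] exI[of _ 0] conjI trivial_walk)

lemma reaches_mono: "reaches G v l w \<Longrightarrow> l \<le> l' \<Longrightarrow> reaches G v l' w"
  unfolding reaches_def by (meson order_trans)

text \<open>If \<open>v\<close> already lies on the walk, prepending it would repeat a vertex; but
  then the rest of the walk from \<open>v\<close> on is no longer than the whole, so the bound
  survives.\<close>

lemma reaches_cons:
  assumes "reaches G v' l w" "e \<in> edges G" "e = (v, v') \<or> e = (v', v)" "metric_graph G"
  shows "reaches G v (l + len G e) w"
proof -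
  obtain A l' where A: "l' \<le> l" "simple_walk G v' A l' w" using assms(1) by (auto simp: reaches_def)
  have "0 < len G e" using assms by (auto simp: metric_graph_def)
  show ?thesis
  proof (cases "v \<in> A")
    case True
    then obtain A' l'' where "l'' \<le> l'" "simple_walk G v A' l'' w"
      using simple_walk_suffix[OF A(2) _ assms(4)] by blast
    moreover have "l'' \<le> l + len G e" using calculation(1) A(1) \<open>0 < len G e\<close> by linarith
    ultimately show ?thesis unfolding reaches_def by blast
  next
    case False
    then show ?thesis unfolding reaches_def
      using cons_walk[OF A(2) _ assms(2,3)] A(1) by (intro exI[of _ "insert v A"] exI[of _ "l' + len G e"]) auto
  qed
qed

text \<open>The invariant for a path that currently ends inside an edge: it came in through one of
  the two ends and has spent at least the distance from that end. The walk is read backwards, from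
  the current position to the start.\<close>

lemma joined_reaches:
  assumes "joined G p l r" "p = Vertex v" "metric_graph G"
  shows "(\<forall>w. r = Vertex w \<longrightarrow> reaches G w l v) \<and>
         (\<forall>e s. r = Inner e s \<longrightarrow> reaches G (fst e) (l - s) v \<or> reaches G (snd e) (l - (len G e - s)) v)"
  using assms
proof (induction rule: joined.induct)
  case (refl p)
  then show ?case by (auto simp: points_def intro: reaches_refl)
next
  case (step p l e s t)
  have e: "e = (fst e, snd e)" by simp
  have "reaches G (fst e) (l - s) v \<or> reaches G (snd e) (l - (len G e - s)) v"
    using step.IH[OF step.prems] by (cases e) (auto simp: edge_point_def split: if_splits)
  then show ?case
  proof
    assume A: "reaches G (fst e) (l - s) v"
    have B: "reaches G (snd e) (l - s + len G e) v"
      by (rule reaches_cons[OF A step.hyps(2) _ step.prems(2)]) simp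
    show ?thesis using reaches_mono[OF A] reaches_mono[OF B] step.hyps
      by (auto simp: edge_point_def split: if_splits)
  next
    assume A: "reaches G (snd e) (l - (len G e - s)) v"
    have B: "reaches G (fst e) (l - (len G e - s) + len G e) v"
      by (rule reaches_cons[OF A step.hyps(2) _ step.prems(2)]) simp
    show ?thesis using reaches_mono[OF A] reaches_mono[OF B] step.hyps
      by (auto simp: edge_point_def split: if_splits)
  qed
qed

text \<open>The Dirichlet energy of the affine interpolation on the edge, which is the least energy
  for these end values when \<open>q = 0\<close>.\<close>

definition increment_energy :: "'v mgraph \<Rightarrow> ('v \<Rightarrow> real) \<Rightarrow> 'v \<times> 'v \<Rightarrow> real" where
  "increment_energy G g e = (g (snd e) - g (fst e))\<^sup>2 / len G e"

lemma finite_edges_at: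
  assumes "metric_graph G" "finite A"
  shows "finite {e \<in> edges G. fst e \<in> A \<or> snd e \<in> A}"
proof -
  have "finite (\<Union>v\<in>A \<inter> verts G. incident G v)" using assms by (auto simp: metric_graph_def)
  moreover have "{e \<in> edges G. fst e \<in> A \<or> snd e \<in> A} \<subseteq> (\<Union>v\<in>A \<inter> verts G. incident G v)"
    using assms by (fastforce simp: metric_graph_def incident_def)
  ultimately show ?thesis by (rule finite_subset[rotated])
qed

lemma four_mult_le_square_add: "4 * a * b \<le> (a + b)\<^sup>2" for a b :: real
  using zero_le_power2[of "a - b"] by (simp add: power2_eq_square algebra_simps)

text \<open>The induction step of Cauchy--Schwarz along a walk. The bound on \<open>y\<close> is
  stated as a product because \<open>l\<close> is 0 for the trivial walk.\<close>

lemma add_square_le: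
  fixes x y S l k :: real
  assumes "y\<^sup>2 \<le> l * S" "0 \<le> l" "0 \<le> S" "0 < k"
  shows "(x + y)\<^sup>2 \<le> (l + k) * (x\<^sup>2 / k + S)"
proof -
  have "(2 * x * y)\<^sup>2 = 4 * x\<^sup>2 * y\<^sup>2" by (simp add: power_mult_distrib)
  also have "\<dots> \<le> 4 * x\<^sup>2 * (l * S)" using assms by (intro mult_left_mono) auto
  also have "\<dots> = 4 * (l * x\<^sup>2 / k) * (k * S)" using assms by simp
  also have "\<dots> \<le> (l * x\<^sup>2 / k + k * S)\<^sup>2"
    using four_mult_le_square_add .
  finally have "2 * x * y \<le> l * x\<^sup>2 / k + k * S"
    by (rule power2_le_imp_le) (use assms in auto)
  moreover have "(l + k) * (x\<^sup>2 / k + S) = x\<^sup>2 + l * S + (l * x\<^sup>2 / k + k * S)"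
    using assms by (simp add: field_simps)
  ultimately show ?thesis using assms(1) unfolding power2_sum by linarith
qed

text \<open>Summing over all edges with both ends on the walk, rather than over its own edges, keeps
  edge lists out of \<open>simple_walk\<close> and only enlarges the bound. A newly visited vertex
  guarantees that the new edge has not been counted yet.\<close>

lemma simple_walk_increment:
  assumes "simple_walk G v A l w" "metric_graph G"
  shows "0 \<le> l \<and> (g v - g w)\<^sup>2 \<le> l * (\<Sum>e\<in>{e\<in>edges G. fst e \<in> A \<and> snd e \<in> A}. increment_energy G g e)"
  using assms
proof (induction rule: simple_walk.induct)
  case (cons_walk v' A l w u e)
  let ?E = "\<lambda>A. {e\<in>edges G. fst e \<in> A \<and> snd e \<in> A}"
  let ?S = "\<lambda>A. \<Sum>e\<in>?E A. increment_energy G g e"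
  have fin: "finite (?E A)" if "finite A" for A
    using finite_edges_at[OF cons_walk.prems that] by (rule finite_subset[rotated]) auto
  have pos: "0 \<le> increment_energy G g e" if "e \<in> edges G" for e
    using that cons_walk.prems by (auto simp: increment_energy_def metric_graph_def less_imp_le)
  have k: "0 < len G e" using cons_walk by (auto simp: metric_graph_def)
  have fA: "finite A" "v' \<in> A" by (rule simple_walk_finite[OF cons_walk.hyps(1)], rule simple_walk_start[OF cons_walk.hyps(1)])
  have S0: "0 \<le> ?S A" by (rule sum_nonneg) (use pos in auto)
  have "e \<notin> ?E A" "e \<in> ?E (insert u A)" using cons_walk.hyps fA by auto
  then have "increment_energy G g e + ?S A = sum (increment_energy G g) (insert e (?E A))"
    using fin[OF fA(1)] by simp
  also have "\<dots> \<le> ?S (insert u A)"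
    by (rule sum_mono2) (use fin[of "insert u A"] fA pos \<open>e \<in> ?E (insert u A)\<close> in auto)
  finally have le: "increment_energy G g e + ?S A \<le> ?S (insert u A)" .
  have ie: "increment_energy G g e = (g u - g v')\<^sup>2 / len G e"
    using cons_walk.hyps(4) power2_commute[of "g v'" "g u"] unfolding increment_energy_def by fastforce
  have "(g u - g w)\<^sup>2 = ((g u - g v') + (g v' - g w))\<^sup>2" by simp
  also have "\<dots> \<le> (l + len G e) * ((g u - g v')\<^sup>2 / len G e + ?S A)"
    by (rule add_square_le) (use cons_walk.IH[OF cons_walk.prems] S0 k in auto)
  also have "\<dots> \<le> (l + len G e) * ?S (insert u A)"
    using le ie cons_walk.IH[OF cons_walk.prems] k by (intro mult_left_mono) auto
  finally show ?case using cons_walk.IH[OF cons_walk.prems] k by simp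
qed auto

section \<open>The quadratic energy form on a locally finite graph\<close>

locale locally_finite_graph =
  fixes G :: "'v mgraph"
  assumes mg: "metric_graph G"
begin

lemma len_pos: "e \<in> edges G \<Longrightarrow> 0 < len G e"
  using mg by (auto simp: metric_graph_def)

lemma edge_verts: "e \<in> edges G \<Longrightarrow> fst e \<in> verts G" "e \<in> edges G \<Longrightarrow> snd e \<in> verts G"
  using mg by (auto simp: metric_graph_def)

lemma no_loop: "e \<in> edges G \<Longrightarrow> fst e \<noteq> snd e"
  using mg by (metis metric_graph_def prod.collapse)

lemma incident_edges: "e \<in> incident G v \<Longrightarrow> e \<in> edges G"
  by (simp add: incident_def)

lemma finite_incident: "v \<in> verts G \<Longrightarrow> finite (incident G v)"
  using mg by (simp add: metric_graph_def)

end

text \<open>\<open>\<alpha> e + \<beta> e - 2 * c e\<close> is the energy of the constant 1 on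
  \<open>e\<close>, so the summable bound \<open>Q\<close> gives constants finite energy, while
  \<open>lower\<close> lets the energy dominate the Dirichlet energy of the increments.\<close>

locale network = locally_finite_graph G for G :: "'v mgraph" +
  fixes \<alpha> \<beta> c Q :: "'v \<times> 'v \<Rightarrow> real"
  assumes coeff: "e \<in> edges G \<Longrightarrow> 0 < c e" "e \<in> edges G \<Longrightarrow> c e \<le> \<alpha> e" "e \<in> edges G \<Longrightarrow> c e \<le> \<beta> e"
      "e \<in> edges G \<Longrightarrow> \<alpha> e + \<beta> e - 2 * c e \<le> Q e"
    and lower: "e \<in> edges G \<Longrightarrow> (b - a)\<^sup>2 / len G e \<le> \<alpha> e * a\<^sup>2 - 2 * c e * a * b + \<beta> e * b\<^sup>2"
    and Q_summable: "Q summable_on edges G"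
begin

definition edge_energy :: "('v \<Rightarrow> real) \<Rightarrow> 'v \<times> 'v \<Rightarrow> real" where
  "edge_energy f e = \<alpha> e * (f (fst e))\<^sup>2 - 2 * c e * f (fst e) * f (snd e) + \<beta> e * (f (snd e))\<^sup>2"

definition energy :: "('v \<Rightarrow> real) \<Rightarrow> real" where
  "energy f = (\<Sum>\<^sub>\<infinity>e\<in>edges G. edge_energy f e)"

text \<open>\<open>energy\<close> takes the default value 0 on families that are not summable, so
  finiteness has to be tracked separately.\<close>

definition finite_energy :: "('v \<Rightarrow> real) \<Rightarrow> bool" where
  "finite_energy f \<longleftrightarrow> edge_energy f summable_on edges G"

text \<open>Half the derivative of \<open>energy\<close> in the value at \<open>v\<close>; for
  solutions on the edges it is minus the sum of the normal derivatives.\<close>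

definition flux :: "('v \<Rightarrow> real) \<Rightarrow> 'v \<Rightarrow> real" where
  "flux f v = (\<Sum>e\<in>incident G v. if v = fst e then \<alpha> e * f v - c e * f (snd e) else \<beta> e * f v - c e * f (fst e))"

definition stiffness :: "'v \<Rightarrow> real" where
  "stiffness v = (\<Sum>e\<in>incident G v. if v = fst e then \<alpha> e else \<beta> e)"

text \<open>Isolated vertices are included; their \<open>flux\<close> is an empty sum.\<close>

definition inner_verts :: "'v set" where
  "inner_verts = verts G - boundary_verts G"

lemma edge_energy_ge: "e \<in> edges G \<Longrightarrow> increment_energy G f e \<le> edge_energy f e"
  using lower by (simp add: increment_energy_def edge_energy_def)

lemma increment_energy_nonneg: "e \<in> edges G \<Longrightarrow> 0 \<le> increment_energy G f e"
  using len_pos by (simp add: increment_energy_def less_imp_le)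

lemma edge_energy_nonneg: "e \<in> edges G \<Longrightarrow> 0 \<le> edge_energy f e"
  using edge_energy_ge increment_energy_nonneg order_trans by blast

lemma energy_nonneg: "0 \<le> energy f"
  unfolding energy_def by (rule infsum_nonneg) (rule edge_energy_nonneg)

lemma finite_energy_finite_modification:
  assumes "finite_energy f" "finite F" "\<And>e. e \<in> edges G \<Longrightarrow> e \<notin> F \<Longrightarrow> edge_energy g e = edge_energy f e"
  shows "finite_energy g"
proof -
  have "edge_energy f summable_on (edges G - F)"
    using assms(1) unfolding finite_energy_def by (rule summable_on_subset_banach) auto
  then have "edge_energy g summable_on (edges G - F)"
    using assms(3) by (subst summable_on_cong[where g="edge_energy f"]) auto
  moreover have "edge_energy g summable_on (edges G \<inter> F)" using assms(2) by (intro summable_on_finite) auto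
  ultimately have "edge_energy g summable_on ((edges G - F) \<union> (edges G \<inter> F))"
    by (rule summable_on_Un_disjoint) auto
  moreover have "(edges G - F) \<union> (edges G \<inter> F) = edges G" by auto
  ultimately show ?thesis by (simp add: finite_energy_def)
qed

lemma finite_energy_modify_verts:
  assumes "finite_energy f" "finite {v. g v \<noteq> f v}"
  shows "finite_energy g"
  by (rule finite_energy_finite_modification[OF assms(1) finite_edges_at[OF mg assms(2)]])
     (auto simp: edge_energy_def)

text \<open>Where the two end values agree, the edge energy is their square times
  \<open>\<alpha> e + \<beta> e - 2 * c e\<close>, which is at most
  \<open>M\<^sup>2 * Q e\<close>.\<close>

lemma finite_energy_eventually_flat:
  assumes F: "finite F" "\<And>e. e \<in> edges G \<Longrightarrow> e \<notin> F \<Longrightarrow> \<phi> (fst e) = \<phi> (snd e)"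
    and M: "\<And>v. v \<in> verts G \<Longrightarrow> \<bar>\<phi> v\<bar> \<le> M"
  shows "finite_energy \<phi>"
proof -
  have "edge_energy \<phi> summable_on (edges G - F)"
  proof (rule summable_on_comparison_test[of "\<lambda>e. M\<^sup>2 * Q e"])
    show "(\<lambda>e. M\<^sup>2 * Q e) summable_on (edges G - F)"
      by (rule summable_on_cmult_right, rule summable_on_subset_banach[OF Q_summable]) auto
    fix e assume e: "e \<in> edges G - F"
    have "edge_energy \<phi> e = (\<phi> (fst e))\<^sup>2 * (\<alpha> e + \<beta> e - 2 * c e)"
      using F(2)[of e] e by (simp add: edge_energy_def power2_eq_square algebra_simps)
    also have "\<dots> \<le> M\<^sup>2 * Q e"
    proof (rule mult_mono)
      show "(\<phi> (fst e))\<^sup>2 \<le> M\<^sup>2" using M[of "fst e"] e edge_verts by (intro abs_le_square_iff[THEN iffD1]) auto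
    qed (use coeff[of e] e in auto)
    finally show "edge_energy \<phi> e \<le> M\<^sup>2 * Q e" .
  qed (use edge_energy_nonneg in auto)
  moreover have "edge_energy \<phi> summable_on (edges G \<inter> F)" using F by (intro summable_on_finite) auto
  ultimately have "edge_energy \<phi> summable_on ((edges G - F) \<union> (edges G \<inter> F))"
    by (rule summable_on_Un_disjoint) auto
  moreover have "(edges G - F) \<union> (edges G \<inter> F) = edges G" by auto
  ultimately show ?thesis by (simp add: finite_energy_def)
qed

lemma energy_bound_sum:
  assumes "finite_energy f" "finite F" "F \<subseteq> edges G"
  shows "(\<Sum>e\<in>F. increment_energy G f e) \<le> energy f"
proof -
  have "(\<Sum>e\<in>F. increment_energy G f e) \<le> (\<Sum>e\<in>F. edge_energy f e)"
    by (rule sum_mono) (use assms edge_energy_ge in auto)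
  also have "\<dots> \<le> energy f"
    unfolding energy_def using assms edge_energy_nonneg
    by (intro finite_sum_le_infsum) (auto simp: finite_energy_def)
  finally show ?thesis .
qed

text \<open>This is what makes minimising sequences converge uniformly: the constant depends on the
  length of the walk to a zero of \<open>g\<close>, not on \<open>g\<close>.\<close>

lemma square_le_energy:
  assumes "finite_energy g" "reaches G v K w" "g w = 0"
  shows "(g v)\<^sup>2 \<le> K * energy g"
proof -
  obtain A l where A: "l \<le> K" "simple_walk G v A l w" using assms(2) by (auto simp: reaches_def)
  let ?F = "{e\<in>edges G. fst e \<in> A \<and> snd e \<in> A}"
  have inc: "0 \<le> l" "(g v)\<^sup>2 \<le> l * sum (increment_energy G g) ?F"
    using simple_walk_increment[OF A(2) mg, of g] assms(3) by auto
  have "finite ?F"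
    using finite_edges_at[OF mg simple_walk_finite[OF A(2)]] by (rule finite_subset[rotated]) auto
  then have "l * sum (increment_energy G g) ?F \<le> l * energy g"
    using inc(1) by (intro mult_left_mono energy_bound_sum assms) auto
  also have "\<dots> \<le> K * energy g" using A(1) energy_nonneg by (intro mult_right_mono) auto
  finally show ?thesis using inc(2) by linarith
qed

lemma parallelogram:
  assumes "finite_energy f" "finite_energy g" "finite_energy (\<lambda>v. f v - g v)" "finite_energy (\<lambda>v. (f v + g v) / 2)"
  shows "energy (\<lambda>v. f v - g v) = 2 * energy f + 2 * energy g - 4 * energy (\<lambda>v. (f v + g v) / 2)"
proof -
  have s: "(edge_energy f has_sum energy f) (edges G)" "(edge_energy g has_sum energy g) (edges G)"
    "(edge_energy (\<lambda>v. f v - g v) has_sum energy (\<lambda>v. f v - g v)) (edges G)"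
    "(edge_energy (\<lambda>v. (f v + g v) / 2) has_sum energy (\<lambda>v. (f v + g v) / 2)) (edges G)"
    using assms by (auto simp: finite_energy_def energy_def)
  have "((\<lambda>e. edge_energy (\<lambda>v. f v - g v) e + 4 * edge_energy (\<lambda>v. (f v + g v) / 2) e) has_sum
      energy (\<lambda>v. f v - g v) + 4 * energy (\<lambda>v. (f v + g v) / 2)) (edges G)"
    by (intro has_sum_add has_sum_cmult_right s)
  moreover have "((\<lambda>e. 2 * edge_energy f e + 2 * edge_energy g e) has_sum 2 * energy f + 2 * energy g) (edges G)"
    by (intro has_sum_add has_sum_cmult_right s)
  moreover have "(\<lambda>e. edge_energy (\<lambda>v. f v - g v) e + 4 * edge_energy (\<lambda>v. (f v + g v) / 2) e)
      = (\<lambda>e. 2 * edge_energy f e + 2 * edge_energy g e)"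
    by (auto simp: fun_eq_iff edge_energy_def power2_eq_square field_simps)
  ultimately show ?thesis using has_sum_unique by fastforce
qed

text \<open>Only the finitely many edges at \<open>v\<close> change, and since there are no loops
  exactly one end value moves on each of them.\<close>

lemma energy_update:
  assumes f: "finite_energy f" and v: "v \<in> verts G"
  shows "energy (f(v := f v + t)) = energy f + 2 * t * flux f v + t\<^sup>2 * stiffness v"
proof -
  define h where "h e = 2 * t * (if v = fst e then \<alpha> e * f v - c e * f (snd e) else \<beta> e * f v - c e * f (fst e))
    + t\<^sup>2 * (if v = fst e then \<alpha> e else \<beta> e)" for e
  let ?I = "incident G v"
  have "((\<lambda>e. if e \<in> ?I then h e else 0) has_sum sum h ?I) (edges G)"
  proof (subst has_sum_cong_neutral[where T="?I" and g=h])
    show "(h has_sum sum h ?I) ?I" by (rule has_sum_finite[OF finite_incident[OF v]])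
  qed (auto simp: incident_def)
  moreover have "(edge_energy f has_sum energy f) (edges G)" using f by (simp add: finite_energy_def energy_def)
  ultimately have "((\<lambda>e. edge_energy f e + (if e \<in> ?I then h e else 0)) has_sum energy f + sum h ?I) (edges G)"
    by (intro has_sum_add)
  moreover have eq: "edge_energy f e + (if e \<in> ?I then h e else 0) = edge_energy (f(v := f v + t)) e" if "e \<in> edges G" for e
    using no_loop[OF that] that
    by (auto simp: edge_energy_def h_def incident_def power2_eq_square algebra_simps)
  ultimately have "(edge_energy (f(v := f v + t)) has_sum energy f + sum h ?I) (edges G)"
    by (simp only: has_sum_cong[OF eq])
  then have "energy (f(v := f v + t)) = energy f + sum h ?I" unfolding energy_def by (rule infsumI)
  also have "sum h ?I = 2 * t * flux f v + t\<^sup>2 * stiffness v"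
    unfolding h_def flux_def stiffness_def by (simp add: sum.distrib sum_distrib_left)
  finally show ?thesis by (simp only: add.assoc)
qed

lemma flux_tendsto:
  assumes "v \<in> verts G" "\<And>w. w \<in> verts G \<Longrightarrow> (\<lambda>n. f n w) \<longlonglongrightarrow> g w"
  shows "(\<lambda>n. flux (f n) v) \<longlonglongrightarrow> flux g v"
  unfolding flux_def
proof (rule tendsto_sum)
  fix e assume "e \<in> incident G v"
  then have "fst e \<in> verts G" "snd e \<in> verts G" using edge_verts incident_edges by blast+
  then show "(\<lambda>n. if v = fst e then \<alpha> e * f n v - c e * f n (snd e) else \<beta> e * f n v - c e * f n (fst e))
    \<longlonglongrightarrow> (if v = fst e then \<alpha> e * g v - c e * g (snd e) else \<beta> e * g v - c e * g (fst e))"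
    using assms by (auto intro!: tendsto_intros)
qed

lemma flux_add: "flux (\<lambda>w. a * f w + b * g w) v = a * flux f v + b * flux g v"
  unfolding flux_def by (simp add: sum_distrib_left sum.distrib[symmetric] algebra_simps if_distrib cong: sum.cong)
     (rule sum.cong, auto simp: algebra_simps)

text \<open>The limit \<open>f\<close> may differ from \<open>\<phi>\<close> at infinitely many
  vertices. The third conclusion is what survives of finite support under uniform convergence, and
  it carries the boundary values at ideal points.\<close>

theorem energy_minimizer:
  assumes \<phi>: "finite_energy \<phi>" and K: "0 < K"
    and escape: "\<And>T v. finite T \<Longrightarrow> T \<subseteq> inner_verts \<Longrightarrow> v \<in> verts G \<Longrightarrow> \<exists>w. w \<notin> T \<and> reaches G v K w"
  obtains f where "\<And>v. v \<in> inner_verts \<Longrightarrow> flux f v = 0"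
    "\<And>v. v \<notin> inner_verts \<Longrightarrow> f v = \<phi> v"
    "\<And>\<epsilon>. 0 < \<epsilon> \<Longrightarrow> finite {v \<in> verts G. \<epsilon> < \<bar>f v - \<phi> v\<bar>}"
proof -
  \<comment> \<open>Two admissible functions agree off a finite set of inner vertices, so
    \<open>escape\<close> supplies a nearby vertex where their difference vanishes.\<close>
  define Adm where "Adm = {f. finite {v. f v \<noteq> \<phi> v} \<and> {v. f v \<noteq> \<phi> v} \<subseteq> inner_verts}"
  have fe: "finite_energy f" if "f \<in> Adm" for f
    using that by (intro finite_energy_modify_verts[OF \<phi>]) (auto simp: Adm_def)
  have \<phi>_Adm: "\<phi> \<in> Adm" by (simp add: Adm_def)
  define m where "m = Inf (energy ` Adm)"
  have bdd: "bdd_below (energy ` Adm)" using energy_nonneg by (intro bdd_belowI[of _ 0]) auto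
  have m_le: "m \<le> energy f" if "f \<in> Adm" for f
    unfolding m_def using bdd that by (intro cInf_lower) auto
  define d where "d n = 1 / (real n + 1)" for n
  have d0: "0 < d n" for n by (simp add: d_def)
  have d_lim: "d \<longlonglongrightarrow> 0" unfolding d_def by real_asymp
  have "\<exists>f\<in>Adm. energy f < m + d n" for n
    using cInf_lessD[of "energy ` Adm" "m + d n"] \<phi>_Adm d0[of n] by (auto simp: m_def)
  then obtain F where F: "\<And>n. F n \<in> Adm" "\<And>n. energy (F n) < m + d n" by metis
  have diff: "(F n v - F k v)\<^sup>2 \<le> K * (2 * d n + 2 * d k)" if v: "v \<in> verts G" for n k v
  proof -
    let ?T = "{v. F n v \<noteq> \<phi> v} \<union> {v. F k v \<noteq> \<phi> v}"
    let ?g = "\<lambda>v. F n v - F k v" and ?h = "\<lambda>v. (F n v + F k v) / 2"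
    have T: "finite ?T" "?T \<subseteq> inner_verts" using F(1)[of n] F(1)[of k] by (auto simp: Adm_def)
    have "?h \<in> Adm"
      unfolding Adm_def mem_Collect_eq
      by (intro conjI finite_subset[OF _ T(1)] subset_trans[OF _ T(2)]) auto
    have "finite_energy (\<lambda>v. 0)" by (simp add: finite_energy_def edge_energy_def[abs_def])
    then have g: "finite_energy ?g"
      by (rule finite_energy_modify_verts) (rule finite_subset[OF _ T(1)], auto)
    obtain w where w: "w \<notin> ?T" "reaches G v K w" using escape[OF T v] by blast
    have "(F n v - F k v)\<^sup>2 \<le> K * energy ?g"
      by (rule square_le_energy[OF g w(2)]) (use w in auto)
    \<comment> \<open>The midpoint is admissible, so its energy is at least \<open>m\<close>, and
      the multiples of \<open>m\<close> cancel in the parallelogram identity.\<close>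
    also have "energy ?g \<le> 2 * d n + 2 * d k"
      using parallelogram[OF fe[OF F(1)] fe[OF F(1)] g fe[OF \<open>?h \<in> Adm\<close>]] m_le[OF \<open>?h \<in> Adm\<close>] F(2)[of n] F(2)[of k]
      by linarith
    finally show ?thesis using K by simp
  qed
  have "convergent (\<lambda>n. F n v)" if v: "v \<in> verts G" for v
  proof (rule Cauchy_convergent, rule CauchyI)
    fix e :: real assume e: "0 < e"
    then have "\<forall>\<^sub>F n in sequentially. d n < e\<^sup>2 / (4 * K)"
      using K by (intro order_tendstoD[OF d_lim]) auto
    then obtain N where N: "\<And>n. n \<ge> N \<Longrightarrow> d n < e\<^sup>2 / (4 * K)" by (auto simp: eventually_sequentially)
    have "norm (F n v - F k v) < e" if "n \<ge> N" "k \<ge> N" for n k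
    proof -
      have "(F n v - F k v)\<^sup>2 \<le> K * (2 * d n + 2 * d k)" by (rule diff[OF v])
      also have "\<dots> < K * (2 * (e\<^sup>2 / (4 * K)) + 2 * (e\<^sup>2 / (4 * K)))"
        using N[OF that(1)] N[OF that(2)] K by (intro mult_strict_left_mono) auto
      also have "\<dots> = e\<^sup>2" using K by simp
      finally have "\<bar>F n v - F k v\<bar>\<^sup>2 < e\<^sup>2" by simp
      then show ?thesis using e power2_less_imp_less[of "\<bar>F n v - F k v\<bar>" e] by simp
    qed
    then show "\<exists>M. \<forall>m\<ge>M. \<forall>n\<ge>M. norm (F m v - F n v) < e" by blast
  qed
  then obtain f0 where f0: "\<And>v. v \<in> verts G \<Longrightarrow> (\<lambda>n. F n v) \<longlonglongrightarrow> f0 v"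
    unfolding convergent_def by metis
  \<comment> \<open>Off the vertex set convergence was not established; the value
    \<open>\<phi> v\<close> there makes \<open>f\<close> agree with \<open>\<phi>\<close> at
    everything that is not an inner vertex.\<close>
  define f where "f v = (if v \<in> verts G then f0 v else \<phi> v)" for v
  have f: "(\<lambda>n. F n v) \<longlonglongrightarrow> f v" if "v \<in> verts G" for v using f0 that by (simp add: f_def)
  have close: "(F n v - f v)\<^sup>2 \<le> K * (2 * d n)" if v: "v \<in> verts G" for n v
  proof (rule LIMSEQ_le)
    show "(\<lambda>k. (F n v - F k v)\<^sup>2) \<longlonglongrightarrow> (F n v - f v)\<^sup>2" by (intro tendsto_intros f v)
    have "(\<lambda>k. K * (2 * d n + 2 * d k)) \<longlonglongrightarrow> K * (2 * d n + 2 * 0)" by (intro tendsto_intros d_lim)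
    then show "(\<lambda>k. K * (2 * d n + 2 * d k)) \<longlonglongrightarrow> K * (2 * d n)" by simp
  qed (use diff[OF v] in auto)
  show thesis
  proof (rule that)
    fix v assume v: "v \<in> inner_verts"
    then have vG: "v \<in> verts G" by (simp add: inner_verts_def)
    have stiff: "0 \<le> stiffness v"
      unfolding stiffness_def using coeff incident_edges
      by (intro sum_nonneg) (smt (verit))
    have "(flux (F n) v)\<^sup>2 \<le> (stiffness v + 1) * d n" for n
    proof -
      define N where "N = flux (F n) v"
      \<comment> \<open>A nearly optimal step against the gradient \<open>N\<close>: it lowers the
        energy by at least \<open>N\<^sup>2 * s\<close>, yet the energy of \<open>F n\<close>
        exceeds the infimum by less than \<open>d n\<close>. The summand 1 avoids division by zero
        at an isolated vertex.\<close>
      define s where "s = 1 / (stiffness v + 1)"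
      have s: "0 < s" "s * stiffness v \<le> 1" using stiff by (auto simp: s_def field_simps)
      let ?g = "(F n)(v := F n v + (- (N * s)))"
      have "?g \<in> Adm"
      proof -
        have "{x. ?g x \<noteq> \<phi> x} \<subseteq> insert v {x. F n x \<noteq> \<phi> x}" by auto
        moreover have "finite (insert v {x. F n x \<noteq> \<phi> x})" "insert v {x. F n x \<noteq> \<phi> x} \<subseteq> inner_verts"
          using F(1)[of n] v by (auto simp: Adm_def)
        ultimately show ?thesis unfolding Adm_def mem_Collect_eq by (meson finite_subset subset_trans)
      qed
      from m_le[OF this] have "0 \<le> d n - 2 * (N * s) * N + (N * s)\<^sup>2 * stiffness v"
        using energy_update[OF fe[OF F(1)] vG, of n "- (N * s)"] F(2)[of n] by (simp add: N_def)
      also have "(N * s)\<^sup>2 * stiffness v = N\<^sup>2 * s * (s * stiffness v)" by (simp add: power2_eq_square)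
      also have "\<dots> \<le> N\<^sup>2 * s * 1" using s by (intro mult_left_mono) auto
      finally have "N\<^sup>2 * s \<le> d n" by (simp add: power2_eq_square algebra_simps)
      then show ?thesis using stiff by (simp add: N_def s_def field_simps)
    qed note bound = this
    have "(\<lambda>n. (flux (F n) v)\<^sup>2) \<longlonglongrightarrow> (flux f v)\<^sup>2"
      by (intro tendsto_intros flux_tendsto vG f)
    moreover have "(\<lambda>n. (stiffness v + 1) * d n) \<longlonglongrightarrow> (stiffness v + 1) * 0"
      by (intro tendsto_intros d_lim)
    ultimately have "(flux f v)\<^sup>2 \<le> (stiffness v + 1) * 0"
      by (rule LIMSEQ_le) (use bound in auto)
    then show "flux f v = 0" by simp
  next
    fix v assume v: "v \<notin> inner_verts"
    then have "F n v = \<phi> v" for n using F(1)[of n] by (auto simp: Adm_def)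
    then show "f v = \<phi> v" using f[of v] by (cases "v \<in> verts G") (auto simp: f_def LIMSEQ_const_iff)
  next
    fix e :: real assume e: "0 < e"
    then have "\<forall>\<^sub>F n in sequentially. d n < e\<^sup>2 / (2 * K)"
      using K by (intro order_tendstoD[OF d_lim]) auto
    then obtain n where n: "d n < e\<^sup>2 / (2 * K)" by (auto simp: eventually_sequentially)
    then have n': "K * (2 * d n) < e\<^sup>2" using K by (simp add: field_simps)
    \<comment> \<open>Where \<open>F n\<close> still equals \<open>\<phi>\<close>, the difference is
      \<open>f v - F n v\<close>, which is uniformly below \<open>e\<close>.\<close>
    have "{v \<in> verts G. e < \<bar>f v - \<phi> v\<bar>} \<subseteq> {v. F n v \<noteq> \<phi> v}"
    proof clarify
      fix v assume v: "v \<in> verts G" "e < \<bar>f v - \<phi> v\<bar>" "F n v = \<phi> v"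
      have "e\<^sup>2 < \<bar>f v - \<phi> v\<bar>\<^sup>2" using e v(2) by (intro power_strict_mono) auto
      also have "\<dots> = (F n v - f v)\<^sup>2" using v(3) by (simp add: power2_commute)
      finally show False using close[OF v(1), of n] n' by linarith
    qed
    moreover have "finite {v. F n v \<noteq> \<phi> v}" using F(1)[of n] by (simp add: Adm_def)
    ultimately show "finite {v \<in> verts G. e < \<bar>f v - \<phi> v\<bar>}" by (rule finite_subset)
  qed
qed

end

lemma edge_point_in_points:
  assumes "metric_graph G" "e \<in> edges G" "t \<in> {0..len G e}"
  shows "edge_point G e t \<in> points G"
  using assms by (cases e) (auto simp: edge_point_def points_def metric_graph_def)

lemma closed_separate_point:
  fixes C :: "'a::metric_space set"
  assumes "closed C" "x \<notin> C"
  obtains \<eta> where "0 < \<eta>" "\<And>y. y \<in> C \<Longrightarrow> \<eta> \<le> dist x y"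
proof -
  have "open (- C)" "x \<in> - C" using assms by auto
  then obtain \<eta> where "0 < \<eta>" "ball x \<eta> \<subseteq> - C" by (meson open_contains_ball)
  then have "\<eta> \<le> dist x y" if "y \<in> C" for y using that by (force simp: not_less[symmetric])
  then show thesis using that \<open>0 < \<eta>\<close> by blast
qed

lemma inner_in_points: "e \<in> edges G \<Longrightarrow> 0 < t \<Longrightarrow> t < len G e \<Longrightarrow> Inner e t \<in> points G"
  unfolding points_def by blast

lemma points_cases:
  assumes "p \<in> points G"
  obtains (Vertex) v where "v \<in> verts G" "p = Vertex v"
    | (Inner) e t where "e \<in> edges G" "0 < t" "t < len G e" "p = Inner e t"
  using assms by (auto simp: points_def)

section \<open>The path metric and the completion\<close>

text \<open>All lower bounds for the path metric below come from functions of this kind.\<close>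

definition edge_lipschitz :: "'v mgraph \<Rightarrow> ('v point \<Rightarrow> real) \<Rightarrow> bool" where
  "edge_lipschitz G h \<longleftrightarrow> (\<forall>e\<in>edges G. \<forall>s\<in>{0..len G e}. \<forall>t\<in>{0..len G e}.
     \<bar>h (edge_point G e t) - h (edge_point G e s)\<bar> \<le> \<bar>t - s\<bar>)"

lemma joined_lipschitz:
  assumes "joined G p l r" "edge_lipschitz G h"
  shows "\<bar>h r - h p\<bar> \<le> l"
  using assms
proof (induction rule: joined.induct)
  case (step p l e s t)
  have "\<bar>h (edge_point G e t) - h (edge_point G e s)\<bar> \<le> \<bar>t - s\<bar>"
    using step by (auto simp: edge_lipschitz_def)
  then show ?case using step by linarith
qed auto

lemma joined_nonneg: "joined G p l r \<Longrightarrow> 0 \<le> l"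
  by (induction rule: joined.induct) auto

locale completed_graph = locally_finite_graph G for G :: "'v mgraph" +
  fixes j :: "'v point \<Rightarrow> 'c::metric_space" and X :: "'c set"
  assumes conn: "graph_connected G"
    and completion: "is_completion G j X" and X_compact: "compact X"
begin

abbreviation P :: "'v \<times> 'v \<Rightarrow> real \<Rightarrow> 'c" where "P e t \<equiv> j (edge_point G e t)"

lemma vertex_in_points: "v \<in> verts G \<Longrightarrow> Vertex v \<in> points G"
  by (simp add: points_def)

lemma j_in_X: "p \<in> points G \<Longrightarrow> j p \<in> X"
  using completion by (auto simp: is_completion_def)

lemma P_in_X: "e \<in> edges G \<Longrightarrow> t \<in> {0..len G e} \<Longrightarrow> P e t \<in> X"
  using j_in_X edge_point_in_points[OF mg] by blast

lemma dist_j: "p \<in> points G \<Longrightarrow> r \<in> points G \<Longrightarrow> dist (j p) (j r) = Inf {l. joined G p l r}"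
  using completion by (auto simp: is_completion_def graph_dist_def)

lemma X_closure: "X \<subseteq> closure (j ` points G)"
  using completion by (auto simp: is_completion_def)

lemma dist_ge_lipschitz:
  assumes "edge_lipschitz G h" "p \<in> points G" "r \<in> points G"
  shows "\<bar>h r - h p\<bar> \<le> dist (j p) (j r)"
proof -
  have "{l. joined G p l r} \<noteq> {}" using conn assms by (auto simp: graph_connected_def)
  then have "\<bar>h r - h p\<bar> \<le> Inf {l. joined G p l r}"
    by (rule cInf_greatest) (use joined_lipschitz assms(1) in auto)
  then show ?thesis using dist_j assms by simp
qed

lemma dist_le_joined:
  assumes "joined G p l r" "p \<in> points G" "r \<in> points G"
  shows "dist (j p) (j r) \<le> l"
  unfolding dist_j[OF assms(2,3)] using assms(1) joined_nonneg
  by (intro cInf_lower bdd_belowI[of _ 0]) auto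

lemma dist_P_le:
  assumes "e \<in> edges G" "s \<in> {0..len G e}" "t \<in> {0..len G e}"
  shows "dist (P e s) (P e t) \<le> \<bar>t - s\<bar>"
proof (rule dist_le_joined)
  have "joined G (edge_point G e s) (0 + \<bar>t - s\<bar>) (edge_point G e t)"
    by (rule joined.step[OF joined.refl]) (use assms edge_point_in_points[OF mg] in auto)
  then show "joined G (edge_point G e s) \<bar>t - s\<bar> (edge_point G e t)" by simp
qed (use assms edge_point_in_points[OF mg] in auto)

lemma P_continuous: "e \<in> edges G \<Longrightarrow> continuous_on {0..len G e} (P e)"
  using dist_P_le
  by (intro lipschitz_on_continuous_on[of 1] lipschitz_onI) (auto simp: dist_real_def abs_minus_commute)

lemma P_compact: "e \<in> edges G \<Longrightarrow> compact (P e ` {0..len G e})"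
  by (intro compact_continuous_image P_continuous) auto

text \<open>The test function is a tent on \<open>e\<close> with peak at \<open>t\<close>, just
  narrow enough to vanish at both ends. A point closer than its height has a positive value and so
  lies inside \<open>e\<close>.\<close>

lemma near_inner:
  assumes e: "e \<in> edges G" "0 < t" "t < len G e" and p: "p \<in> points G"
    and d: "dist (j (Inner e t)) (j p) < min t (len G e - t)"
  obtains s where "p = Inner e s" "\<bar>s - t\<bar> \<le> dist (j (Inner e t)) (j p)"
proof -
  define \<epsilon> where "\<epsilon> = min t (len G e - t)"
  define h where "h p = (case p of Vertex v \<Rightarrow> 0 | Inner e' s \<Rightarrow> if e' = e then max 0 (\<epsilon> - \<bar>s - t\<bar>) else 0)"
    for p :: "'v point"
  have hP: "h (edge_point G e s) = max 0 (\<epsilon> - \<bar>s - t\<bar>)" if "s \<in> {0..len G e}" for s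
    using that e by (auto simp: h_def edge_point_def \<epsilon>_def)
  have hP': "h (edge_point G e' s) = 0" if "e' \<noteq> e" for e' s
    using that by (auto simp: h_def edge_point_def)
  have "edge_lipschitz G h"
    unfolding edge_lipschitz_def
  proof (intro ballI)
    fix e' s r assume *: "e' \<in> edges G" "s \<in> {0..len G e'}" "r \<in> {0..len G e'}"
    show "\<bar>h (edge_point G e' r) - h (edge_point G e' s)\<bar> \<le> \<bar>r - s\<bar>"
      using * by (cases "e' = e") (auto simp: hP hP')
  qed
  moreover have "Inner e t \<in> points G" using e by (rule inner_in_points)
  ultimately have "\<bar>h p - h (Inner e t)\<bar> \<le> dist (j (Inner e t)) (j p)"
    using p by (rule dist_ge_lipschitz)
  moreover have "h (Inner e t) = \<epsilon>" using e by (simp add: h_def \<epsilon>_def)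
  ultimately have *: "\<epsilon> - h p \<le> dist (j (Inner e t)) (j p)" "0 < h p" using d by (auto simp: \<epsilon>_def)
  show thesis
  proof (cases p)
    case (Inner e' s)
    then have "e' = e" "h p = \<epsilon> - \<bar>s - t\<bar>" using *(2) by (auto simp: h_def split: if_splits)
    then show thesis using that[of s] Inner *(1) by simp
  qed (use *(2) in \<open>simp add: h_def\<close>)
qed

text \<open>The 1 serves a vertex without edges, where the minimum would be over an empty
  set.\<close>

definition star_radius :: "'v \<Rightarrow> real" where
  "star_radius v = Min (insert 1 (len G ` incident G v))"

lemma star_radius_pos: "v \<in> verts G \<Longrightarrow> 0 < star_radius v"
  using mg by (auto simp: star_radius_def metric_graph_def incident_def)

lemma star_radius_le: "v \<in> verts G \<Longrightarrow> e \<in> incident G v \<Longrightarrow> star_radius v \<le> len G e"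
  using mg by (auto simp: star_radius_def metric_graph_def)

text \<open>The test function is the distance to \<open>v\<close> along the incident edges, cut off
  at \<open>star_radius v\<close>. This radius is at most every incident length, so the function has
  reached its cut-off at the far ends and continues as a constant.\<close>

lemma near_vertex:
  assumes v: "v \<in> verts G" and p: "p \<in> points G" and d: "dist (j (Vertex v)) (j p) < star_radius v"
  shows "p = Vertex v \<or> (\<exists>e\<in>incident G v. \<exists>s. p = Inner e s)"
proof -
  define \<epsilon> where "\<epsilon> = star_radius v"
  have \<epsilon>: "0 < \<epsilon>" using star_radius_pos[OF v] by (simp add: \<epsilon>_def)
  define h where "h p = (case p of Vertex w \<Rightarrow> if w = v then 0 else \<epsilon>
      | Inner e s \<Rightarrow> if e \<in> incident G v then min \<epsilon> (if v = fst e then s else len G e - s) else \<epsilon>)"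
    for p :: "'v point"
  have hP: "h (edge_point G e s) = (if e \<in> incident G v then min \<epsilon> (if v = fst e then s else len G e - s) else \<epsilon>)"
    if "e \<in> edges G" "s \<in> {0..len G e}" for e s
    using that \<epsilon> no_loop[OF that(1)] star_radius_le[OF v, of e] len_pos[OF that(1)]
    by (auto simp: h_def edge_point_def \<epsilon>_def incident_def)
  have "edge_lipschitz G h"
    unfolding edge_lipschitz_def by (auto simp: hP)
  then have "\<bar>h p - h (Vertex v)\<bar> \<le> dist (j (Vertex v)) (j p)"
    using vertex_in_points[OF v] p by (rule dist_ge_lipschitz)
  then have "h p < \<epsilon>" using d by (simp add: h_def \<epsilon>_def)
  then show ?thesis by (cases p) (auto simp: h_def split: if_splits)
qed

lemma j_inj: "inj_on j (points G)"
proof (rule inj_onI)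
  fix p r assume p: "p \<in> points G" and r: "r \<in> points G" and eq: "j p = j r"
  from p show "p = r"
  proof (cases rule: points_cases)
    case (Inner e t)
    then show ?thesis using near_inner[of e t r] r eq by force
  next
    case (Vertex v)
    show ?thesis
    proof (cases rule: points_cases[OF r])
      case (1 w)
      then show ?thesis using near_vertex[OF Vertex(1) r] Vertex star_radius_pos[OF Vertex(1)] eq by force
    next
      case (2 e t)
      then show ?thesis using near_inner[of e t p] p eq Vertex by force
    qed
  qed
qed

lemma P_inj:
  assumes "e \<in> edges G"
  shows "inj_on (P e) {0..len G e}"
proof (rule inj_onI)
  fix s t assume st: "s \<in> {0..len G e}" "t \<in> {0..len G e}" "P e s = P e t"
  then have "edge_point G e s = edge_point G e t"
    using inj_onD[OF j_inj] edge_point_in_points[OF mg assms] by blast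
  then show "s = t" using no_loop[OF assms] by (auto simp: edge_point_def split: if_splits)
qed

text \<open>Graph points are dense, so a closed set that catches those in an open ball catches the
  whole ball. This keeps ideal points away from graph points.\<close>

lemma ball_subset_closed:
  assumes "closed C" "\<And>p. p \<in> points G \<Longrightarrow> dist z (j p) < \<epsilon> \<Longrightarrow> j p \<in> C"
  shows "X \<inter> ball z \<epsilon> \<subseteq> C"
proof -
  have "X \<inter> ball z \<epsilon> \<subseteq> closure (j ` points G \<inter> ball z \<epsilon>)"
    using X_closure open_Int_closure_subset[OF open_ball, of z \<epsilon> "j ` points G"] by (auto simp: Int_commute)
  also have "\<dots> \<subseteq> C" by (rule closure_minimal[OF _ assms(1)]) (use assms(2) in auto)
  finally show ?thesis .
qed

lemma inner_in_edge: "e \<in> edges G \<Longrightarrow> Inner e t \<in> points G \<Longrightarrow> j (Inner e t) \<in> P e ` {0..len G e}"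
  by (rule image_eqI[of _ _ t]) (auto simp: points_def edge_point_def)

lemma ball_inner:
  assumes e: "e \<in> edges G" "0 < t" "t < len G e"
  shows "X \<inter> ball (j (Inner e t)) (min t (len G e - t)) \<subseteq> j ` {p \<in> points G. \<exists>s. p = Inner e s}"
proof -
  have "X \<inter> ball (j (Inner e t)) (min t (len G e - t)) \<subseteq> P e ` {0..len G e}"
  proof (rule ball_subset_closed[OF compact_imp_closed[OF P_compact[OF e(1)]]])
    fix p assume "p \<in> points G" "dist (j (Inner e t)) (j p) < min t (len G e - t)"
    then show "j p \<in> P e ` {0..len G e}" using near_inner[OF e] inner_in_edge[OF e(1)] by metis
  qed
  show ?thesis
  proof
    fix x assume x: "x \<in> X \<inter> ball (j (Inner e t)) (min t (len G e - t))"
    then obtain s where s: "s \<in> {0..len G e}" "x = P e s"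
      using \<open>X \<inter> _ \<subseteq> _\<close> by blast
    have p: "edge_point G e s \<in> points G" by (rule edge_point_in_points[OF mg e(1) s(1)])
    have "dist (j (Inner e t)) (P e s) < min t (len G e - t)" using x s(2) by simp
    then obtain r where "edge_point G e s = Inner e r" by (rule near_inner[OF e p])
    then show "x \<in> j ` {p \<in> points G. \<exists>s. p = Inner e s}" using p s(2) by blast
  qed
qed

text \<open>The vertex is inserted separately for the case without incident edges.\<close>

definition star :: "'v \<Rightarrow> 'c set" where
  "star v = insert (j (Vertex v)) (\<Union>e\<in>incident G v. P e ` {0..len G e})"

lemma star_closed: "v \<in> verts G \<Longrightarrow> closed (star v)"
  unfolding star_def using finite_incident P_compact
  by (intro closed_insert closed_UN) (auto simp: incident_def compact_imp_closed)

lemma star_subset: "v \<in> verts G \<Longrightarrow> star v \<subseteq> j ` points G"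
  unfolding star_def using vertex_in_points edge_point_in_points[OF mg] by (auto simp: incident_def)

lemma ball_vertex_star:
  assumes v: "v \<in> verts G"
  shows "X \<inter> ball (j (Vertex v)) (star_radius v) \<subseteq> star v"
proof (rule ball_subset_closed[OF star_closed[OF v]])
  fix p assume p: "p \<in> points G" "dist (j (Vertex v)) (j p) < star_radius v"
  show "j p \<in> star v"
    using near_vertex[OF v p]
  proof (elim disjE bexE exE)
    fix e s assume e: "e \<in> incident G v" "p = Inner e s"
    then have "e \<in> edges G" by (simp add: incident_def)
    then have "j p \<in> P e ` {0..len G e}" using inner_in_edge p(1) e(2) by blast
    then show ?thesis using e(1) unfolding star_def by blast
  qed (simp add: star_def)
qed

lemma ball_vertex:
  assumes v: "v \<in> verts G"
  shows "X \<inter> ball (j (Vertex v)) (star_radius v) \<subseteq>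
    j ` {p \<in> points G. p = Vertex v \<or> (\<exists>e\<in>incident G v. \<exists>s. p = Inner e s)}"
proof
  fix x assume x: "x \<in> X \<inter> ball (j (Vertex v)) (star_radius v)"
  then obtain p where p: "p \<in> points G" "x = j p" using ball_vertex_star[OF v] star_subset[OF v] by blast
  then have "p = Vertex v \<or> (\<exists>e\<in>incident G v. \<exists>s. p = Inner e s)"
    using x near_vertex[OF v p(1)] by simp
  then show "x \<in> j ` {p \<in> points G. p = Vertex v \<or> (\<exists>e\<in>incident G v. \<exists>s. p = Inner e s)}"
    using p by blast
qed

definition free_points :: "'v point set" where
  "free_points = points G - Vertex ` boundary_verts G"

lemma boundary_alt: "completion_boundary G j X = X - j ` free_points"
proof -
  have "j ` Vertex ` boundary_verts G \<subseteq> X" using j_in_X by (auto simp: boundary_verts_def points_def)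
  moreover have "Vertex ` boundary_verts G \<subseteq> points G" by (auto simp: boundary_verts_def points_def)
  ultimately show ?thesis
    using j_inj unfolding completion_boundary_def free_points_def inj_on_def by blast
qed

text \<open>The free points form an open subset of \<open>X\<close>: a small ball around an inner
  point stays inside its edge, and one around a vertex contains no other vertex.\<close>

lemma boundary_compact: "compact (completion_boundary G j X)"
proof -
  define R where "R p = (case p of Vertex v \<Rightarrow> star_radius v | Inner e t \<Rightarrow> min t (len G e - t))" for p
  have R: "0 < R p" "X \<inter> ball (j p) (R p) \<subseteq> j ` free_points" if p: "p \<in> free_points" for p
  proof -
    have "p \<in> points G" using p by (simp add: free_points_def)
    then have "0 < R p \<and> X \<inter> ball (j p) (R p) \<subseteq> j ` free_points"
    proof (cases rule: points_cases)
      case (Vertex v)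
      have "{p \<in> points G. p = Vertex v \<or> (\<exists>e\<in>incident G v. \<exists>s. p = Inner e s)} \<subseteq> free_points"
        using p Vertex by (auto simp: free_points_def)
      then have "j ` {p \<in> points G. p = Vertex v \<or> (\<exists>e\<in>incident G v. \<exists>s. p = Inner e s)} \<subseteq> j ` free_points"
        by (rule image_mono)
      with ball_vertex[OF Vertex(1)] show ?thesis
        using star_radius_pos[OF Vertex(1)] Vertex(2) unfolding R_def by simp
    next
      case (Inner e t)
      have "{p \<in> points G. \<exists>s. p = Inner e s} \<subseteq> free_points"
        by (auto simp: free_points_def)
      then have "j ` {p \<in> points G. \<exists>s. p = Inner e s} \<subseteq> j ` free_points" by (rule image_mono)
      with ball_inner[OF Inner(1-3)] show ?thesis using Inner unfolding R_def by simp
    qed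
    then show "0 < R p" "X \<inter> ball (j p) (R p) \<subseteq> j ` free_points" by auto
  qed
  have "completion_boundary G j X = X - (\<Union>p\<in>free_points. ball (j p) (R p))"
    unfolding boundary_alt using R by fastforce
  moreover have "open (\<Union>p\<in>free_points. ball (j p) (R p))" by auto
  ultimately show ?thesis using X_compact by (simp add: compact_diff)
qed

lemma boundary_subset: "completion_boundary G j X \<subseteq> X"
  by (auto simp: boundary_alt)

section \<open>Consequences of compactness: diameter, short edges and ideal points\<close>

definition D :: real where "D = diameter X"

lemma dist_le_D: "x \<in> X \<Longrightarrow> y \<in> X \<Longrightarrow> dist x y \<le> D"
  unfolding D_def using compact_imp_bounded[OF X_compact] by (rule diameter_bounded_bound)

lemma D_nonneg: "0 \<le> D"
  unfolding D_def using compact_imp_bounded[OF X_compact] by (rule diameter_ge_0)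

lemma inner_dist_ge:
  assumes "e \<in> edges G" "p \<in> points G" "\<And>s. p \<noteq> Inner e s"
  shows "len G e / 2 \<le> dist (j (Inner e (len G e / 2))) (j p)"
  using near_inner[of e "len G e / 2" p] assms len_pos[OF assms(1)] by (force simp: not_le[symmetric])

lemma len_le: "e \<in> edges G \<Longrightarrow> len G e \<le> 2 * D"
proof -
  assume e: "e \<in> edges G"
  have "Inner e (len G e / 2) \<in> points G" using e len_pos[OF e] by (intro inner_in_points) auto
  then have "len G e / 2 \<le> D"
    using inner_dist_ge[OF e vertex_in_points[OF edge_verts(1)[OF e]]] dist_le_D j_in_X
      vertex_in_points[OF edge_verts(1)[OF e]] by (meson order_trans point.distinct(1))
  then show "len G e \<le> 2 * D" by simp
qed

text \<open>Midpoints of distinct edges of length at least \<open>\<delta>\<close> are at least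
  \<open>\<delta> / 2\<close> apart, so infinitely many of them could have no convergent
  subsequence.\<close>

lemma finite_long_edges:
  assumes "0 < \<delta>"
  shows "finite {e \<in> edges G. \<delta> \<le> len G e}"
proof (rule ccontr)
  assume "infinite {e \<in> edges G. \<delta> \<le> len G e}"
  then obtain f :: "nat \<Rightarrow> 'v \<times> 'v" where f: "inj f" "range f \<subseteq> {e \<in> edges G. \<delta> \<le> len G e}"
    using infinite_countable_subset by blast
  then have fe: "f n \<in> edges G" "\<delta> \<le> len G (f n)" for n by auto
  define x where "x n = j (Inner (f n) (len G (f n) / 2))" for n
  have pt: "Inner (f n) (len G (f n) / 2) \<in> points G" for n
    using fe(1) len_pos[OF fe(1)] by (intro inner_in_points) auto
  then have "\<forall>n. x n \<in> X" using j_in_X by (simp add: x_def)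
  then obtain l r where lr: "strict_mono (r :: nat \<Rightarrow> nat)" "(x \<circ> r) \<longlonglongrightarrow> l"
    using X_compact unfolding compact_def by meson
  then have "Cauchy (x \<circ> r)" by (meson convergent_Cauchy convergent_def)
  then obtain N where N: "\<And>m n. m \<ge> N \<Longrightarrow> n \<ge> N \<Longrightarrow> dist (x (r m)) (x (r n)) < \<delta> / 2"
    using assms unfolding Cauchy_def by (metis comp_apply half_gt_zero)
  have "r N \<noteq> r (Suc N)" using strict_monoD[OF lr(1), of N "Suc N"] by simp
  then have "f (r N) \<noteq> f (r (Suc N))" using f(1) by (auto dest: injD)
  then have "\<delta> / 2 \<le> dist (x (r N)) (x (r (Suc N)))"
    using inner_dist_ge[OF fe(1)[of "r N"] pt[of "r (Suc N)"]] fe(2)[of "r N"] by (auto simp: x_def)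
  then show False using N[of N "Suc N"] by simp
qed

text \<open>The long edges are finitely many compact sets that miss \<open>x\<close>, so they have
  positive distance from it.\<close>

lemma near_ideal_short:
  assumes x: "x \<notin> j ` points G" and \<delta>: "0 < \<delta>"
  obtains \<eta> where "0 < \<eta>" "\<And>e t. e \<in> edges G \<Longrightarrow> t \<in> {0..len G e} \<Longrightarrow> dist x (P e t) < \<eta> \<Longrightarrow> len G e < \<delta>"
proof -
  let ?F = "{e \<in> edges G. \<delta> \<le> len G e}"
  let ?C = "\<Union>e\<in>?F. P e ` {0..len G e}"
  have "closed ?C" using finite_long_edges[OF \<delta>] P_compact by (intro closed_UN) (auto intro: compact_imp_closed)
  moreover have "x \<notin> ?C" using x edge_point_in_points[OF mg] by auto
  ultimately obtain \<eta> where \<eta>: "0 < \<eta>" "\<And>y. y \<in> ?C \<Longrightarrow> \<eta> \<le> dist x y"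
    by (rule closed_separate_point) blast
  have "len G e < \<delta>" if "e \<in> edges G" "t \<in> {0..len G e}" "dist x (P e t) < \<eta>" for e t
  proof (rule ccontr)
    assume "\<not> len G e < \<delta>"
    then have "P e t \<in> ?C" using that by (intro UN_I[of e] imageI) auto
    then show False using \<eta>(2) that(3) by fastforce
  qed
  then show thesis using that \<eta>(1) by blast
qed

text \<open>A graph point close enough to \<open>x\<close> lies on a short edge, whose ends are then
  close to \<open>x\<close> too.\<close>

lemma vertex_near_ideal:
  assumes x: "x \<in> X" "x \<notin> j ` points G" and \<delta>: "0 < \<delta>"
  obtains v where "v \<in> verts G" "dist x (j (Vertex v)) < \<delta>"
proof -
  obtain \<eta> where \<eta>: "0 < \<eta>" "\<And>e t. e \<in> edges G \<Longrightarrow> t \<in> {0..len G e} \<Longrightarrow> dist x (P e t) < \<eta> \<Longrightarrow> len G e < \<delta> / 2"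
    using near_ideal_short[OF x(2), of "\<delta> / 2"] \<delta> by auto
  have "x \<in> closure (j ` points G)" using x X_closure by auto
  then obtain p where p: "p \<in> points G" "dist (j p) x < min \<eta> (\<delta> / 2)"
    using \<eta>(1) \<delta> unfolding closure_approachable by (metis (no_types, lifting) half_gt_zero imageE min_less_iff_conj)
  from p(1) show thesis
  proof (cases rule: points_cases)
    case (Vertex v)
    then show thesis using that[of v] p \<delta> by (simp add: dist_commute)
  next
    case (Inner e t)
    then have Pt: "P e t = j p" "P e 0 = j (Vertex (fst e))" "t \<in> {0..len G e}" by (auto simp: edge_point_def)
    then have "len G e < \<delta> / 2" using \<eta>(2)[of e t] p Inner by (simp add: dist_commute)
    moreover have "dist (j p) (j (Vertex (fst e))) \<le> t"
      using dist_P_le[of e t 0] Pt Inner by simp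
    ultimately have "dist x (j (Vertex (fst e))) < \<delta>"
      using p(2) dist_triangle[of x "j (Vertex (fst e))" "j p"] Inner by (simp add: dist_commute)
    then show thesis using that edge_verts(1)[OF Inner(1)] by blast
  qed
qed

text \<open>The distance is an infimum of path lengths that need not be attained, so the diameter is
  relaxed by 1.\<close>

lemma reaches_all:
  assumes "v \<in> verts G" "w \<in> verts G"
  shows "reaches G v (D + 1) w"
proof -
  have p: "Vertex v \<in> points G" "Vertex w \<in> points G" using assms vertex_in_points by auto
  then have "Inf {l. joined G (Vertex w) l (Vertex v)} < D + 1"
    using dist_j[OF p(2,1)] dist_le_D[OF j_in_X[OF p(2)] j_in_X[OF p(1)]] by simp
  moreover have "{l. joined G (Vertex w) l (Vertex v)} \<noteq> {}" using conn p by (auto simp: graph_connected_def)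
  ultimately obtain l where l: "joined G (Vertex w) l (Vertex v)" "l < D + 1"
    using cInf_lessD[of "{l. joined G (Vertex w) l (Vertex v)}" "D + 1"] by auto
  then have "reaches G v l w" using joined_reaches[OF l(1) HOL.refl mg] by simp
  then show ?thesis using l(2) by (rule reaches_mono[OF _ less_imp_le])
qed

lemma verts_subset_closed:
  assumes "w \<in> Z" "w \<in> verts G"
    and step: "\<And>e. e \<in> edges G \<Longrightarrow> fst e \<in> Z \<longleftrightarrow> snd e \<in> Z"
  shows "verts G \<subseteq> Z"
proof
  fix v assume "v \<in> verts G"
  then obtain A l where "simple_walk G v A l w"
    using reaches_all[OF \<open>v \<in> verts G\<close> assms(2)] unfolding reaches_def by blast
  then show "v \<in> Z" using assms(1)
  proof (induction rule: simple_walk.induct)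
    case (cons_walk v' A l w u e)
    then show ?case using step[OF cons_walk.hyps(3)] by auto
  qed auto
qed

text \<open>A boundary vertex lies outside \<open>T\<close> by assumption; near an ideal point there
  are vertices closer to it than any in the finite set \<open>T\<close>.\<close>

lemma escape_vertex:
  assumes B: "completion_boundary G j X \<noteq> {}" and T: "finite T" "T \<subseteq> verts G - boundary_verts G"
  obtains w where "w \<in> verts G" "w \<notin> T"
proof -
  consider b where "b \<in> boundary_verts G" | x where "x \<in> X" "x \<notin> j ` points G"
    using B by (auto simp: completion_boundary_def)
  then show thesis
  proof cases
    case 1
    then show thesis using that[of b] T by (auto simp: boundary_verts_def)
  next
    case 2
    have "closed ((\<lambda>v. j (Vertex v)) ` T)" using T by (intro finite_imp_closed) auto
    moreover have "x \<notin> (\<lambda>v. j (Vertex v)) ` T" using 2 T vertex_in_points by auto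
    ultimately obtain \<eta> where \<eta>: "0 < \<eta>" "\<And>y. y \<in> (\<lambda>v. j (Vertex v)) ` T \<Longrightarrow> \<eta> \<le> dist x y"
      by (rule closed_separate_point) blast
    obtain v where "v \<in> verts G" "dist x (j (Vertex v)) < \<eta>" using vertex_near_ideal[OF 2 \<eta>(1)] .
    then show thesis using that \<eta>(2) by fastforce
  qed
qed

text \<open>\<open>P e\<close> is a continuous injection of a compact interval, so continuity in the
  coordinate is continuity on the edge. A small ball around a graph point meets \<open>X\<close>
  only within one edge or within a star, a finite union of closed pieces.\<close>

lemma continuous_at_graph_point:
  assumes cont: "\<And>e. e \<in> edges G \<Longrightarrow> continuous_on {0..len G e} (\<lambda>t. u (P e t))" and p: "p \<in> points G"
  shows "continuous (at (j p) within X) u"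
proof -
  have edge: "continuous_on (P e ` {0..len G e}) u" if e: "e \<in> edges G" for e
  proof -
    have "continuous_on (P e ` {0..len G e}) (inv_into {0..len G e} (P e))"
      by (rule continuous_on_inv[OF P_continuous[OF e]]) (simp_all add: inv_into_f_f[OF P_inj[OF e]])
    then have "continuous_on (P e ` {0..len G e}) (\<lambda>x. (\<lambda>t. u (P e t)) (inv_into {0..len G e} (P e) x))"
      by (rule continuous_on_compose2[OF cont[OF e]]) (auto intro: inv_into_into)
    then show ?thesis by (rule continuous_on_eq) (rule arg_cong[of _ _ u], rule f_inv_into_f)
  qed
  have "\<exists>\<epsilon> C. 0 < \<epsilon> \<and> X \<inter> ball (j p) \<epsilon> \<subseteq> C \<and> j p \<in> C \<and> continuous_on C u"
  proof (cases rule: points_cases[OF p])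
    case (1 v)
    have "continuous_on (star v) u"
      unfolding star_def using finite_incident[OF 1(1)] edge P_compact
      by (subst insert_is_Un, intro continuous_on_closed_Un continuous_on_closed_Union closed_UN)
         (auto simp: incident_def compact_imp_closed)
    then show ?thesis
      using ball_vertex_star[OF 1(1)] star_radius_pos[OF 1(1)] 1(2)
      by (intro exI[of _ "star_radius v"] exI[of _ "star v"]) (simp add: star_def)
  next
    case (2 e t)
    have "X \<inter> ball (j p) (min t (len G e - t)) \<subseteq> P e ` {0..len G e}"
      using ball_inner[OF 2(1-3)] inner_in_edge[OF 2(1)] 2(4) by auto
    moreover have "j p \<in> P e ` {0..len G e}" using inner_in_edge[OF 2(1)] p 2(4) by blast
    ultimately show ?thesis using edge[OF 2(1)] 2
      by (intro exI[of _ "min t (len G e - t)"] exI[of _ "P e ` {0..len G e}"]) auto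
  qed
  then obtain \<epsilon> C where \<epsilon>: "0 < \<epsilon>" "X \<inter> ball (j p) \<epsilon> \<subseteq> C" "j p \<in> C" "continuous_on C u" by blast
  have "continuous (at (j p) within C) u" using \<epsilon> by (simp add: continuous_on_eq_continuous_within)
  then have "continuous (at (j p) within (X \<inter> ball (j p) \<epsilon>)) u"
    using \<epsilon>(2) by (rule continuous_within_subset)
  moreover have "at (j p) within (X \<inter> ball (j p) \<epsilon>) = at (j p) within X"
    by (rule at_within_nhd[of _ "ball (j p) \<epsilon>"]) (use \<epsilon>(1) in auto)
  ultimately show ?thesis by (simp add: continuous_within)
qed

end

lemma edge_solution_cong:
  assumes "edge_solution L q u u'" "\<And>t. t \<in> {0..L} \<Longrightarrow> v t = u t"
  shows "edge_solution L q v u'"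
  unfolding edge_solution_def
proof (intro conjI ballI)
  fix t assume t: "t \<in> {0..L}"
  have "(u has_real_derivative u' t) (at t within {0..L})" using assms(1) t by (simp add: edge_solution_def)
  then show "(v has_real_derivative u' t) (at t within {0..L})"
    by (rule has_field_derivative_transform_within[OF _ zero_less_one t]) (simp add: assms(2))
next
  show "absolutely_continuous_on 0 L u'" using assms(1) by (simp add: edge_solution_def)
  have "AE t in lebesgue. t \<in> {0<..<L} \<longrightarrow> (u' has_real_derivative q t * u t) (at t)"
    using assms(1) by (simp add: edge_solution_def)
  then show "AE t in lebesgue. t \<in> {0<..<L} \<longrightarrow> (u' has_real_derivative q t * v t) (at t)"
    by eventually_elim (simp add: assms(2))
qed

lemma edge_solution_continuous: "edge_solution L q u u' \<Longrightarrow> continuous_on {0..L} u"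
  by (auto simp: edge_solution_def intro!: DERIV_continuous_on)

lemma q_harmonic_alt:
  "q_harmonic G q u \<longleftrightarrow>
     (\<forall>e\<in>edges G. \<exists>u'. edge_solution (len G e) (\<lambda>t. q (edge_point G e t)) (\<lambda>t. u (edge_point G e t)) u') \<and>
     (\<forall>v\<in>verts G. 2 \<le> card (incident G v) \<longrightarrow>
        (\<forall>e\<in>incident G v. ((\<lambda>t. u (coord_from G v e t)) \<longlongrightarrow> u (Vertex v)) (at_right 0)) \<and>
        (\<Sum>e\<in>incident G v. normal_deriv G u v e) = 0)"
  unfolding q_harmonic_def edge_solution_def by simp

section \<open>The Dirichlet problem\<close>

locale dirichlet_network = completed_graph G j X + network G \<alpha> \<beta> c Q
  for G :: "'v mgraph" and j :: "'v point \<Rightarrow> 'c::metric_space" and X :: "'c set"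
    and \<alpha> \<beta> c Q :: "'v \<times> 'v \<Rightarrow> real" +
  fixes q :: "'v point \<Rightarrow> real" and y1 y2 :: "'v \<times> 'v \<Rightarrow> real \<Rightarrow> real"
  assumes model: "e \<in> edges G \<Longrightarrow>
      edge_model (len G e) (\<lambda>t. q (edge_point G e t)) (y1 e) (y2 e) (\<alpha> e) (\<beta> e) (c e)"
    and Q_eq: "e \<in> edges G \<Longrightarrow> Q e = integral {0..len G e} (\<lambda>t. q (edge_point G e t))"
    and boundary_nonempty: "completion_boundary G j X \<noteq> {}"
begin

lemma model_ends:
  assumes "e \<in> edges G"
  shows "y1 e 0 = 1" "y1 e (len G e) = 0" "y2 e 0 = 0" "y2 e (len G e) = 1"
  using model[OF assms] by (auto simp: edge_model_def)

lemma model_bounds: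
  assumes "e \<in> edges G" "t \<in> {0..len G e}"
  shows "0 \<le> y1 e t" "0 \<le> y2 e t" "y1 e t + y2 e t \<le> 1" "1 - len G e * Q e \<le> y1 e t + y2 e t"
  using model[OF assms(1)] assms(2) Q_eq[OF assms(1)] by (auto simp: edge_model_def)

lemma model_solution:
  assumes "e \<in> edges G"
  obtains u' where "edge_solution (len G e) (\<lambda>t. q (edge_point G e t)) (\<lambda>t. a * y1 e t + b * y2 e t) u'"
  using model[OF assms] unfolding edge_model_def by blast

lemma model_unique:
  assumes "e \<in> edges G" "edge_solution (len G e) (\<lambda>t. q (edge_point G e t)) u u'"
  shows "t \<in> {0..len G e} \<Longrightarrow> u t = u 0 * y1 e t + u (len G e) * y2 e t"
    "u' 0 = c e * u (len G e) - \<alpha> e * u 0" "u' (len G e) = \<beta> e * u (len G e) - c e * u 0"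
  using model[OF assms(1)] assms(2) unfolding edge_model_def by blast+

abbreviation vals :: "('c \<Rightarrow> real) \<Rightarrow> 'v \<Rightarrow> real" where "vals u v \<equiv> u (j (Vertex v))"

text \<open>Harmonicity with the differential equation already solved on each edge
  (\<open>solution_iff\<close>). Each condition besides continuity is linear in finitely many point
  values, so differences and uniform limits inherit it.\<close>

definition solution :: "('c \<Rightarrow> real) \<Rightarrow> bool" where
  "solution u \<longleftrightarrow> continuous_on X u \<and>
     (\<forall>e\<in>edges G. \<forall>t\<in>{0..len G e}. u (P e t) = vals u (fst e) * y1 e t + vals u (snd e) * y2 e t) \<and>
     (\<forall>v\<in>inner_verts. flux (vals u) v = 0)"

lemma P_ends: "e \<in> edges G \<Longrightarrow> P e 0 = j (Vertex (fst e))" "e \<in> edges G \<Longrightarrow> P e (len G e) = j (Vertex (snd e))"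
  using len_pos[of e] by (auto simp: edge_point_def)

lemma normal_deriv_eq:
  assumes e: "e \<in> incident G v" and es: "edge_solution (len G e) (\<lambda>t. q (edge_point G e t)) (\<lambda>t. u (P e t)) u'"
  shows "normal_deriv G (\<lambda>p. u (j p)) v e =
    - (if v = fst e then \<alpha> e * vals u v - c e * vals u (snd e) else \<beta> e * vals u v - c e * vals u (fst e))"
proof -
  have eE: "e \<in> edges G" using e by (simp add: incident_def)
  let ?L = "len G e"
  have L: "0 < ?L" by (rule len_pos[OF eE])
  have der: "((\<lambda>t. u (P e t)) has_real_derivative u' t) (at t within {0..?L})" if "t \<in> {0..?L}" for t
    using es that by (simp add: edge_solution_def)
  have ends: "u' 0 = c e * vals u (snd e) - \<alpha> e * vals u (fst e)"
      "u' ?L = \<beta> e * vals u (snd e) - c e * vals u (fst e)"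
    using model_unique(2,3)[OF eE es] by (simp_all only: P_ends[OF eE])
  show ?thesis
  proof (cases "v = fst e")
    case True
    then have "normal_deriv G (\<lambda>p. u (j p)) v e = vector_derivative (\<lambda>t. u (P e t)) (at 0 within {0..?L})"
      by (simp add: normal_deriv_def coord_from_def)
    also have "\<dots> = u' 0"
      by (rule vector_derivative_within_closed_interval[OF L])
        (use der[of 0] L in \<open>auto simp: has_real_derivative_iff_has_vector_derivative\<close>)
    finally show ?thesis using True ends by simp
  next
    case False
    then have v: "v = snd e" using e by (auto simp: incident_def)
    have "normal_deriv G (\<lambda>p. u (j p)) v e = vector_derivative (\<lambda>t. u (P e (?L - t))) (at 0 within {0..?L})"
      using False by (simp add: normal_deriv_def coord_from_def)
    also have "\<dots> = - u' ?L"
    proof (rule vector_derivative_within_closed_interval[OF L])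
      have "((\<lambda>t. u (P e (?L - t))) has_real_derivative - u' ?L) (at 0 within {0..?L})"
        by (rule has_real_derivative_within_reflect[of "\<lambda>t. u (P e t)"]) (use der[of ?L] L in auto)
      then show "((\<lambda>t. u (P e (?L - t))) has_vector_derivative - u' ?L) (at 0 within {0..?L})"
        by (simp add: has_real_derivative_iff_has_vector_derivative)
    qed (use L in auto)
    finally show ?thesis using False v ends by simp
  qed
qed

lemma card_incident_cases:
  assumes "v \<in> inner_verts"
  shows "incident G v = {} \<or> 2 \<le> card (incident G v)"
proof -
  have "finite (incident G v)" "card (incident G v) \<noteq> 1"
    using assms finite_incident by (auto simp: inner_verts_def boundary_verts_def)
  then show ?thesis by (cases "card (incident G v)") auto
qed

lemma flux_eq_normal_derivs:
  assumes "\<And>e. e \<in> edges G \<Longrightarrow> \<exists>u'. edge_solution (len G e) (\<lambda>t. q (edge_point G e t)) (\<lambda>t. u (P e t)) u'"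
  shows "flux (vals u) v = - (\<Sum>e\<in>incident G v. normal_deriv G (\<lambda>p. u (j p)) v e)"
  unfolding flux_def sum_negf[symmetric]
proof (rule sum.cong[OF HOL.refl])
  fix e assume e: "e \<in> incident G v"
  then obtain u' where "edge_solution (len G e) (\<lambda>t. q (edge_point G e t)) (\<lambda>t. u (P e t)) u'"
    using assms incident_edges by blast
  from normal_deriv_eq[OF e this]
  show "(if v = fst e then \<alpha> e * vals u v - c e * vals u (snd e) else \<beta> e * vals u v - c e * vals u (fst e)) =
      - normal_deriv G (\<lambda>p. u (j p)) v e" by simp
qed

lemma solution_iff: "solution u \<longleftrightarrow> continuous_on X u \<and> q_harmonic G q (\<lambda>p. u (j p))"
proof
  assume s: "solution u"
  have ex: "\<exists>u'. edge_solution (len G e) (\<lambda>t. q (edge_point G e t)) (\<lambda>t. u (P e t)) u'" if e: "e \<in> edges G" for e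
  proof -
    obtain u' where "edge_solution (len G e) (\<lambda>t. q (edge_point G e t))
        (\<lambda>t. vals u (fst e) * y1 e t + vals u (snd e) * y2 e t) u'"
      using model_solution[OF e] .
    then have "edge_solution (len G e) (\<lambda>t. q (edge_point G e t)) (\<lambda>t. u (P e t)) u'"
      by (rule edge_solution_cong) (use s e in \<open>simp add: solution_def\<close>)
    then show ?thesis by blast
  qed
  have "q_harmonic G q (\<lambda>p. u (j p))"
    unfolding q_harmonic_alt
  proof (intro conjI ballI impI)
    fix v assume v: "v \<in> verts G" "2 \<le> card (incident G v)"
    then have "v \<in> inner_verts" by (simp add: inner_verts_def boundary_verts_def)
    then have "flux (vals u) v = 0" using s by (simp add: solution_def)
    then show "(\<Sum>e\<in>incident G v. normal_deriv G (\<lambda>p. u (j p)) v e) = 0"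
      using flux_eq_normal_derivs[OF ex] by simp
    fix e assume e: "e \<in> incident G v"
    then have eE: "e \<in> edges G" by (rule incident_edges)
    define k where "k t = (if v = fst e then t else len G e - t)" for t
    have "continuous_on {0..len G e} (\<lambda>t. u (P e t))"
      using ex[OF eE] edge_solution_continuous by blast
    then have "continuous_on {0..len G e} (\<lambda>t. (\<lambda>t. u (P e t)) (k t))"
      by (rule continuous_on_compose2) (cases "v = fst e"; auto simp: k_def intro!: continuous_intros)+
    then have "((\<lambda>t. u (P e (k t))) \<longlongrightarrow> u (P e (k 0))) (at 0 within {0..len G e})"
      using len_pos[OF eE] by (auto simp: continuous_on_def)
    moreover have "P e (k 0) = j (Vertex v)"
      using e P_ends[OF eE] by (auto simp: k_def incident_def)
    moreover have "at 0 within {0..len G e} = at_right 0"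
      using len_pos[OF eE] by (rule at_within_Icc_at_right)
    ultimately show "((\<lambda>t. u (j (coord_from G v e t))) \<longlongrightarrow> u (j (Vertex v))) (at_right 0)"
      by (simp add: coord_from_def k_def)
  qed (use ex in auto)
  then show "continuous_on X u \<and> q_harmonic G q (\<lambda>p. u (j p))" using s by (simp add: solution_def)
next
  assume h: "continuous_on X u \<and> q_harmonic G q (\<lambda>p. u (j p))"
  then have ex: "\<exists>u'. edge_solution (len G e) (\<lambda>t. q (edge_point G e t)) (\<lambda>t. u (P e t)) u'" if "e \<in> edges G" for e
    using that by (simp add: q_harmonic_alt)
  show "solution u"
    unfolding solution_def
  proof (intro conjI ballI)
    fix e t assume e: "e \<in> edges G" "t \<in> {0..len G e}"
    then obtain u' where "edge_solution (len G e) (\<lambda>t. q (edge_point G e t)) (\<lambda>t. u (P e t)) u'" using ex by blast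
    from model_unique(1)[OF e(1) this e(2)]
    show "u (P e t) = vals u (fst e) * y1 e t + vals u (snd e) * y2 e t" by (simp only: P_ends[OF e(1)])
  next
    fix v assume v: "v \<in> inner_verts"
    show "flux (vals u) v = 0"
    \<comment> \<open>\<open>q_harmonic\<close> imposes no vertex condition at degree 0, and there
      the flux is an empty sum.\<close>
    proof (cases "incident G v = {}")
      case False
      then have "2 \<le> card (incident G v)" using card_incident_cases[OF v] by simp
      then show ?thesis
        using h v flux_eq_normal_derivs[OF ex] by (simp add: q_harmonic_alt inner_verts_def)
    qed (simp add: flux_def)
  qed (use h in simp)
qed

lemma solution_diff:
  assumes "solution u" "solution w"
  shows "solution (\<lambda>x. u x - w x)"
  unfolding solution_def
proof (intro conjI ballI)
  fix v assume v: "v \<in> inner_verts"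
  show "flux (vals (\<lambda>x. u x - w x)) v = 0"
    using assms v flux_add[of 1 "vals u" "-1" "vals w" v] by (simp add: solution_def)
qed (use assms in \<open>auto simp: solution_def algebra_simps intro!: continuous_intros\<close>)

lemma solution_cong:
  assumes "solution u" "\<And>x. x \<in> X \<Longrightarrow> w x = u x"
  shows "solution w"
proof -
  have eq: "vals w v = vals u v" if "v \<in> verts G" for v
    using assms(2) j_in_X vertex_in_points[OF that] by simp
  have "flux (vals w) v = flux (vals u) v" if "v \<in> verts G" for v
    unfolding flux_def by (rule sum.cong) (use that eq edge_verts incident_edges in auto)
  moreover have "continuous_on X w" using assms continuous_on_cong[OF HOL.refl, of X w u] by (simp add: solution_def)
  ultimately show ?thesis
    using assms(1) P_in_X eq edge_verts unfolding solution_def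
    by (auto simp: assms(2) inner_verts_def)
qed

lemma solution_uniform_limit:
  assumes s: "\<And>n. solution (u n)" and lim: "uniform_limit X u w sequentially"
  shows "solution w"
  unfolding solution_def
proof (intro conjI ballI)
  show "continuous_on X w"
    using uniform_limit_theorem[OF _ lim] s by (auto simp: solution_def)
  have pt: "(\<lambda>n. u n x) \<longlonglongrightarrow> w x" if "x \<in> X" for x using lim that by (rule tendsto_uniform_limitI)
  have vpt: "(\<lambda>n. vals (u n) v) \<longlonglongrightarrow> vals w v" if "v \<in> verts G" for v
    by (rule pt[OF j_in_X[OF vertex_in_points[OF that]]])
  fix e t assume e: "e \<in> edges G" "t \<in> {0..len G e}"
  have "(\<lambda>n. vals (u n) (fst e) * y1 e t + vals (u n) (snd e) * y2 e t) \<longlonglongrightarrow>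
      vals w (fst e) * y1 e t + vals w (snd e) * y2 e t"
    by (intro tendsto_intros vpt edge_verts e)
  moreover have "(\<lambda>n. vals (u n) (fst e) * y1 e t + vals (u n) (snd e) * y2 e t) = (\<lambda>n. u n (P e t))"
    using s e by (simp add: solution_def)
  ultimately show "w (P e t) = vals w (fst e) * y1 e t + vals w (snd e) * y2 e t"
    using pt[OF P_in_X[OF e]] LIMSEQ_unique by metis
next
  have pt: "(\<lambda>n. u n x) \<longlonglongrightarrow> w x" if "x \<in> X" for x using lim that by (rule tendsto_uniform_limitI)
  fix v assume v: "v \<in> inner_verts"
  then have "(\<lambda>n. flux (vals (u n)) v) \<longlonglongrightarrow> flux (vals w) v"
    by (intro flux_tendsto pt j_in_X vertex_in_points) (auto simp: inner_verts_def)
  then show "flux (vals w) v = 0" using s v by (simp add: solution_def LIMSEQ_const_iff)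
qed

text \<open>At a positive maximum \<open>c e \<le> \<alpha> e\<close> and
  \<open>c e \<le> \<beta> e\<close> bound each summand of the flux below by \<open>c e\<close>
  times a nonnegative difference. A vanishing sum makes all these differences vanish.\<close>

lemma flux_zero_neighbour:
  assumes v: "v \<in> inner_verts" "flux f v = 0" and max: "\<And>w. w \<in> verts G \<Longrightarrow> f w \<le> f v" and pos: "0 < f v"
    and e: "e \<in> incident G v"
  shows "f (fst e) = f v" "f (snd e) = f v"
proof -
  let ?t = "\<lambda>e. if v = fst e then \<alpha> e * f v - c e * f (snd e) else \<beta> e * f v - c e * f (fst e)"
  have ge: "c e * (f v - f (snd e)) \<le> \<alpha> e * f v - c e * f (snd e)"
    "c e * (f v - f (fst e)) \<le> \<beta> e * f v - c e * f (fst e)"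
    "0 \<le> c e * (f v - f (snd e))" "0 \<le> c e * (f v - f (fst e))" if "e \<in> incident G v" for e
  proof -
    have eE: "e \<in> edges G" using that by (rule incident_edges)
    show "c e * (f v - f (snd e)) \<le> \<alpha> e * f v - c e * f (snd e)"
      "c e * (f v - f (fst e)) \<le> \<beta> e * f v - c e * f (fst e)"
      using mult_right_mono[OF coeff(2)[OF eE], of "f v"] mult_right_mono[OF coeff(3)[OF eE], of "f v"] pos
      by (simp_all add: right_diff_distrib)
    show "0 \<le> c e * (f v - f (snd e))" "0 \<le> c e * (f v - f (fst e))"
      using coeff(1)[OF eE] max edge_verts[OF eE] by simp_all
  qed
  have nn: "0 \<le> ?t e" if "e \<in> incident G v" for e
  proof (cases "v = fst e")
    case True
    show ?thesis unfolding if_P[OF True] by (rule order_trans[OF ge(3,1)[OF that]])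
  next
    case False
    show ?thesis unfolding if_not_P[OF False] by (rule order_trans[OF ge(4,2)[OF that]])
  qed
  have "finite (incident G v)" using v finite_incident by (simp add: inner_verts_def)
  then have z: "?t e = 0"
    using v(2) nn e unfolding flux_def by (subst (asm) sum_nonneg_eq_0_iff) auto
  have "0 < c e" using coeff(1) incident_edges[OF e] by blast
  then have "v = fst e \<Longrightarrow> f v = f (snd e)" "v \<noteq> fst e \<Longrightarrow> f v = f (fst e)"
    using z ge[OF e] by (auto simp: zero_le_mult_iff mult_le_0_iff)
  then show "f (fst e) = f v" "f (snd e) = f v"
    using e no_loop[OF incident_edges[OF e]] by (auto simp: incident_def)
qed

text \<open>A maximum above \<open>M\<close> is attained at a vertex, spreads along edges to all
  vertices, and so reaches the boundary: at a boundary vertex directly, at an ideal point by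
  continuity. A negative bound need not persist inside, since the potential pulls solutions towards
  0; hence \<open>0 \<le> M\<close>.\<close>

theorem maximum_principle:
  assumes s: "solution u" and M: "0 \<le> M" and B: "\<And>x. x \<in> completion_boundary G j X \<Longrightarrow> u x \<le> M" and x: "x \<in> X"
  shows "u x \<le> M"
proof (rule ccontr)
  assume "\<not> u x \<le> M"
  have cont: "continuous_on X u" using s by (simp add: solution_def)
  obtain x0 where x0: "x0 \<in> X" "\<And>y. y \<in> X \<Longrightarrow> u y \<le> u x0"
    using continuous_attains_sup[OF X_compact _ cont] x by blast
  define m where "m = u x0"
  have m: "M < m" "0 < m" using x0(2)[OF x] \<open>\<not> u x \<le> M\<close> M by (auto simp: m_def)
  have le: "vals u v \<le> m" if "v \<in> verts G" for v
    using x0(2) j_in_X vertex_in_points[OF that] by (simp add: m_def)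
  define Z where "Z = {v \<in> verts G. vals u v = m}"
  have "x0 \<in> j ` points G" using B[of x0] x0(1) m(1) by (force simp: completion_boundary_def m_def)
  then obtain p where p: "p \<in> points G" "x0 = j p" by blast
  have "\<exists>w. w \<in> Z"
  proof (cases rule: points_cases[OF p(1)])
    case (1 v)
    then show ?thesis using p(2) by (auto simp: Z_def m_def)
  next
    case (2 e t)
    let ?a = "vals u (fst e)" and ?b = "vals u (snd e)"
    have t: "t \<in> {0..len G e}" "P e t = x0" using 2 p by (auto simp: edge_point_def)
    have eq: "m = ?a * y1 e t + ?b * y2 e t" using s 2(1) t by (auto simp: solution_def m_def)
    have "?a = m \<or> ?b = m"
    proof (rule ccontr)
      assume ne: "\<not> (?a = m \<or> ?b = m)"
      \<comment> \<open>The weights \<open>y1\<close> and \<open>y2\<close> may sum to less than 1,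
        so the bound for the end values must also be nonnegative to bound the value between
        them.\<close>
      define k where "k = max 0 (max ?a ?b)"
      have k: "0 \<le> k" "?a \<le> k" "?b \<le> k" "k < m"
        using ne le[OF edge_verts(1)[OF 2(1)]] le[OF edge_verts(2)[OF 2(1)]] m by (auto simp: k_def)
      have "?a * y1 e t + ?b * y2 e t \<le> k * y1 e t + k * y2 e t"
        using model_bounds[OF 2(1) t(1)] k by (intro add_mono mult_right_mono) auto
      also have "\<dots> = k * (y1 e t + y2 e t)" by (simp add: distrib_left)
      also have "\<dots> \<le> k * 1" using model_bounds[OF 2(1) t(1)] k by (intro mult_left_mono) auto
      finally show False using eq k by simp
    qed
    then show ?thesis using edge_verts[OF 2(1)] by (auto simp: Z_def)
  qed
  then obtain w where w: "w \<in> Z" by blast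
  have nbr: "fst e \<in> Z \<and> snd e \<in> Z" if v: "v \<in> Z" and e: "e \<in> incident G v" for v e
  proof -
    have "v \<notin> boundary_verts G"
      using B[of "j (Vertex v)"] v m by (auto simp: Z_def completion_boundary_def)
    then have iv: "v \<in> inner_verts" using v by (simp add: Z_def inner_verts_def)
    then have "flux (vals u) v = 0" using s by (simp add: solution_def)
    from flux_zero_neighbour[OF iv this _ _ e] show ?thesis
      using v le m edge_verts[OF incident_edges[OF e]] by (simp add: Z_def)
  qed
  have all: "verts G \<subseteq> Z"
    by (rule verts_subset_closed[of w]) (use w nbr in \<open>auto simp: Z_def incident_def\<close>)
  consider b where "b \<in> boundary_verts G" | y where "y \<in> X" "y \<notin> j ` points G"
    using boundary_nonempty by (auto simp: completion_boundary_def)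
  then show False
  proof cases
    case 1
    then have "b \<in> Z" using all by (auto simp: boundary_verts_def)
    then show False using B[of "j (Vertex b)"] 1 m by (auto simp: Z_def completion_boundary_def)
  next
    case 2
    then have "u y < m" using B[of y] m by (force simp: completion_boundary_def)
    then obtain d where d: "0 < d" "\<And>z. z \<in> X \<Longrightarrow> dist z y < d \<Longrightarrow> dist (u z) (u y) < m - u y"
      using cont 2(1) unfolding continuous_on_iff by (metis diff_gt_0_iff_gt)
    obtain v where v: "v \<in> verts G" "dist y (j (Vertex v)) < d" using vertex_near_ideal[OF 2 d(1)] .
    then have "dist m (u y) < m - u y"
      using d(2)[of "j (Vertex v)"] all j_in_X vertex_in_points by (auto simp: Z_def dist_commute)
    then show False by (simp add: dist_real_def)
  qed
qed

text \<open>\<open>M = 0\<close> is uniqueness; positive \<open>M\<close> turns uniform closeness on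
  the boundary into uniform closeness on \<open>X\<close>.\<close>

lemma comparison:
  assumes "solution u" "solution w" "0 \<le> M" "\<And>x. x \<in> completion_boundary G j X \<Longrightarrow> \<bar>u x - w x\<bar> \<le> M" "x \<in> X"
  shows "\<bar>u x - w x\<bar> \<le> M"
proof -
  have "u x - w x \<le> M"
    by (rule maximum_principle[OF solution_diff[OF assms(1,2)] assms(3) _ assms(5)]) (use assms(4) in force)
  moreover have "w x - u x \<le> M"
    by (rule maximum_principle[OF solution_diff[OF assms(2,1)] assms(3) _ assms(5)]) (use assms(4) in force)
  ultimately show ?thesis by simp
qed

section \<open>Solutions for flat boundary data\<close>

definition flat :: "('c \<Rightarrow> real) set" where
  "flat = {\<phi>. continuous_on X \<phi> \<and>
     (\<exists>F. finite F \<and> (\<forall>e\<in>edges G - F. vals \<phi> (fst e) = vals \<phi> (snd e)))}"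

definition extend :: "('v \<Rightarrow> real) \<Rightarrow> 'v point \<Rightarrow> real" where
  "extend f p = (case p of Vertex v \<Rightarrow> f v | Inner e t \<Rightarrow> f (fst e) * y1 e t + f (snd e) * y2 e t)"

lemma extend_edge_point:
  "e \<in> edges G \<Longrightarrow> t \<in> {0..len G e} \<Longrightarrow> extend f (edge_point G e t) = f (fst e) * y1 e t + f (snd e) * y2 e t"
  by (auto simp: extend_def edge_point_def model_ends)

text \<open>The weights \<open>y1\<close> and \<open>y2\<close> fall short of a convex combination
  by at most \<open>len G e * Q e\<close>, which the constant \<open>k\<close> feels as the second
  error term.\<close>

lemma edge_value_close:
  assumes e: "e \<in> edges G" "t \<in> {0..len G e}" and ab: "\<bar>a - k\<bar> \<le> r" "\<bar>b - k\<bar> \<le> r"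
  shows "\<bar>a * y1 e t + b * y2 e t - k\<bar> \<le> r + \<bar>k\<bar> * (len G e * Q e)"
proof -
  note mb = model_bounds[OF e]
  have r: "0 \<le> r" using ab by linarith
  have "a * y1 e t + b * y2 e t - k = (a - k) * y1 e t + (b - k) * y2 e t - k * (1 - (y1 e t + y2 e t))"
    by (simp add: algebra_simps)
  also have "\<bar>\<dots>\<bar> \<le> \<bar>a - k\<bar> * y1 e t + \<bar>b - k\<bar> * y2 e t + \<bar>k\<bar> * (1 - (y1 e t + y2 e t))"
    using mb abs_triangle_ineq4[of "(a - k) * y1 e t + (b - k) * y2 e t" "k * (1 - (y1 e t + y2 e t))"]
      abs_triangle_ineq[of "(a - k) * y1 e t" "(b - k) * y2 e t"]
    by (simp add: abs_mult)
  also have "\<dots> \<le> r * y1 e t + r * y2 e t + \<bar>k\<bar> * (len G e * Q e)"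
    using mb ab by (intro add_mono mult_right_mono mult_left_mono) auto
  also have "r * y1 e t + r * y2 e t = r * (y1 e t + y2 e t)" by (simp add: distrib_left)
  also have "\<dots> \<le> r * 1" using mb r by (intro mult_left_mono) auto
  finally show ?thesis by simp
qed

theorem solution_flat_data:
  assumes \<phi>: "\<phi> \<in> flat"
  obtains u where "solution u" "\<And>x. x \<in> completion_boundary G j X \<Longrightarrow> u x = \<phi> x"
proof -
  have cont: "continuous_on X \<phi>" using \<phi> by (simp add: flat_def)
  obtain F where F: "finite F" "\<And>e. e \<in> edges G \<Longrightarrow> e \<notin> F \<Longrightarrow> vals \<phi> (fst e) = vals \<phi> (snd e)"
    using \<phi> by (auto simp: flat_def)
  obtain M where M: "\<And>x. x \<in> X \<Longrightarrow> \<bar>\<phi> x\<bar> \<le> M"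
    using compact_imp_bounded[OF compact_continuous_image[OF cont X_compact]] unfolding bounded_iff by auto
  have fe: "finite_energy (vals \<phi>)"
    by (rule finite_energy_eventually_flat[OF F M]) (auto intro: j_in_X vertex_in_points)
  have escape: "\<exists>w. w \<notin> T \<and> reaches G v (D + 1) w"
    if T: "finite T" "T \<subseteq> inner_verts" and v: "v \<in> verts G" for T v
  proof -
    obtain w where "w \<in> verts G" "w \<notin> T"
      using escape_vertex[OF boundary_nonempty T(1)] T(2) unfolding inner_verts_def by blast
    then show ?thesis using reaches_all[OF v] by blast
  qed
  obtain f where f: "\<And>v. v \<in> inner_verts \<Longrightarrow> flux f v = 0" "\<And>v. v \<notin> inner_verts \<Longrightarrow> f v = vals \<phi> v"
    "\<And>\<epsilon>. 0 < \<epsilon> \<Longrightarrow> finite {v \<in> verts G. \<epsilon> < \<bar>f v - vals \<phi> v\<bar>}"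
    by (rule energy_minimizer[OF fe _ escape]) (use D_nonneg in auto)
  define u where "u x = (if x \<in> j ` points G then extend f (inv_into (points G) j x) else \<phi> x)" for x
  have uj: "u (j p) = extend f p" if "p \<in> points G" for p
    using that by (simp add: u_def inv_into_f_f[OF j_inj])
  have uP: "u (P e t) = f (fst e) * y1 e t + f (snd e) * y2 e t" if "e \<in> edges G" "t \<in> {0..len G e}" for e t
    using uj[OF edge_point_in_points[OF mg that]] extend_edge_point[OF that] by simp
  have uv: "vals u v = f v" if "v \<in> verts G" for v
    using uj[OF vertex_in_points[OF that]] by (simp add: extend_def)
  have ideal: "continuous (at x within X) u" if x: "x \<in> X" "x \<notin> j ` points G" for x
    unfolding continuous_within_eps_delta
  proof (intro allI impI)
    fix \<epsilon> :: real assume "0 < \<epsilon>"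
    \<comment> \<open>The vertex values will cost \<open>2 * r\<close> and the defect of the weights
      inside an edge another \<open>r\<close>, in total less than \<open>\<epsilon>\<close>.\<close>
    define r where "r = \<epsilon> / 4"
    have r: "0 < r" using \<open>0 < \<epsilon>\<close> by (simp add: r_def)
    define k where "k = \<phi> x"
    have ux: "u x = k" using x by (simp add: u_def k_def)
    obtain \<eta>0 where \<eta>0: "0 < \<eta>0" "\<And>y. y \<in> X \<Longrightarrow> dist y x < \<eta>0 \<Longrightarrow> \<bar>\<phi> y - k\<bar> < r"
      using cont x(1) r unfolding continuous_on_iff k_def dist_real_def by metis
    \<comment> \<open>The vertices where \<open>f\<close> is not yet close to \<open>\<phi>\<close>
      are finitely many, and the ideal point \<open>x\<close> is none of them, so a ball around
      \<open>x\<close> avoids them.\<close>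
    let ?S = "(\<lambda>v. j (Vertex v)) ` {v \<in> verts G. r < \<bar>f v - vals \<phi> v\<bar>}"
    have "closed ?S" by (intro finite_imp_closed finite_imageI f(3) r)
    moreover have "x \<notin> ?S" using x(2) vertex_in_points by auto
    ultimately obtain \<eta>1 where \<eta>1: "0 < \<eta>1" "\<And>y. y \<in> ?S \<Longrightarrow> \<eta>1 \<le> dist x y"
      by (rule closed_separate_point) blast
    define \<eta> where "\<eta> = min \<eta>0 \<eta>1"
    have vert: "\<bar>f v - k\<bar> \<le> 2 * r" if v: "v \<in> verts G" "dist (j (Vertex v)) x < \<eta>" for v
    proof -
      have "\<bar>vals \<phi> v - k\<bar> < r"
        using \<eta>0(2)[of "j (Vertex v)"] v j_in_X vertex_in_points by (auto simp: \<eta>_def)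
      moreover have "\<not> \<eta>1 \<le> dist x (j (Vertex v))" using v(2) by (simp add: \<eta>_def dist_commute)
      then have "\<bar>f v - vals \<phi> v\<bar> \<le> r" using \<eta>1(2)[of "j (Vertex v)"] v(1) by force
      ultimately show ?thesis by linarith
    qed
    define T where "T = (\<Sum>\<^sub>\<infinity>e\<in>edges G. Q e)"
    have Q0: "0 \<le> Q e" if "e \<in> edges G" for e
      using coeff[OF that] by linarith
    have QT: "Q e \<le> T" if "e \<in> edges G" for e
      using finite_sum_le_infsum[OF Q_summable, of "{e}"] that Q0 by (simp add: T_def)
    have T0: "0 \<le> T" unfolding T_def by (rule infsum_nonneg) (rule Q0)
    \<comment> \<open>\<open>\<eta> / 2\<close> keeps both ends of an edge of length below
      \<open>\<delta>\<close> within \<open>\<eta>\<close> of \<open>x\<close>; the quotient makes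
      the defect term at most \<open>r\<close>, its summands 1 guarding against zero
      denominators.\<close>
    define \<delta> where "\<delta> = min (\<eta> / 2) (r / ((\<bar>k\<bar> + 1) * (T + 1)))"
    have "0 < \<eta>" using \<eta>0(1) \<eta>1(1) by (simp add: \<eta>_def)
    then have \<delta>: "0 < \<delta>" using r T0 by (simp add: \<delta>_def)
    obtain \<eta>2 where \<eta>2: "0 < \<eta>2" "\<And>e t. e \<in> edges G \<Longrightarrow> t \<in> {0..len G e} \<Longrightarrow> dist x (P e t) < \<eta>2 \<Longrightarrow> len G e < \<delta>"
      using near_ideal_short[OF x(2) \<delta>] by blast
    have kT: "\<bar>k\<bar> * (len G e * Q e) \<le> r" if e: "e \<in> edges G" "len G e < \<delta>" for e
    proof -
      have "\<bar>k\<bar> * (len G e * Q e) \<le> (\<bar>k\<bar> + 1) * (\<delta> * (T + 1))"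
        using e len_pos[OF e(1)] Q0[OF e(1)] QT[OF e(1)] T0 by (intro mult_mono) auto
      also have "\<dots> = \<delta> * ((\<bar>k\<bar> + 1) * (T + 1))" by simp
      also have "\<dots> \<le> r"
        using T0 by (subst pos_le_divide_eq[symmetric]) (auto simp: \<delta>_def)
      finally show ?thesis .
    qed
    show "\<exists>d>0. \<forall>y\<in>X. dist y x < d \<longrightarrow> dist (u y) (u x) < \<epsilon>"
    proof (intro exI[of _ "min \<eta>2 (\<eta> / 2)"] conjI ballI impI)
      show "0 < min \<eta>2 (\<eta> / 2)" using \<eta>2(1) \<open>0 < \<eta>\<close> by simp
      fix y assume y: "y \<in> X" "dist y x < min \<eta>2 (\<eta> / 2)"
      have "\<bar>u y - k\<bar> \<le> 3 * r"
      proof (cases "y \<in> j ` points G")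
        case False
        then show ?thesis using \<eta>0(2)[OF y(1)] y(2) r \<open>0 < \<eta>\<close> by (auto simp: u_def \<eta>_def)
      next
        case True
        then obtain p where p: "p \<in> points G" "y = j p" by blast
        show ?thesis
        proof (cases rule: points_cases[OF p(1)])
          case (1 v)
          then show ?thesis using vert[of v] uv[of v] p(2) y(2) r \<open>0 < \<eta>\<close> by auto
        next
          case (2 e t)
          then have t: "t \<in> {0..len G e}" "P e t = y" using p(2) by (auto simp: edge_point_def)
          have short: "len G e < \<delta>" using \<eta>2(2)[OF 2(1) t(1)] t(2) y(2) by (simp add: dist_commute)
          have near: "dist (P e s) x < \<eta>" if s: "s \<in> {0..len G e}" for s
          proof -
            have "dist (P e s) y \<le> \<bar>t - s\<bar>" using dist_P_le[OF 2(1) s t(1)] t(2) by simp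
            also have "\<dots> \<le> len G e" using s t(1) by auto
            also have "\<dots> < \<eta> / 2" using short by (simp add: \<delta>_def)
            finally show ?thesis using y(2) dist_triangle[of "P e s" x y] by simp
          qed
          have "\<bar>f (fst e) - k\<bar> \<le> 2 * r" "\<bar>f (snd e) - k\<bar> \<le> 2 * r"
            using vert[OF edge_verts(1)[OF 2(1)]] vert[OF edge_verts(2)[OF 2(1)]] near[of 0] near[of "len G e"]
              P_ends[OF 2(1)] len_pos[OF 2(1)] by auto
          from edge_value_close[OF 2(1) t(1) this] show ?thesis
            using uP[OF 2(1) t(1)] t(2) kT[OF 2(1) short] by simp
        qed
      qed
      then show "dist (u y) (u x) < \<epsilon>" using r ux by (simp add: dist_real_def r_def)
    qed
  qed
  have "continuous_on X u"
    unfolding continuous_on_eq_continuous_within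
  proof
    fix x assume x: "x \<in> X"
    show "continuous (at x within X) u"
    proof (cases "x \<in> j ` points G")
      case True
      have "continuous_on {0..len G e} (\<lambda>t. u (P e t))" if e: "e \<in> edges G" for e
      proof -
        obtain u' where "edge_solution (len G e) (\<lambda>t. q (edge_point G e t)) (\<lambda>t. f (fst e) * y1 e t + f (snd e) * y2 e t) u'"
          using model_solution[OF e] .
        then have "continuous_on {0..len G e} (\<lambda>t. f (fst e) * y1 e t + f (snd e) * y2 e t)"
          by (rule edge_solution_continuous)
        then show ?thesis by (rule continuous_on_eq) (simp add: uP[OF e])
      qed
      with True show ?thesis using continuous_at_graph_point[of u] by blast
    qed (use ideal x in blast)
  qed
  moreover have "flux (vals u) v = 0" if v: "v \<in> inner_verts" for v
  proof -
    have vG: "v \<in> verts G" using v by (simp add: inner_verts_def)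
    have "flux (vals u) v = flux f v"
      unfolding flux_def
      by (rule sum.cong[OF HOL.refl]) (simp add: uv[OF vG] uv[OF edge_verts(1)[OF incident_edges]] uv[OF edge_verts(2)[OF incident_edges]])
    then show ?thesis using f(1)[OF v] by simp
  qed
  ultimately have "solution u" using uP uv edge_verts by (simp add: solution_def)
  moreover have "u x = \<phi> x" if x: "x \<in> completion_boundary G j X" for x
  proof (cases "x \<in> j ` points G")
    case True
    then obtain b where b: "b \<in> boundary_verts G" "x = j (Vertex b)" using x by (auto simp: completion_boundary_def)
    then have "b \<in> verts G" "b \<notin> inner_verts" by (auto simp: inner_verts_def boundary_verts_def)
    then show ?thesis using uv f(2) b(2) by simp
  qed (simp add: u_def)
  ultimately show thesis using that by blast
qed

text \<open>Only finitely many edges come near a graph point, so cutting at finitely many graph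
  points can disturb flatness on finitely many edges only.\<close>

lemma isolating_radius:
  assumes p: "p \<in> points G"
  obtains \<rho> F where "0 < \<rho>" "finite F" "\<And>e t. e \<in> edges G \<Longrightarrow> t \<in> {0..len G e} \<Longrightarrow> dist (j p) (P e t) < \<rho> \<Longrightarrow> e \<in> F"
proof (cases rule: points_cases[OF p])
  case (1 v)
  show thesis
  proof (rule that[of "star_radius v" "incident G v"])
    fix e t assume e: "e \<in> edges G" "t \<in> {0..len G e}" "dist (j p) (P e t) < star_radius v"
    then have "edge_point G e t = Vertex v \<or> (\<exists>e'\<in>incident G v. \<exists>s. edge_point G e t = Inner e' s)"
      using near_vertex[OF 1(1) edge_point_in_points[OF mg e(1,2)]] 1(2) by simp
    then show "e \<in> incident G v" using e(1) by (auto simp: edge_point_def incident_def split: if_splits)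
  qed (use 1 star_radius_pos finite_incident in auto)
next
  case (2 e' r)
  show thesis
  proof (rule that[of "min r (len G e' - r)" "{e'}"])
    fix e t assume e: "e \<in> edges G" "t \<in> {0..len G e}" "dist (j p) (P e t) < min r (len G e' - r)"
    then obtain s where "edge_point G e t = Inner e' s"
      using near_inner[OF 2(1-3) edge_point_in_points[OF mg e(1,2)]] unfolding 2(4) by metis
    then show "e \<in> {e'}" by (auto simp: edge_point_def split: if_splits)
  qed (use 2 in auto)
qed

text \<open>A cut-off indicator of \<open>V\<close>. An edge that stays away from the cut points is
  connected, hence lies entirely in \<open>U\<close> or in \<open>V\<close>, and the function is
  constantly 0 or 1 on it.\<close>

lemma flat_separating:
  assumes wc: "weakly_connected G j X" and xy: "x \<in> X" "y \<in> X" "x \<noteq> y"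
  obtains \<phi> where "\<phi> \<in> flat" "\<phi> x \<noteq> \<phi> y"
proof -
  obtain W U V where W: "finite W" "W \<subseteq> j ` points G"
    and UV: "openin (top_of_set X) U" "openin (top_of_set X) V" "U \<inter> V = {}" "X - W = U \<union> V" "x \<in> U" "y \<in> V"
    using wc xy unfolding weakly_connected_def by meson
  have "\<exists>\<rho> F. 0 < \<rho> \<and> finite F \<and> (\<forall>e\<in>edges G. \<forall>t\<in>{0..len G e}. dist w (P e t) < \<rho> \<longrightarrow> e \<in> F)"
    if w: "w \<in> W" for w
  proof -
    obtain p where p: "p \<in> points G" "w = j p" using w W(2) by blast
    show ?thesis using isolating_radius[OF p(1)] unfolding p(2) by metis
  qed
  then obtain \<rho> F where \<rho>: "\<And>w. w \<in> W \<Longrightarrow> (0::real) < \<rho> w" and F: "\<And>w. w \<in> W \<Longrightarrow> finite (F w)"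
    "\<And>w e t. w \<in> W \<Longrightarrow> e \<in> edges G \<Longrightarrow> t \<in> {0..len G e} \<Longrightarrow> dist w (P e t) < \<rho> w \<Longrightarrow> e \<in> F w"
    by metis
  define g where "g z = (\<Prod>w\<in>W. min 1 (dist w z / \<rho> w))" for z
  \<comment> \<open>\<open>g\<close> is \<open>1\<close> away from small balls around the cut points and vanishes at them.\<close>
  define \<phi> where "\<phi> z = (if z \<in> V then g z else 0)" for z
  have g_cont: "continuous_on A g" for A
    unfolding g_def using \<rho> by (intro continuous_intros) force
  have g0: "g z = 0" if "z \<in> W" for z
    unfolding g_def by (rule prod_zero[OF W(1)]) (use that in force)
  \<comment> \<open>The closed sets \<open>X - U\<close> and \<open>X - V\<close> cover
    \<open>X\<close> and meet exactly in \<open>W\<close>, where \<open>g\<close> vanishes and the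
    two branches agree.\<close>
  have "continuous_on ((X - U) \<union> (X - V)) (\<lambda>z. if z \<in> V then g z else 0)"
  proof (rule continuous_on_cases_local[OF _ _ g_cont])
    have un: "(X - U) \<union> (X - V) = X" using UV(3) by auto
    show "closedin (top_of_set ((X - U) \<union> (X - V))) (X - U)" "closedin (top_of_set ((X - U) \<union> (X - V))) (X - V)"
      unfolding un using UV(1,2) by (auto intro: closedin_diff)
    fix z assume "z \<in> X - U \<and> z \<notin> V \<or> z \<in> X - V \<and> z \<in> V"
    then have "z \<in> W" using UV(4) by blast
    then show "g z = 0" by (rule g0)
  qed auto
  moreover have "(X - U) \<union> (X - V) = X" using UV(3) by auto
  ultimately have "continuous_on X \<phi>" by (simp add: \<phi>_def[abs_def])
  moreover have "vals \<phi> (fst e) = vals \<phi> (snd e)" if e: "e \<in> edges G" "e \<notin> (\<Union>w\<in>W. F w)" for e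
  proof -
    let ?E = "P e ` {0..len G e}"
    have far: "\<rho> w \<le> dist w (P e t)" if "w \<in> W" "t \<in> {0..len G e}" for w t
      using F(2)[OF that(1) e(1) that(2)] e(2) that(1) by (force simp: not_less[symmetric])
    have g1: "g (P e t) = 1" if "t \<in> {0..len G e}" for t
      unfolding g_def
    proof (rule prod.neutral, rule ballI)
      fix w assume w: "w \<in> W"
      then show "min 1 (dist w (P e t) / \<rho> w) = 1" using far[OF w that] \<rho>[OF w] by (simp add: min_def field_simps)
    qed
    have EW: "?E \<subseteq> U \<union> V"
    proof
      fix z assume "z \<in> ?E"
      then obtain t where t: "t \<in> {0..len G e}" "z = P e t" by blast
      have "z \<notin> W" using far[of z t] \<rho>[of z] t by auto
      then show "z \<in> U \<union> V" using UV(4) P_in_X[OF e(1) t(1)] t(2) by blast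
    qed
    obtain U0 V0 where UV0: "open U0" "U = X \<inter> U0" "open V0" "V = X \<inter> V0"
      using UV(1,2) by (auto simp: openin_open)
    have EX: "?E \<subseteq> X" using P_in_X[OF e(1)] by auto
    have "connected ?E" by (intro connected_continuous_image P_continuous e(1)) auto
    then have "U0 \<inter> ?E = {} \<or> V0 \<inter> ?E = {}"
      by (rule connectedD[OF _ UV0(1,3)]) (use UV0 UV(3) EX EW in auto)
    moreover have "j (Vertex (fst e)) \<in> ?E" "j (Vertex (snd e)) \<in> ?E"
      using P_ends[OF e(1)] len_pos[OF e(1)] by (metis atLeastAtMost_iff imageI less_imp_le order_refl)+
    moreover have "g (j (Vertex (fst e))) = 1" "g (j (Vertex (snd e))) = 1"
      using g1[of 0] g1[of "len G e"] P_ends[OF e(1)] len_pos[OF e(1)] by auto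
    ultimately show ?thesis using EW UV0 by (auto simp: \<phi>_def)
  qed
  moreover have "finite (\<Union>w\<in>W. F w)" using W(1) F(1) by blast
  ultimately have "\<phi> \<in> flat"
    unfolding flat_def by (intro CollectI conjI exI[of _ "\<Union>w\<in>W. F w"] ballI) auto
  moreover have "x \<notin> V" using UV(3,5) by blast
  then have "\<phi> x = 0" by (simp add: \<phi>_def)
  moreover have "\<phi> y \<noteq> 0"
  proof -
    have "y \<notin> W" using UV(4,6) by blast
    then have "0 < dist w y / \<rho> w" if "w \<in> W" for w using \<rho>[OF that] that by (cases "w = y") auto
    then have "0 < g y" unfolding g_def by (intro prod_pos) simp
    then show ?thesis using UV(6) by (simp add: \<phi>_def)
  qed
  ultimately show thesis using that by metis
qed

lemma flat_ring:
  assumes "weakly_connected G j X"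
  shows "function_ring_on flat (completion_boundary G j X)"
proof
  show "compact (completion_boundary G j X)" by (rule boundary_compact)
  show "continuous_on (completion_boundary G j X) f" if "f \<in> flat" for f
    using that boundary_subset by (auto simp: flat_def intro: continuous_on_subset)
  show "(\<lambda>x. f x + g x) \<in> flat" "(\<lambda>x. f x * g x) \<in> flat" if fg: "f \<in> flat" "g \<in> flat" for f g
  proof -
    obtain F where F: "finite F" "\<forall>e\<in>edges G - F. vals f (fst e) = vals f (snd e)" using fg by (auto simp: flat_def)
    obtain F' where F': "finite F'" "\<forall>e\<in>edges G - F'. vals g (fst e) = vals g (snd e)" using fg by (auto simp: flat_def)
    have "finite (F \<union> F')" "continuous_on X f" "continuous_on X g" using F F' fg by (auto simp: flat_def)
    moreover have "vals f (fst e) = vals f (snd e)" "vals g (fst e) = vals g (snd e)"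
      if "e \<in> edges G - (F \<union> F')" for e
      using F(2) F'(2) that by blast+
    ultimately show "(\<lambda>x. f x + g x) \<in> flat" "(\<lambda>x. f x * g x) \<in> flat"
      unfolding flat_def by (intro CollectI conjI continuous_intros exI[of _ "F \<union> F'"] ballI; simp)+
  qed
  show "(\<lambda>_. k) \<in> flat" for k by (auto simp: flat_def)
  show "\<exists>f\<in>flat. f x \<noteq> f y" if "x \<in> completion_boundary G j X" "y \<in> completion_boundary G j X" "x \<noteq> y" for x y
    using flat_separating[OF assms _ _ that(3)] that boundary_subset by blast
qed

theorem dirichlet_problem:
  assumes wc: "weakly_connected G j X" and U: "continuous_on (completion_boundary G j X) U"
  shows "\<exists>!u. u \<in> extensional X \<and> continuous_on X u \<and>
              (\<forall>x\<in>completion_boundary G j X. u x = U x) \<and> q_harmonic G q (\<lambda>p. u (j p))"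
proof -
  let ?B = "completion_boundary G j X"
  interpret R: function_ring_on flat ?B by (rule flat_ring[OF wc])
  define d where "d n = 1 / (real n + 1)" for n :: nat
  have d: "0 < d n" for n by (simp add: d_def)
  have d_lim: "d \<longlonglongrightarrow> 0" unfolding d_def by real_asymp
  have "\<exists>u. solution u \<and> (\<forall>x\<in>?B. \<bar>U x - u x\<bar> < d n)" for n
  proof -
    obtain \<phi> where \<phi>: "\<phi> \<in> flat" "\<forall>x\<in>?B. \<bar>U x - \<phi> x\<bar> < d n" using R.Stone_Weierstrass_basic[OF U d] by blast
    obtain u where "solution u" "\<And>x. x \<in> ?B \<Longrightarrow> u x = \<phi> x" using solution_flat_data[OF \<phi>(1)] by blast
    then show ?thesis using \<phi>(2) by auto
  qed
  then obtain u where u: "\<And>n. solution (u n)" "\<And>n x. x \<in> ?B \<Longrightarrow> \<bar>U x - u n x\<bar> < d n" by metis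
  have close: "\<bar>u n x - u m x\<bar> \<le> d n + d m" if "x \<in> X" for n m x
  proof (rule comparison[OF u(1) u(1) _ _ that])
    show "\<bar>u n x - u m x\<bar> \<le> d n + d m" if "x \<in> ?B" for x
      using u(2)[OF that, of n] u(2)[OF that, of m] by linarith
  qed (use d[of n] d[of m] in linarith)
  have "uniformly_Cauchy_on X u"
    unfolding uniformly_Cauchy_on_def
  proof (intro allI impI)
    fix e :: real assume "0 < e"
    then have "\<forall>\<^sub>F n in sequentially. d n < e / 2" by (intro order_tendstoD[OF d_lim]) auto
    then obtain N where N: "\<And>n. n \<ge> N \<Longrightarrow> d n < e / 2" by (auto simp: eventually_sequentially)
    have "dist (u m x) (u n x) < e" if "x \<in> X" "m \<ge> N" "n \<ge> N" for x m n
      using close[OF that(1), of m n] N[OF that(2)] N[OF that(3)] unfolding dist_real_def by linarith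
    then show "\<exists>M. \<forall>x\<in>X. \<forall>m\<ge>M. \<forall>n\<ge>M. dist (u m x) (u n x) < e" by blast
  qed
  then obtain w where w: "uniform_limit X u w sequentially"
    using Cauchy_uniformly_convergent uniformly_convergent_on_def by blast
  \<comment> \<open>Restricting fixes the values off \<open>X\<close>, so that uniqueness becomes an
    equality of functions on the whole type.\<close>
  have sw: "solution (restrict w X)"
    by (rule solution_cong[OF solution_uniform_limit[OF u(1) w]]) simp
  have wB: "w x = U x" if x: "x \<in> ?B" for x
  proof -
    have "(\<lambda>n. u n x) \<longlonglongrightarrow> w x" using w x boundary_subset by (intro tendsto_uniform_limitI[OF w]) auto
    moreover have "(\<lambda>n. u n x - U x) \<longlonglongrightarrow> 0"
    proof (rule Lim_null_comparison[OF _ d_lim])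
      show "\<forall>\<^sub>F n in sequentially. norm (u n x - U x) \<le> d n"
        using u(2)[OF x] by (intro always_eventually allI) (simp add: abs_minus_commute less_imp_le)
    qed
    then have "(\<lambda>n. u n x) \<longlonglongrightarrow> U x" by (rule LIM_zero_cancel)
    ultimately show ?thesis by (rule LIMSEQ_unique)
  qed
  show ?thesis
  proof (rule ex1I[of _ "restrict w X"])
    show "restrict w X \<in> extensional X \<and> continuous_on X (restrict w X) \<and>
        (\<forall>x\<in>?B. restrict w X x = U x) \<and> q_harmonic G q (\<lambda>p. restrict w X (j p))"
      using sw wB boundary_subset unfolding solution_iff by auto
  next
    fix v assume v: "v \<in> extensional X \<and> continuous_on X v \<and> (\<forall>x\<in>?B. v x = U x) \<and> q_harmonic G q (\<lambda>p. v (j p))"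
    then have sv: "solution v" by (simp add: solution_iff)
    show "v = restrict w X"
    proof (rule extensionalityI)
      fix x assume x: "x \<in> X"
      have "\<bar>v x - restrict w X x\<bar> \<le> 0"
        by (rule comparison[OF sv sw order_refl _ x]) (use v wB boundary_subset in auto)
      then show "v x = restrict w X x" by simp
    qed (use v in auto)
  qed
qed

end

section \<open>Integrability of the potential over the graph\<close>

lemma weighted_integrals_summable:
  fixes E :: "'a set" and q :: "'a \<Rightarrow> real \<Rightarrow> real" and \<omega> L :: "'a \<Rightarrow> real"
  assumes \<omega>: "\<forall>e\<in>E. 0 < \<omega> e" "\<omega> summable_on E"
    and L: "\<And>e. e \<in> E \<Longrightarrow> 0 \<le> L e" "\<And>e. e \<in> E \<Longrightarrow> L e \<le> K"
    and q: "\<And>e. e \<in> E \<Longrightarrow> q e absolutely_integrable_on {0..L e}" "\<And>e t. e \<in> E \<Longrightarrow> t \<in> {0..L e} \<Longrightarrow> 0 \<le> q e t"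
    and fin: "(\<Sum>\<^sub>\<infinity>e\<in>E. \<integral>\<^sup>+t\<in>{0..L e}. ennreal ((q e t / \<omega> e)\<^sup>2 * \<omega> e) \<partial>lebesgue) < \<infinity>"
  shows "(\<lambda>e. integral {0..L e} (q e)) summable_on E"
proof -
  define I where "I e = (\<integral>\<^sup>+t\<in>{0..L e}. ennreal ((q e t / \<omega> e)\<^sup>2 * \<omega> e) \<partial>lebesgue)" for e
  define S where "S = (\<Sum>\<^sub>\<infinity>e\<in>E. I e)"
  have S: "S < \<infinity>" using fin by (simp add: S_def I_def)
  have nn: "0 \<le> integral {0..L e} (q e)" if e: "e \<in> E" for e
    using q[OF e] by (intro Henstock_Kurzweil_Integration.integral_nonneg set_lebesgue_integral_eq_integral(1)) auto
  have le: "ennreal (2 * integral {0..L e} (q e)) \<le> I e + ennreal (\<omega> e * K)" if e: "e \<in> E" for e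
  proof -
    have w: "0 < \<omega> e" using \<omega> e by blast
    have qi: "(q e has_integral integral {0..L e} (q e)) {0..L e}"
      using q(1)[OF e] by (intro integrable_integral set_lebesgue_integral_eq_integral(1))
    have meas: "(\<lambda>t. q e t * indicator {0..L e} t) \<in> borel_measurable lebesgue"
      using has_integral_implies_lebesgue_measurable[OF qi] by (simp add: mult.commute)
    have "ennreal (2 * integral {0..L e} (q e)) = (\<integral>\<^sup>+t. ennreal (2 * q e t) * indicator {0..L e} t \<partial>lebesgue)"
      using nn_integral_has_integral_lebesgue'[OF _ has_integral_mult_right[OF qi, of 2]] q(2)[OF e]
      by (simp add: nn_integral_completion)
    also have "\<dots> \<le> (\<integral>\<^sup>+t. ennreal ((q e t / \<omega> e)\<^sup>2 * \<omega> e) * indicator {0..L e} t + ennreal (\<omega> e) * indicator {0..L e} t \<partial>lebesgue)"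
    proof (rule nn_integral_mono)
      fix t
      have "2 * q e t \<le> (q e t / \<omega> e)\<^sup>2 * \<omega> e + \<omega> e"
      proof -
        have "0 \<le> \<omega> e * (q e t / \<omega> e - 1)\<^sup>2" using w by simp
        also have "\<dots> = (q e t / \<omega> e)\<^sup>2 * \<omega> e + \<omega> e - 2 * q e t"
          using w by (simp add: power2_eq_square field_simps)
        finally show ?thesis by simp
      qed
      then have "ennreal (2 * q e t) \<le> ennreal ((q e t / \<omega> e)\<^sup>2 * \<omega> e + \<omega> e)"
        by (rule ennreal_leI)
      also have "\<dots> = ennreal ((q e t / \<omega> e)\<^sup>2 * \<omega> e) + ennreal (\<omega> e)"
        using w by (intro ennreal_plus) auto
      finally show "ennreal (2 * q e t) * indicator {0..L e} t \<le> ennreal ((q e t / \<omega> e)\<^sup>2 * \<omega> e) * indicator {0..L e} t + ennreal (\<omega> e) * indicator {0..L e} t"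
        by (simp add: indicator_def)
    qed
    also have "\<dots> = I e + (\<integral>\<^sup>+t. ennreal (\<omega> e) * indicator {0..L e} t \<partial>lebesgue)"
      unfolding I_def
    proof (rule nn_integral_add)
      \<comment> \<open>Measurability is known for \<open>q e\<close> on the edge only, so the
        indicator first goes inside the square.\<close>
      have "(\<lambda>t. ennreal ((q e t * indicator {0..L e} t / \<omega> e)\<^sup>2 * \<omega> e)) \<in> borel_measurable lebesgue"
        using meas by measurable
      moreover have "(\<lambda>t. ennreal ((q e t * indicator {0..L e} t / \<omega> e)\<^sup>2 * \<omega> e)) =
          (\<lambda>t. ennreal ((q e t / \<omega> e)\<^sup>2 * \<omega> e) * indicator {0..L e} t)"
        by (auto simp: fun_eq_iff indicator_def)
      ultimately show "(\<lambda>t. ennreal ((q e t / \<omega> e)\<^sup>2 * \<omega> e) * indicator {0..L e} t) \<in> borel_measurable lebesgue" by simp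
      have [measurable]: "{0..L e} \<in> sets lebesgue" by simp
      show "(\<lambda>t. ennreal (\<omega> e) * indicator {0..L e} t) \<in> borel_measurable lebesgue" by measurable
    qed
    also have "(\<integral>\<^sup>+t. ennreal (\<omega> e) * indicator {0..L e} t \<partial>lebesgue) = ennreal (\<omega> e) * ennreal (L e)"
      using L(1)[OF e] by (simp add: nn_integral_cmult_indicator)
    also have "\<dots> = ennreal (\<omega> e * L e)" using w L(1)[OF e] by (simp add: ennreal_mult)
    also have "\<dots> \<le> ennreal (\<omega> e * K)" using w L(2)[OF e] by (intro ennreal_leI mult_left_mono) auto
    finally show ?thesis by (simp add: add_left_mono)
  qed
  \<comment> \<open>If \<open>E\<close> is empty nothing forces \<open>0 \<le> K\<close>; the
    absolute value covers that case.\<close>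
  define T where "T = (\<Sum>\<^sub>\<infinity>e\<in>E. \<omega> e) * \<bar>K\<bar>"
  have bound: "(\<Sum>e\<in>F. integral {0..L e} (q e)) \<le> enn2real (S + ennreal T) / 2" if F: "finite F" "F \<subseteq> E" for F
  proof -
    have "ennreal (\<Sum>e\<in>F. 2 * integral {0..L e} (q e)) = (\<Sum>e\<in>F. ennreal (2 * integral {0..L e} (q e)))"
      using nn F by (intro sum_ennreal[symmetric]) auto
    also have "\<dots> \<le> (\<Sum>e\<in>F. I e + ennreal (\<omega> e * \<bar>K\<bar>))"
    proof (rule sum_mono)
      fix e assume "e \<in> F"
      then have e: "e \<in> E" using F by auto
      have "ennreal (\<omega> e * K) \<le> ennreal (\<omega> e * \<bar>K\<bar>)" using \<omega>(1) e by (intro ennreal_leI mult_left_mono) auto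
      then show "ennreal (2 * integral {0..L e} (q e)) \<le> I e + ennreal (\<omega> e * \<bar>K\<bar>)"
        using le[OF e] add_left_mono order_trans by blast
    qed
    also have "\<dots> = (\<Sum>e\<in>F. I e) + ennreal (\<Sum>e\<in>F. \<omega> e * \<bar>K\<bar>)"
      using \<omega>(1) F by (subst sum_ennreal[symmetric]) (auto simp: sum.distrib less_imp_le)
    also have "\<dots> \<le> S + ennreal T"
    proof (rule add_mono)
      show "(\<Sum>e\<in>F. I e) \<le> S"
        unfolding S_def by (subst nonneg_infsum_complete) (use F in \<open>auto intro!: SUP_upper\<close>)
      have "(\<Sum>e\<in>F. \<omega> e) \<le> (\<Sum>\<^sub>\<infinity>e\<in>E. \<omega> e)"
        by (rule finite_sum_le_infsum[OF \<omega>(2) F]) (use \<omega>(1) in \<open>auto simp: less_imp_le\<close>)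
      then show "ennreal (\<Sum>e\<in>F. \<omega> e * \<bar>K\<bar>) \<le> ennreal T"
        unfolding T_def sum_distrib_right[symmetric] by (intro ennreal_leI mult_right_mono) auto
    qed
    finally have "ennreal (\<Sum>e\<in>F. 2 * integral {0..L e} (q e)) \<le> S + ennreal T" .
    moreover have "S + ennreal T < top" using S by (simp add: less_top[symmetric])
    ultimately have "enn2real (ennreal (\<Sum>e\<in>F. 2 * integral {0..L e} (q e))) \<le> enn2real (S + ennreal T)"
      by (rule enn2real_mono)
    moreover have "0 \<le> (\<Sum>e\<in>F. 2 * integral {0..L e} (q e))"
      by (rule sum_nonneg) (use nn F in auto)
    ultimately have "(\<Sum>e\<in>F. 2 * integral {0..L e} (q e)) \<le> enn2real (S + ennreal T)"
      by (simp only: enn2real_ennreal)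
    then show ?thesis by (simp add: sum_distrib_left[symmetric])
  qed
  show ?thesis
    by (rule nonneg_bdd_above_summable_on)
      (use nn bound in \<open>auto intro!: bdd_aboveI[of _ "enn2real (S + ennreal T) / 2"]\<close>)
qed

theorem theorem2p7:
  fixes G :: "'v mgraph"
    and j :: "'v point \<Rightarrow> 'c::metric_space" and X :: "'c set"
    and \<omega> :: "'v \<times> 'v \<Rightarrow> real" and q :: "'v point \<Rightarrow> real" and U :: "'c \<Rightarrow> real"
  assumes "metric_graph G" and "graph_connected G"
    and "is_completion G j X" and "weakly_connected G j X" and "compact X"
    and "\<forall>e\<in>edges G. 0 < \<omega> e" and "\<omega> summable_on edges G"
    and "\<forall>p\<in>points G. 0 \<le> q p" and "locally_integrable G q"
    and "(\<Sum>\<^sub>\<infinity>e\<in>edges G. \<integral>\<^sup>+t\<in>{0..len G e}.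
            ennreal ((q (edge_point G e t) / \<omega> e)\<^sup>2 * \<omega> e) \<partial>lebesgue) < \<infinity>"
    and "completion_boundary G j X \<noteq> {}"
    and "continuous_on (completion_boundary G j X) U"
  shows "\<exists>!u. u \<in> extensional X \<and> continuous_on X u \<and>
              (\<forall>x\<in>completion_boundary G j X. u x = U x) \<and>
              q_harmonic G q (\<lambda>p. u (j p))"
proof -
  interpret completed_graph G j X
    by unfold_locales (use assms in auto)
  let ?q = "\<lambda>e t. q (edge_point G e t)"
  have ode: "edge_ode (len G e) (?q e)" if e: "e \<in> edges G" for e
  proof
    show "?q e absolutely_integrable_on {0..len G e}" using assms(9) e by (auto simp: locally_integrable_def)
    show "0 \<le> ?q e t" if "t \<in> {0..len G e}" for t
      using assms(8) edge_point_in_points[OF mg e that] by blast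
  qed (rule len_pos[OF e])
  define Q where "Q e = integral {0..len G e} (?q e)" for e
  have "\<forall>e\<in>edges G. \<exists>y1 y2 \<alpha> \<beta> c. edge_model (len G e) (?q e) y1 y2 \<alpha> \<beta> c"
    using edge_ode.edge_model_exists[OF ode] by blast
  then obtain y1 y2 \<alpha> \<beta> c where m: "\<And>e. e \<in> edges G \<Longrightarrow> edge_model (len G e) (?q e) (y1 e) (y2 e) (\<alpha> e) (\<beta> e) (c e)"
    by metis
  have Qs: "Q summable_on edges G"
    unfolding Q_def
  \<comment> \<open>Compactness enters through \<open>2 * D\<close> as the common bound for the edge
    lengths.\<close>
  proof (rule weighted_integrals_summable[OF assms(6,7) _ _ _ _ assms(10)])
    fix e assume e: "e \<in> edges G"
    show "0 \<le> len G e" using len_pos[OF e] by simp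
    show "len G e \<le> 2 * D" by (rule len_le[OF e])
    show "?q e absolutely_integrable_on {0..len G e}" using ode[OF e] by (simp add: edge_ode_def)
    show "0 \<le> ?q e t" if "t \<in> {0..len G e}" for t using ode[OF e] that by (simp add: edge_ode_def)
  qed
  interpret dirichlet_network G j X \<alpha> \<beta> c Q q y1 y2
  proof
    fix e a b assume e: "e \<in> edges G"
    show "(b - a)\<^sup>2 / len G e \<le> \<alpha> e * a\<^sup>2 - 2 * c e * a * b + \<beta> e * b\<^sup>2"
      using m[OF e] unfolding edge_model_def by blast
  qed (use m Qs assms(11) in \<open>auto simp: edge_model_def Q_def\<close>)
  show ?thesis by (rule dirichlet_problem[OF assms(4,12)])
qed

end
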